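(* For each $N$, let $(W_i)_{i\in\mathbb{N}}$ be independent random $N\times N$ matrices, $W_i$ having i.i.d. $\mathcal{N}(0,\sigma_i^2)$ entries with $\sigma_i>0$. Let $(G_i)_{i\ge1}$ be a sequence of connected product graphs such that all vertices have dimension $N$ and input $\mathbf{1}_N$ (all-ones vector), and each edge has as input either one of the matrices $W_\ell$ or the $N\times N$ matrix $\mathbf{I}$ with all entries equal to $1$. Then for any $m\ge1$, as $N\to\infty$, $$\Big(\big(\sigma_{G_i}N^{\check e(G_i)+\frac12}\big)^{-1}\mathbf{W}_{G_i}-|\mathcal{P}_{\mathrm{A}}(G_i)|\sqrt N\Big)_{i=1}^m\xrightarrow{d}\mathbf{Z}=(Z_1,\dots,Z_m)^\top,$$ where $\mathbf{Z}$ is a centred Gaussian vector with covariance $\mathbb{E}[\mathbf{Z}\mathbf{Z}^\top]_{i,j}=|\mathcal{P}_{\mathrm{B}}(G_i\sqcup G_j)|$.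
   Context: The underlying directed graphs and the labelling of edges by the indices $\ell$ do not depend on $N$; the $\sigma_i$ may. The value of a product graph $G=(V,E)$ (finite directed graph, each vertex $v$ with dimension $\mathfrak d(v)$ and input vector $\mathbf{X}_v\in\mathbb{R}^{\mathfrak d(v)}$, each edge $(u,v)$ with input matrix $\mathbf{X}_{(u,v)}\in\mathbb{R}^{\mathfrak d(u)\times\mathfrak d(v)}$) is $\mathbf{W}_G=\sum_{(i_v)\in\prod_v\{1,\dots,\mathfrak d(v)\}}\prod_{(u,v)\in E}[\mathbf{X}_{(u,v)}]_{i_ui_v}\prod_{w\in V}[\mathbf{X}_w]_{i_w}$. In an edge $(u,v)$, $u$ is the head and $v$ the tail. $E_{\mathcal{W}}(G)$ is the set of edges of $G$ whose input is some $W_\ell$ (then $\ell(e):=\ell$). $\sigma_G:=\prod_{e\in E_{\mathcal{W}}(G)}\sigma_{\ell(e)}$ and $\check e(G):=\frac12|E_{\mathcal{W}}(G)|+|E(G)\setminus E_{\mathcal{W}}(G)|$. An admissible pairing $\phi\in\mathcal{P}(G)$ is a partition of $E_{\mathcal{W}}(G)$ into pairs $\{e,e'\}$ with $\ell(e)=\ell(e')$; $G_\phi$ is the directed multigraph obtained by identifying paired edges head to head and tail to tail. "Tree" means that the underlying undirected multigraph is connected and has no cycles (loops and parallel edges count as cycles). For $G$ connected, $\mathcal{P}_{\mathrm{A}}(G)$ (atomic pairings) is the set of $\phi\in\mathcal{P}(G)$ such that $G_\phi$ is a tree. For the disjoint union of two connected graphs, $\mathcal{P}_{\mathrm{B}}(G_i\sqcup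 G_j)$ (bi-atomic pairings) is the set of $\phi\in\mathcal{P}(G_i\sqcup G_j)$ such that $(G_i\sqcup G_j)_\phi$ is a tree; when $i=j$, $G_i\sqcup G_i$ consists of two disjoint copies of $G_i$ with the same labels. *)

theory Defs
  imports
    "HOL-Probability.Probability"
    "HOL-Library.Disjoint_Sets"
    "Graph_Theory.Digraph_Component"
begin

section \<open>Product graphs and their values\<close>

text \<open>
  Graphs are the (multi)graphs of type \<^typ>\<open>('v, 'e) pre_digraph\<close>; an edge written \<open>(u, v)\<close> has
  \<open>u\<close> as its \<^const>\<open>head\<close> and \<open>v\<close> as its \<^const>\<open>tail\<close>, so the row index of its matrix sits at the
  head. Coordinates of vectors and matrices run over \<open>{1..d}\<close>; values outside are irrelevant.
\<close>

definition graph_value ::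
    "('v, 'e) pre_digraph \<Rightarrow> ('v \<Rightarrow> nat) \<Rightarrow> ('v \<Rightarrow> nat \<Rightarrow> real) \<Rightarrow> ('e \<Rightarrow> nat \<Rightarrow> nat \<Rightarrow> real) \<Rightarrow> real"
  where
  "graph_value G d x X =
     (\<Sum>i \<in> (\<Pi>\<^sub>E v\<in>verts G. {1..d v}).
        (\<Prod>e\<in>arcs G. X e (i (head G e)) (i (tail G e))) * (\<Prod>w\<in>verts G. x w (i w)))"

datatype edge_input = W_input (ell: nat) | Ones_input

fun input_matrix :: "(nat \<Rightarrow> nat \<Rightarrow> nat \<Rightarrow> real) \<Rightarrow> edge_input \<Rightarrow> nat \<Rightarrow> nat \<Rightarrow> real" where
  "input_matrix W (W_input l) = W l"
| "input_matrix W Ones_input = (\<lambda>_ _. 1)"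

definition W_arcs :: "('v, 'e) pre_digraph \<Rightarrow> ('e \<Rightarrow> edge_input) \<Rightarrow> 'e set" where
  "W_arcs G inp = {e \<in> arcs G. \<exists>l. inp e = W_input l}"

definition sigma_graph ::
    "(nat \<Rightarrow> real) \<Rightarrow> ('v, 'e) pre_digraph \<Rightarrow> ('e \<Rightarrow> edge_input) \<Rightarrow> real" where
  "sigma_graph \<sigma> G inp = (\<Prod>e\<in>W_arcs G inp. \<sigma> (ell (inp e)))"

definition e_check :: "('v, 'e) pre_digraph \<Rightarrow> ('e \<Rightarrow> edge_input) \<Rightarrow> real" where
  "e_check G inp = 1/2 * real (card (W_arcs G inp)) + real (card (arcs G - W_arcs G inp))"


section \<open>Pairings\<close>

definition admissible_pairings ::
    "('v, 'e) pre_digraph \<Rightarrow> ('e \<Rightarrow> edge_input) \<Rightarrow> 'e set set set" where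
  "admissible_pairings G inp =
     {\<phi>. partition_on (W_arcs G inp) \<phi> \<and>
         (\<forall>p\<in>\<phi>. \<exists>e e'. e \<noteq> e' \<and> p = {e, e'} \<and> ell (inp e) = ell (inp e'))}"

text \<open>
  The equivalence relation on vertices generated by gluing the heads and the tails of the edges
  in each block. It is symmetric because \<open>e\<close> and \<open>e'\<close> range over all ordered pairs from a block.
\<close>

definition glue :: "('v, 'e) pre_digraph \<Rightarrow> 'e set set \<Rightarrow> 'v rel" where
  "glue G \<phi> = ({(head G e, head G e') | e e' p. p \<in> \<phi> \<and> e \<in> p \<and> e' \<in> p} \<union>
               {(tail G e, tail G e') | e e' p. p \<in> \<phi> \<and> e \<in> p \<and> e' \<in> p})\<^sup>*"

text \<open>
  The graph \<open>G\<^sub>\<phi>\<close>: its vertices are the classes of \<^const>\<open>glue\<close>, its edges are the blocks of \<open>\<phi>\<close> and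
  the singletons of the remaining edges. The heads of all edges of a block lie in one class, so the
  image below is that class; likewise for the tails.
\<close>

definition glued_graph :: "('v, 'e) pre_digraph \<Rightarrow> 'e set set \<Rightarrow> ('v set, 'e set) pre_digraph" where
  "glued_graph G \<phi> =
     \<lparr> verts = verts G // glue G \<phi>,
       arcs = \<phi> \<union> {{e} | e. e \<in> arcs G - \<Union>\<phi>},
       tail = (\<lambda>p. glue G \<phi> `` (tail G ` p)),
       head = (\<lambda>p. glue G \<phi> `` (head G ` p)) \<rparr>"

text \<open>
  Cycles of the underlying undirected multigraph, where edge \<open>es ! k\<close> joins \<open>vs ! k\<close> and the
  cyclically next vertex. Length 1 is a loop and length 2 a pair of parallel edges. (The notions
  \<^const>\<open>forest\<close> and \<open>tree\<close> of the graph library only exclude directed cycles.)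
\<close>

definition undirected_cycle :: "('v, 'e) pre_digraph \<Rightarrow> 'v list \<Rightarrow> 'e list \<Rightarrow> bool" where
  "undirected_cycle G vs es \<longleftrightarrow>
     es \<noteq> [] \<and> length vs = length es \<and> distinct vs \<and> distinct es \<and> set es \<subseteq> arcs G \<and>
     (\<forall>k<length es. {tail G (es ! k), head G (es ! k)} = {vs ! k, vs ! (Suc k mod length es)})"

definition undirected_tree :: "('v, 'e) pre_digraph \<Rightarrow> bool" where
  "undirected_tree G \<longleftrightarrow>
     Digraph_Component.connected G \<and> (\<nexists>vs es. undirected_cycle G vs es)"

definition tree_pairings ::
    "('v, 'e) pre_digraph \<Rightarrow> ('e \<Rightarrow> edge_input) \<Rightarrow> 'e set set set" where
  "tree_pairings G inp = {\<phi> \<in> admissible_pairings G inp. undirected_tree (glued_graph G \<phi>)}"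

definition disjoint_union ::
    "('v, 'e) pre_digraph \<Rightarrow> ('w, 'f) pre_digraph \<Rightarrow> ('v + 'w, 'e + 'f) pre_digraph" where
  "disjoint_union G H =
     \<lparr> verts = verts G <+> verts H,
       arcs = arcs G <+> arcs H,
       tail = map_sum (tail G) (tail H),
       head = map_sum (head G) (head H) \<rparr>"

definition atomic_pairings ::
    "('v, 'e) pre_digraph \<Rightarrow> ('e \<Rightarrow> edge_input) \<Rightarrow> 'e set set set" where
  "atomic_pairings G inp = tree_pairings G inp"

definition biatomic_pairings ::
    "('v, 'e) pre_digraph \<Rightarrow> ('e \<Rightarrow> edge_input) \<Rightarrow> ('w, 'f) pre_digraph \<Rightarrow> ('f \<Rightarrow> edge_input) \<Rightarrow>
     ('e + 'f) set set set" where
  "biatomic_pairings G inp H inp' = tree_pairings (disjoint_union G H) (case_sum inp inp')"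


section \<open>Random matrices, Gaussian vectors, convergence in distribution\<close>

text \<open>
  \<open>W l \<omega> a b\<close> is the entry in row \<open>a\<close> and column \<open>b\<close> of the \<open>l\<close>-th matrix. The restriction to
  \<open>{1..N} \<times> {1..N}\<close> turns the matrix into a random element of a finite product of real lines.
\<close>

definition independent_gaussian_matrices ::
    "'a measure \<Rightarrow> nat \<Rightarrow> (nat \<Rightarrow> real) \<Rightarrow> (nat \<Rightarrow> 'a \<Rightarrow> nat \<Rightarrow> nat \<Rightarrow> real) \<Rightarrow> bool" where
  "independent_gaussian_matrices M N \<sigma> W \<longleftrightarrow>
     prob_space.indep_vars M (\<lambda>_. \<Pi>\<^sub>M ab\<in>{1..N} \<times> {1..N}. borel)
       (\<lambda>l \<omega>. \<lambda>(a, b)\<in>{1..N} \<times> {1..N}. W l \<omega> a b) UNIV \<and>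
     (\<forall>l. prob_space.indep_vars M (\<lambda>_. borel) (\<lambda>(a, b) \<omega>. W l \<omega> a b) ({1..N} \<times> {1..N}) \<and>
          (\<forall>a\<in>{1..N}. \<forall>b\<in>{1..N}.
             distributed M lborel (\<lambda>\<omega>. W l \<omega> a b) (normal_density 0 (\<sigma> l))))"

text \<open>The normal law on the real line with mean \<open>m\<close> and standard deviation \<open>s \<ge> 0\<close>.\<close>

definition normal_law :: "real \<Rightarrow> real \<Rightarrow> real measure" where
  "normal_law m s =
     (if s = 0 then return borel m else density lborel (\<lambda>x. ennreal (normal_density m s x)))"

definition gaussian_vector :: "'a measure \<Rightarrow> ('a \<Rightarrow> real ^ 'm) \<Rightarrow> bool" where
  "gaussian_vector P Z \<longleftrightarrow>
     Z \<in> borel_measurable P \<and>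
     (\<forall>t. \<exists>m. \<exists>s\<ge>0. distr P borel (\<lambda>\<omega>. t \<bullet> Z \<omega>) = normal_law m s)"

text \<open>
  Convergence in distribution of \<open>X N\<close>, defined on \<open>M N\<close>, to \<open>Z\<close>, defined on \<open>P\<close>.
  Measurability is included since the Bochner integral of a non-measurable function is \<open>0\<close>.
\<close>

definition converges_in_distribution ::
    "(nat \<Rightarrow> 'a measure) \<Rightarrow> (nat \<Rightarrow> 'a \<Rightarrow> 'c::topological_space) \<Rightarrow> 'b measure \<Rightarrow> ('b \<Rightarrow> 'c) \<Rightarrow> bool"
  where
  "converges_in_distribution M X P Z \<longleftrightarrow>
     (\<forall>\<^sub>F N in sequentially. X N \<in> borel_measurable (M N)) \<and> Z \<in> borel_measurable P \<and>
     (\<forall>f :: 'c \<Rightarrow> real. continuous_on UNIV f \<longrightarrow> bounded (range f) \<longrightarrow>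
        (\<lambda>N. \<integral>\<omega>. f (X N \<omega>) \<partial>M N) \<longlonglongrightarrow> (\<integral>\<omega>. f (Z \<omega>) \<partial>P))"

end

theory Submission
  imports Defs
begin

text \<open>
  By Wick's formula the expectation of the value of a graph is \<open>\<sigma>\<^sub>G\<close> times the sum over the admissible
  pairings \<open>\<phi>\<close> of \<open>N\<close> to the number of vertices of \<open>G\<^sub>\<phi>\<close>. A connected \<open>G\<^sub>\<phi>\<close> has at most one
  vertex more than edges, with equality exactly for trees. A mixed moment is the expectation of the
  value of a disjoint union of graphs; splitting the pairings by the components of the glued union
  expresses the moments through cumulants, which are sums over the pairings that glue the whole
  union together. After normalisation the cumulant of \<open>k\<close> graphs is of order \<open>N\<close> to the power
  \<open>1 - k/2\<close>: the first ones are the means, the second ones tend to the numbers of bi-atomic pairings,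
  and the others vanish. So the centred moments tend to those of the Gaussian vector, and
  the method of moments, applied to all linear forms, gives the convergence of the characteristic
  functions and hence of the laws.
\<close>

section \<open>Moments of the standard normal law\<close>

text \<open>The means can be of order sqrt N while the fluctuations are of order 1, so limits cannot
  be taken before centring. The recursion that peels one factor off a mixed moment is therefore
  centred exactly, for each N: the term with a first cumulant cancels against the subtracted mean,
  and only cumulants that have limits remain. Orders are read off by counting:
  \<open>e_check\<close> is the number of edges of the glued graph whatever the pairing, it is
  additive over the graphs, and connectivity allows one extra vertex for the whole union, whereas
  each graph brings its own factor sqrt N into the normalisation. That the numbers of bi-atomic
  pairings form a positive semidefinite matrix, without which there would be no Gaussian vector, is
  inherited from covariances at finite N. In the step from characteristic functions to laws, bounded
  second moments take the place of tightness: a bounded continuous function is approximated on the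
  whole space by a trigonometric polynomial with an error that grows like the squared norm.\<close>

definition gauss_moment :: "nat \<Rightarrow> real" where
  "gauss_moment n = (\<integral>x. std_normal_density x * x ^ n \<partial>lborel)"

lemma gauss_moment_even: "gauss_moment (2 * k) = fact (2 * k) / (2 ^ k * fact k)"
  unfolding gauss_moment_def by (rule integral_std_normal_moment_even)

lemma gauss_moment_odd: "odd n \<Longrightarrow> gauss_moment n = 0"
  using integral_std_normal_moment_odd by (auto simp: gauss_moment_def elim!: oddE)

lemma gauss_moment_0 [simp]: "gauss_moment 0 = 1"
  using gauss_moment_even[of 0] by simp

lemma gauss_moment_1 [simp]: "gauss_moment (Suc 0) = 0"
  by (rule gauss_moment_odd) simp

text \<open>This is the recursion for the number of pairings of n + 2 elements: a fixed element has
  n + 1 possible partners. Through it both pairing counts (\<open>card_pairings\<close>) and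
  limiting moments (\<open>wick_sum\<close>) are identified with Gaussian moments.\<close>

lemma gauss_moment_Suc_Suc: "gauss_moment (Suc (Suc n)) = real (Suc n) * gauss_moment n"
proof (cases "even n")
  case True
  then obtain k where k: "n = 2 * k" by (elim evenE)
  have f: "(fact (2 * Suc k) :: real) = (2 * real (Suc k)) * (real (Suc (2 * k)) * fact (2 * k))"
    by (simp add: algebra_simps)
  have g: "(2 ^ Suc k * fact (Suc k) :: real) = (2 * real (Suc k)) * (2 ^ k * fact k)"
    by (simp add: algebra_simps)
  have "gauss_moment (2 * Suc k) = fact (2 * Suc k) / (2 ^ Suc k * fact (Suc k))"
    by (rule gauss_moment_even)
  also have "\<dots> = ((2 * real (Suc k)) * (real (Suc (2 * k)) * fact (2 * k)))
      / ((2 * real (Suc k)) * (2 ^ k * fact k))"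
    unfolding f g ..
  also have "\<dots> = real (Suc (2 * k)) * (fact (2 * k) / (2 ^ k * fact k))"
    by (subst mult_divide_mult_cancel_left) (auto simp del: of_nat_Suc)
  finally show ?thesis
    by (simp only: k gauss_moment_even[symmetric] mult_Suc_right) simp
next
  case False
  then show ?thesis by (simp add: gauss_moment_odd)
qed

lemma integrable_std_normal_distribution_power:
  "integrable std_normal_distribution (\<lambda>x. x ^ k)"
  by (subst integrable_density) (use integrable_std_normal_moment in auto)

lemma integral_std_normal_distribution_power:
  "(\<integral>x. x ^ k \<partial>std_normal_distribution) = gauss_moment k"
  unfolding gauss_moment_def by (subst integral_density) auto

section \<open>The method of moments\<close>

text \<open>A Taylor estimate at the argument 1 of the characteristic function. As n is even, the
  absolute moment in the remainder is an ordinary moment, whose limit will be known.\<close>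

lemma (in prob_space) iexp_moment_approx:
  fixes Y :: "'a \<Rightarrow> real"
  assumes int: "\<And>k. integrable M (\<lambda>\<omega>. Y \<omega> ^ k)" and n: "even n"
  shows "cmod ((CLINT \<omega>|M. iexp (Y \<omega>)) - (\<Sum>k\<le>n. \<i> ^ k / fact k * expectation (\<lambda>\<omega>. Y \<omega> ^ k)))
           \<le> 2 / fact n * expectation (\<lambda>\<omega>. Y \<omega> ^ n)"
proof -
  have [measurable]: "Y \<in> borel_measurable M"
    using int[of 1] by (auto dest: borel_measurable_integrable)
  interpret D: real_distribution "distr M borel Y" by (rule real_distribution_distr) simp
  have "cmod (char (distr M borel Y) 1
          - (\<Sum>k\<le>n. (\<i> * (1::real)) ^ k / fact k * D.expectation (\<lambda>x. x ^ k)))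
        \<le> 2 * \<bar>1::real\<bar> ^ n / fact n * D.expectation (\<lambda>x. \<bar>x\<bar> ^ n)"
    by (rule D.char_approx1) (use int in \<open>simp add: integrable_distr_eq\<close>)
  moreover have "char (distr M borel Y) 1 = (CLINT \<omega>|M. iexp (Y \<omega>))"
    by (simp add: char_def integral_distr)
  ultimately show ?thesis
    using n by (simp add: integral_distr power_even_abs)
qed

text \<open>One Taylor remainder serves both \<open>Y N\<close> and the normal law. For the normal
  law it is a term of a convergent series, hence small for large n; for \<open>Y N\<close> it is
  then small for large N, because the n-th moment converges.\<close>

lemma moments_imp_char_tendsto:
  fixes Y :: "nat \<Rightarrow> 'a \<Rightarrow> real"
  assumes prob: "\<forall>\<^sub>F N in sequentially. prob_space (M N)"
    and int: "\<forall>\<^sub>F N in sequentially. \<forall>k. integrable (M N) (\<lambda>\<omega>. Y N \<omega> ^ k)"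
    and lim: "\<And>k. (\<lambda>N. \<integral>\<omega>. Y N \<omega> ^ k \<partial>M N) \<longlonglongrightarrow> s ^ k * gauss_moment k"
  shows "(\<lambda>N. CLINT \<omega>|M N. iexp (Y N \<omega>)) \<longlonglongrightarrow> complex_of_real (exp (- (s\<^sup>2) / 2))"
proof (rule LIMSEQ_I)
  fix r :: real assume r: "r > 0"
  define L where "L = complex_of_real (exp (- (s\<^sup>2) / 2))"
  define T where "T N n = (\<Sum>k\<le>n. \<i> ^ k / fact k * complex_of_real (\<integral>\<omega>. Y N \<omega> ^ k \<partial>M N))" for N n
  define U where "U n = (\<Sum>k\<le>n. \<i> ^ k / fact k * complex_of_real (s ^ k * gauss_moment k))" for n
  have U: "cmod (L - U n) \<le> 2 / fact n * (s ^ n * gauss_moment n)" if "even n" for n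
  proof -
    interpret S: real_distribution std_normal_distribution by (rule real_dist_normal_dist)
    have pw: "(\<lambda>x. (s * x) ^ k) = (\<lambda>x. s ^ k * x ^ k)" for k by (simp add: power_mult_distrib)
    have "cmod ((CLINT x|std_normal_distribution. iexp (s * x))
            - (\<Sum>k\<le>n. \<i> ^ k / fact k * S.expectation (\<lambda>x. (s * x) ^ k)))
          \<le> 2 / fact n * S.expectation (\<lambda>x. (s * x) ^ n)"
      by (rule S.iexp_moment_approx)
        (use that integrable_std_normal_distribution_power in \<open>simp_all add: pw\<close>)
    moreover have "(CLINT x|std_normal_distribution. iexp (s * x)) = L"
      using char_std_normal_distribution unfolding char_def L_def by meson
    ultimately show ?thesis
      unfolding U_def pw by (simp add: integral_std_normal_distribution_power)
  qed
  \<comment> \<open>The factorial in the Gaussian moment cancels the one in the Taylor remainder;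
    twice a term of the exponential series at s^2 / 2 is left.\<close>
  have e: "2 / fact (2 * m) * (s ^ (2 * m) * gauss_moment (2 * m)) = 2 * ((s\<^sup>2 / 2) ^ m /\<^sub>R fact m)" for m
    unfolding gauss_moment_even power_mult by (simp add: power_divide divide_simps)
  have "(\<lambda>m. (s\<^sup>2 / 2) ^ m /\<^sub>R fact m) \<longlonglongrightarrow> 0"
    by (rule summable_LIMSEQ_zero) (rule summable_exp_generic)
  then have "(\<lambda>m. 2 * ((s\<^sup>2 / 2) ^ m /\<^sub>R fact m)) \<longlonglongrightarrow> 2 * 0" by (intro tendsto_intros)
  then have "\<forall>\<^sub>F m in sequentially. 2 * ((s\<^sup>2 / 2) ^ m /\<^sub>R fact m) < r / 4"
    by (rule order_tendstoD) (use r in auto)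
  then obtain m where m: "2 * ((s\<^sup>2 / 2) ^ m /\<^sub>R fact m) < r / 4"
    by (auto simp: eventually_sequentially)
  define n where "n = 2 * m"
  have n: "even n" "2 / fact n * (s ^ n * gauss_moment n) < r / 4"
    using m e[of m] by (auto simp: n_def)
  have "(\<lambda>N. T N n) \<longlonglongrightarrow> U n"
    unfolding T_def U_def by (intro tendsto_intros lim)
  then have "\<forall>\<^sub>F N in sequentially. dist (T N n) (U n) < r / 4"
    by (rule tendstoD) (use r in auto)
  moreover have "(\<lambda>N. 2 / fact n * (\<integral>\<omega>. Y N \<omega> ^ n \<partial>M N)) \<longlonglongrightarrow> 2 / fact n * (s ^ n * gauss_moment n)"
    by (intro tendsto_intros lim)
  then have "\<forall>\<^sub>F N in sequentially. 2 / fact n * (\<integral>\<omega>. Y N \<omega> ^ n \<partial>M N) < r / 4"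
    by (rule order_tendstoD) (use n in auto)
  ultimately have "\<forall>\<^sub>F N in sequentially. norm ((CLINT \<omega>|M N. iexp (Y N \<omega>)) - L) < r"
    using prob int
  proof eventually_elim
    case (elim N)
    interpret prob_space "M N" by fact
    have "cmod ((CLINT \<omega>|M N. iexp (Y N \<omega>)) - T N n) \<le> 2 / fact n * expectation (\<lambda>\<omega>. Y N \<omega> ^ n)"
      unfolding T_def by (rule iexp_moment_approx) (use elim n in auto)
    with elim(2) have a: "cmod ((CLINT \<omega>|M N. iexp (Y N \<omega>)) - T N n) < r / 4" by simp
    have b: "cmod (T N n - U n) < r / 4" using elim(1) by (simp add: dist_norm)
    have c: "cmod (U n - L) < r / 4" using U[OF n(1)] n(2) by (simp add: norm_minus_commute)
    have "cmod ((CLINT \<omega>|M N. iexp (Y N \<omega>)) - L) \<le>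
        cmod ((CLINT \<omega>|M N. iexp (Y N \<omega>)) - T N n) + cmod (T N n - U n) + cmod (U n - L)"
      by norm
    with a b c r show ?case by linarith
  qed
  then show "\<exists>no. \<forall>N\<ge>no. norm ((CLINT \<omega>|M N. iexp (Y N \<omega>)) - L) < r"
    by (simp add: eventually_sequentially)
qed

section \<open>Convergence in distribution from characteristic functions\<close>

inductive trig_polynomial :: "('c::real_inner \<Rightarrow> complex) \<Rightarrow> bool" where
  iexp: "trig_polynomial (\<lambda>x. c * iexp (t \<bullet> x))"
| add: "trig_polynomial f \<Longrightarrow> trig_polynomial g \<Longrightarrow> trig_polynomial (\<lambda>x. f x + g x)"

lemma trig_polynomial_const: "trig_polynomial (\<lambda>x. c)"
  using trig_polynomial.iexp[of c 0] by simp

lemma trig_polynomial_sum: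
  "finite A \<Longrightarrow> (\<And>a. a \<in> A \<Longrightarrow> trig_polynomial (f a)) \<Longrightarrow> trig_polynomial (\<lambda>x. \<Sum>a\<in>A. f a x)"
  by (induction A rule: finite_induct) (auto intro: trig_polynomial_const trig_polynomial.add)

lemma trig_polynomial_mult:
  assumes "trig_polynomial f" "trig_polynomial g"
  shows "trig_polynomial (\<lambda>x. f x * g x)"
  using assms(1)
proof induction
  case (iexp c t)
  show ?case using assms(2)
  proof induction
    case (iexp d u)
    have "(\<lambda>x. c * iexp (t \<bullet> x) * (d * iexp (u \<bullet> x))) = (\<lambda>x. (c * d) * iexp ((t + u) \<bullet> x))"
      by (simp add: inner_add_left distrib_left exp_add mult_ac)
    then show ?case by (simp only: trig_polynomial.iexp)
  next
    case (add f g)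
    then show ?case by (simp add: distrib_left trig_polynomial.add)
  qed
next
  case (add f g)
  then show ?case by (simp add: distrib_right trig_polynomial.add)
qed

lemma trig_polynomial_sin: "trig_polynomial (\<lambda>x. complex_of_real (sin (t \<bullet> x)))"
proof -
  have "(\<lambda>x. complex_of_real (sin (t \<bullet> x))) =
        (\<lambda>x. (1 / (2 * \<i>)) * iexp (t \<bullet> x) + (- 1 / (2 * \<i>)) * iexp ((- t) \<bullet> x))"
    by (auto simp: sin_of_real[symmetric] sin_exp_eq field_simps)
  then show ?thesis by (simp only: trig_polynomial.intros)
qed

text \<open>A bounded periodic map that tends to the identity as \<open>R \<rightarrow> \<infinity>\<close>; composing a polynomial with
  it gives a trigonometric polynomial.\<close>

definition sin_map :: "real \<Rightarrow> 'c::euclidean_space \<Rightarrow> 'c" where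
  "sin_map R x = (\<Sum>b\<in>Basis. (R * sin ((b /\<^sub>R R) \<bullet> x)) *\<^sub>R b)"

lemma trig_polynomial_sin_map:
  fixes p :: "'c::euclidean_space \<Rightarrow> real"
  assumes "real_polynomial_function p"
  shows "trig_polynomial (\<lambda>x. complex_of_real (p (sin_map R x)))"
  using assms
proof induction
  case (linear f)
  then interpret bounded_linear f .
  have "(\<lambda>x. complex_of_real (f (sin_map R x))) =
        (\<lambda>x. \<Sum>b\<in>Basis. complex_of_real (R * f b) * complex_of_real (sin ((b /\<^sub>R R) \<bullet> x)))"
    by (simp add: sin_map_def sum scaleR mult_ac)
  then show ?case
    by (simp only:) (intro trig_polynomial_sum trig_polynomial_mult trig_polynomial_const
        trig_polynomial_sin finite_Basis)
qed (auto intro: trig_polynomial_const trig_polynomial.add trig_polynomial_mult)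

text \<open>Confines \<open>sin_map R\<close> to one compact ball, so that a polynomial close to f
  on this ball stays close after composition at every point of the space.\<close>

lemma norm_sin_map_le:
  assumes "R > 0"
  shows "norm (sin_map R (x::'c::euclidean_space)) \<le> R * DIM('c)"
proof -
  have "norm (sin_map R x) \<le> (\<Sum>b\<in>(Basis::'c set). R)"
    unfolding sin_map_def
    by (rule sum_norm_le) (use assms in \<open>simp add: abs_mult mult_left_le\<close>)
  then show ?thesis by (simp add: mult.commute)
qed

lemma norm_sin_map_diff_le:
  fixes x :: "'c::euclidean_space"
  assumes "R > 0" "norm x \<le> K"
  shows "norm (sin_map R x - x) \<le> DIM('c) * (K\<^sup>2 / (2 * R))"
proof -
  \<comment> \<open>As sin has no quadratic term, an argument of order 1 / R, scaled back by R,
    leaves an error of order 1 / R.\<close>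
  have sinb: "\<bar>sin v - v\<bar> \<le> v\<^sup>2 / 2" for v :: real
    using Maclaurin_sin_bound[of v 2] by (simp add: numeral_2_eq_2 sin_coeff_def)
  have "sin_map R x - x = (\<Sum>b\<in>Basis. (R * sin ((b /\<^sub>R R) \<bullet> x) - x \<bullet> b) *\<^sub>R b)"
    by (simp add: sin_map_def scaleR_diff_left sum_subtractf euclidean_representation)
  also have "norm \<dots> \<le> (\<Sum>b\<in>(Basis::'c set). K\<^sup>2 / (2 * R))"
  proof (rule sum_norm_le)
    fix b :: 'c assume b: "b \<in> Basis"
    define v where "v = (b /\<^sub>R R) \<bullet> x"
    have v: "x \<bullet> b = R * v" using assms by (simp add: v_def inner_commute)
    have "\<bar>x \<bullet> b\<bar> \<le> K" using Basis_le_norm[OF b, of x] assms by linarith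
    then have "(R * v)\<^sup>2 \<le> K\<^sup>2" unfolding v by (metis abs_ge_zero power2_abs power_mono)
    have "\<bar>R * sin v - R * v\<bar> = R * \<bar>sin v - v\<bar>"
      using assms by (simp add: abs_mult right_diff_distrib[symmetric])
    also have "\<dots> \<le> R * (v\<^sup>2 / 2)" using assms sinb by (intro mult_left_mono) auto
    also have "\<dots> = (R * v)\<^sup>2 / (2 * R)" using assms by (simp add: power2_eq_square field_simps)
    also have "\<dots> \<le> K\<^sup>2 / (2 * R)" using assms \<open>(R * v)\<^sup>2 \<le> K\<^sup>2\<close> by (intro divide_right_mono) auto
    finally show "norm ((R * sin ((b /\<^sub>R R) \<bullet> x) - x \<bullet> b) *\<^sub>R b) \<le> K\<^sup>2 / (2 * R)"
      unfolding v v_def[symmetric] using b by simp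
  qed
  finally show ?thesis by (simp add: mult.commute)
qed

text \<open>Near the origin \<open>sin_map R\<close> is close to the identity and f is uniformly
  continuous; far out only the boundedness of f is used, and the weight
  \<open>(norm x)\<^sup>2\<close> absorbs it. Stone-Weierstrass replaces f by a polynomial on a ball
  containing the range of \<open>sin_map R\<close>.\<close>

lemma trig_polynomial_approx:
  fixes f :: "'c::euclidean_space \<Rightarrow> real"
  assumes cont: "continuous_on UNIV f" and bd: "\<And>x. \<bar>f x\<bar> \<le> B" and \<eta>: "\<eta> > 0"
  shows "\<exists>g. continuous_on UNIV g \<and> bounded (range g) \<and> trig_polynomial (\<lambda>x. complex_of_real (g x)) \<and>
           (\<forall>x. \<bar>f x - g x\<bar> \<le> \<eta> * (1 + (norm x)\<^sup>2))"
proof -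
  have B: "B \<ge> 0" using bd[of 0] by linarith
  \<comment> \<open>Outside the ball of radius K the trivial bound 2 B is at most half of the weight
    \<open>\<eta> * (norm x)\<^sup>2\<close>; the summand 1 keeps K positive when B = 0.\<close>
  define K where "K = sqrt (4 * B / \<eta>) + 1"
  have K: "K > 0" "2 * B / K\<^sup>2 \<le> \<eta> / 2"
  proof -
    show "K > 0" using B \<eta> by (simp add: K_def add_nonneg_pos)
    have "4 * B / \<eta> = (sqrt (4 * B / \<eta>))\<^sup>2" using B \<eta> by simp
    also have "\<dots> \<le> K\<^sup>2" unfolding K_def using B \<eta> by (intro power_mono) auto
    finally have "4 * B / \<eta> \<le> K\<^sup>2" .
    with \<open>K > 0\<close> \<eta> show "2 * B / K\<^sup>2 \<le> \<eta> / 2" by (simp add: field_simps)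
  qed
  \<comment> \<open>The radius is K + 1 because \<open>sin_map R\<close> will move points of the
    ball of radius K by less than 1.\<close>
  have "uniformly_continuous_on (cball 0 (K + 1)) f"
    using cont by (intro compact_uniformly_continuous) (auto intro: continuous_on_subset)
  then obtain \<delta> where \<delta>: "\<delta> > 0"
      "\<And>x y. norm x \<le> K + 1 \<Longrightarrow> norm y \<le> K + 1 \<Longrightarrow> dist y x < \<delta> \<Longrightarrow> dist (f y) (f x) < \<eta> / 2"
    using \<eta> unfolding uniformly_continuous_on_def by (auto dest!: spec[of _ "\<eta> / 2"])
  define D where "D = real (DIM('c)) * K\<^sup>2"
  \<comment> \<open>Makes the displacement D / (2 R) on the ball of radius K smaller than both 1 and
    \<open>\<delta>\<close>.\<close>
  define R where "R = D / min 1 \<delta> + 1"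
  have D: "D \<ge> 0" by (simp add: D_def)
  have R: "R > 0" "D / (2 * R) < min 1 \<delta>"
  proof -
    show "R > 0" using D \<delta> by (simp add: R_def add_nonneg_pos)
    have "D < min 1 \<delta> * R" using \<delta>(1) by (simp add: R_def field_simps)
    moreover have "0 < min 1 \<delta> * R" using \<open>R > 0\<close> \<delta>(1) by simp
    ultimately have "D < min 1 \<delta> * (2 * R)" by linarith
    then show "D / (2 * R) < min 1 \<delta>" using \<open>R > 0\<close> by (subst pos_divide_less_eq) auto
  qed
  obtain p where p: "real_polynomial_function p"
      "\<And>y. y \<in> cball 0 (R * DIM('c)) \<Longrightarrow> \<bar>f y - p y\<bar> < \<eta> / 2"
    using Stone_Weierstrass_real_polynomial_function[of "cball 0 (R * DIM('c))" f "\<eta> / 2"] \<eta> cont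
    by (metis compact_cball continuous_on_subset half_gt_zero subset_UNIV)
  define g where "g x = p (sin_map R x)" for x
  have fp: "\<bar>f (sin_map R x) - g x\<bar> < \<eta> / 2" for x
    unfolding g_def by (rule p) (use norm_sin_map_le[OF R(1)] in auto)
  have ff: "\<bar>f x - f (sin_map R x)\<bar> \<le> \<eta> / 2 + \<eta> / 2 * (norm x)\<^sup>2" for x
  proof (cases "norm x \<le> K")
    case True
    have d: "norm (sin_map R x - x) < min 1 \<delta>"
      using norm_sin_map_diff_le[OF R(1) True] R(2) by (simp add: D_def)
    then have "norm (sin_map R x) \<le> K + 1"
      using True norm_triangle_sub[of "sin_map R x" x] by linarith
    then have "dist (f (sin_map R x)) (f x) < \<eta> / 2"
      using True d by (intro \<delta>) (auto simp: dist_norm)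
    moreover have "\<eta> / 2 * (norm x)\<^sup>2 \<ge> 0" using \<eta> by simp
    ultimately show ?thesis unfolding dist_real_def by linarith
  next
    case False
    then have "1 \<le> (norm x)\<^sup>2 / K\<^sup>2" using K(1) by (simp add: power_mono)
    then have "2 * B * 1 \<le> 2 * B * ((norm x)\<^sup>2 / K\<^sup>2)" using B by (intro mult_left_mono) auto
    also have "\<dots> = 2 * B / K\<^sup>2 * (norm x)\<^sup>2" by simp
    also have "\<dots> \<le> \<eta> / 2 * (norm x)\<^sup>2" using K(2) by (intro mult_right_mono) auto
    finally show ?thesis using bd[of x] bd[of "sin_map R x"] \<eta> by linarith
  qed
  have "\<bar>f x - g x\<bar> \<le> \<eta> * (1 + (norm x)\<^sup>2)" for x
  proof -
    have "0 \<le> \<eta> * (norm x)\<^sup>2" using \<eta> by simp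
    with fp[of x] ff[of x] show ?thesis unfolding distrib_left by linarith
  qed
  moreover have "continuous_on UNIV g"
    unfolding g_def
    by (rule continuous_on_compose2[OF continuous_on_polymonial_function[of p UNIV]])
      (use p(1) in \<open>auto simp: sin_map_def real_polynomial_function_eq[symmetric] intro!: continuous_intros\<close>)
  moreover have "bounded (range g)"
    unfolding bounded_iff
  proof (intro exI ballI)
    fix y assume "y \<in> range g"
    then obtain x where "y = g x" by auto
    then show "norm y \<le> B + \<eta>"
      using fp[of x] bd[of "sin_map R x"] \<eta> unfolding real_norm_def by linarith
  qed
  moreover have "trig_polynomial (\<lambda>x. complex_of_real (g x))"
    unfolding g_def by (rule trig_polynomial_sin_map) fact
  ultimately show ?thesis by blast
qed

section \<open>From characteristic functions to bounded continuous functions\<close>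

text \<open>Integrability is carried through the induction because the integral of a sum splits only
  for integrable summands.\<close>

lemma trig_polynomial_tendsto:
  fixes X :: "nat \<Rightarrow> 'a \<Rightarrow> 'c::euclidean_space" and Z :: "'b \<Rightarrow> 'c"
  assumes prob: "\<forall>\<^sub>F N in sequentially. prob_space (M N)" and P: "prob_space P"
    and X: "\<forall>\<^sub>F N in sequentially. X N \<in> borel_measurable (M N)" and Z: "Z \<in> borel_measurable P"
    and char: "\<And>t. (\<lambda>N. CLINT \<omega>|M N. iexp (t \<bullet> X N \<omega>)) \<longlonglongrightarrow> (CLINT \<omega>|P. iexp (t \<bullet> Z \<omega>))"
    and g: "trig_polynomial g"
  shows "(\<forall>\<^sub>F N in sequentially. integrable (M N) (\<lambda>\<omega>. g (X N \<omega>))) \<and> integrable P (\<lambda>\<omega>. g (Z \<omega>)) \<and>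
    (\<lambda>N. CLINT \<omega>|M N. g (X N \<omega>)) \<longlonglongrightarrow> (CLINT \<omega>|P. g (Z \<omega>))"
  using g
proof induction
  case (iexp c t)
  have int: "integrable Q (\<lambda>\<omega>. iexp (t \<bullet> Y \<omega>))"
    if "prob_space Q" "Y \<in> borel_measurable Q" for Q :: "'x measure" and Y
    using that by (intro prob_space.integrable_iexp) auto
  have "\<forall>\<^sub>F N in sequentially. integrable (M N) (\<lambda>\<omega>. iexp (t \<bullet> X N \<omega>))"
    using prob X by eventually_elim (rule int)
  moreover have "integrable P (\<lambda>\<omega>. iexp (t \<bullet> Z \<omega>))" by (rule int) fact+
  ultimately show ?case
    using char[of t] by (auto elim: eventually_mono intro!: tendsto_intros)
next
  case (add f g)
  have *: "\<forall>\<^sub>F N in sequentially. (CLINT \<omega>|M N. f (X N \<omega>) + g (X N \<omega>)) =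
      (CLINT \<omega>|M N. f (X N \<omega>)) + (CLINT \<omega>|M N. g (X N \<omega>))"
    using add.IH(1)[THEN conjunct1] add.IH(2)[THEN conjunct1] by eventually_elim simp
  have "(\<lambda>N. CLINT \<omega>|M N. f (X N \<omega>) + g (X N \<omega>)) \<longlonglongrightarrow> (CLINT \<omega>|P. f (Z \<omega>)) + (CLINT \<omega>|P. g (Z \<omega>))"
    unfolding tendsto_cong[OF *] by (intro tendsto_intros) (use add.IH in auto)
  moreover have "\<forall>\<^sub>F N in sequentially. integrable (M N) (\<lambda>\<omega>. f (X N \<omega>) + g (X N \<omega>))"
    using add.IH(1)[THEN conjunct1] add.IH(2)[THEN conjunct1] by eventually_elim simp
  ultimately show ?case using add.IH by simp
qed

lemma (in prob_space) expectation_diff_le: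
  fixes X :: "'a \<Rightarrow> 'c::euclidean_space" and f g :: "'c \<Rightarrow> real"
  assumes [measurable]: "X \<in> borel_measurable M"
    and f: "continuous_on UNIV f" "bounded (range f)" and g: "continuous_on UNIV g" "bounded (range g)"
    and le: "\<And>x. \<bar>f x - g x\<bar> \<le> \<eta> * (1 + (norm x)\<^sup>2)" and \<eta>: "\<eta> \<ge> 0"
    and X: "integrable M (\<lambda>\<omega>. (norm (X \<omega>))\<^sup>2)" "expectation (\<lambda>\<omega>. (norm (X \<omega>))\<^sup>2) \<le> B"
  shows "\<bar>expectation (\<lambda>\<omega>. f (X \<omega>)) - expectation (\<lambda>\<omega>. g (X \<omega>))\<bar> \<le> \<eta> * (1 + B)"
proof -
  have [measurable]: "f \<in> borel_measurable borel" "g \<in> borel_measurable borel"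
    using f g by (auto intro: borel_measurable_continuous_onI)
  have int: "integrable M (\<lambda>\<omega>. h (X \<omega>))"
    if h: "h \<in> borel_measurable borel" "bounded (range h)" for h :: "'c \<Rightarrow> real"
  proof -
    from h(2) obtain b where "\<And>x. norm (h x) \<le> b" by (auto simp: bounded_iff)
    with h(1) show ?thesis by (intro integrable_const_bound[where B = b]) auto
  qed
  have if': "integrable M (\<lambda>\<omega>. f (X \<omega>))" and ig: "integrable M (\<lambda>\<omega>. g (X \<omega>))"
    using f g by (auto intro!: int)
  have "\<bar>expectation (\<lambda>\<omega>. f (X \<omega>)) - expectation (\<lambda>\<omega>. g (X \<omega>))\<bar>
      = \<bar>expectation (\<lambda>\<omega>. f (X \<omega>) - g (X \<omega>))\<bar>" using if' ig by simp
  also have "\<dots> \<le> expectation (\<lambda>\<omega>. \<bar>f (X \<omega>) - g (X \<omega>)\<bar>)" by (rule integral_abs_bound)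
  also have "\<dots> \<le> expectation (\<lambda>\<omega>. \<eta> * (1 + (norm (X \<omega>))\<^sup>2))"
    using if' ig X le by (intro integral_mono) auto
  also have "\<dots> = \<eta> * (1 + expectation (\<lambda>\<omega>. (norm (X \<omega>))\<^sup>2))"
    using X by (simp add: prob_space)
  also have "\<dots> \<le> \<eta> * (1 + B)" using X \<eta> by (intro mult_left_mono) auto
  finally show ?thesis .
qed

text \<open>A form of Levy's continuity theorem. The second moment bounds turn the weight 1 + (norm
  x)^2 of \<open>trig_polynomial_approx\<close> into an error that is small uniformly in N.\<close>

lemma converges_in_distributionI_char:
  fixes X :: "nat \<Rightarrow> 'a \<Rightarrow> 'c::euclidean_space" and Z :: "'b \<Rightarrow> 'c"
  assumes prob: "\<forall>\<^sub>F N in sequentially. prob_space (M N)" and P: "prob_space P"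
    and X: "\<forall>\<^sub>F N in sequentially. X N \<in> borel_measurable (M N)" and Z: "Z \<in> borel_measurable P"
    and char: "\<And>t. (\<lambda>N. CLINT \<omega>|M N. iexp (t \<bullet> X N \<omega>)) \<longlonglongrightarrow> (CLINT \<omega>|P. iexp (t \<bullet> Z \<omega>))"
    and X2: "\<forall>\<^sub>F N in sequentially. integrable (M N) (\<lambda>\<omega>. (norm (X N \<omega>))\<^sup>2) \<and>
        (\<integral>\<omega>. (norm (X N \<omega>))\<^sup>2 \<partial>M N) \<le> B"
    and Z2: "integrable P (\<lambda>\<omega>. (norm (Z \<omega>))\<^sup>2)" "(\<integral>\<omega>. (norm (Z \<omega>))\<^sup>2 \<partial>P) \<le> B"
  shows "converges_in_distribution M X P Z"
  unfolding converges_in_distribution_def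
proof (intro conjI allI impI X Z)
  fix f :: "'c \<Rightarrow> real" assume f: "continuous_on UNIV f" "bounded (range f)"
  obtain b where b: "\<And>x. \<bar>f x\<bar> \<le> b" using f(2) by (auto simp: bounded_iff)
  show "(\<lambda>N. \<integral>\<omega>. f (X N \<omega>) \<partial>M N) \<longlonglongrightarrow> (\<integral>\<omega>. f (Z \<omega>) \<partial>P)"
  proof (rule tendstoI)
    fix e :: real assume e: "e > 0"
    have B: "B \<ge> 0" by (rule order_trans[OF _ Z2(2)]) simp
    \<comment> \<open>Replacing f by g costs e / 4 on either side, and the convergence for g costs a
      third e / 4.\<close>
    define \<eta> where "\<eta> = e / (4 * (1 + B))"
    have "1 + B \<noteq> 0" using B by linarith
    then have \<eta>: "\<eta> > 0" "\<eta> * (1 + B) = e / 4"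
      unfolding \<eta>_def using e B by (auto simp: divide_simps)
    obtain g where g: "continuous_on UNIV g" "bounded (range g)"
        "trig_polynomial (\<lambda>x. complex_of_real (g x))" "\<And>x. \<bar>f x - g x\<bar> \<le> \<eta> * (1 + (norm x)\<^sup>2)"
      using trig_polynomial_approx[OF f(1) b \<eta>(1)] by blast
    have "(\<lambda>N. CLINT \<omega>|M N. complex_of_real (g (X N \<omega>))) \<longlonglongrightarrow> (CLINT \<omega>|P. complex_of_real (g (Z \<omega>)))"
      using trig_polynomial_tendsto[OF prob P X Z char g(3)] by blast
    then have "(\<lambda>N. \<integral>\<omega>. g (X N \<omega>) \<partial>M N) \<longlonglongrightarrow> (\<integral>\<omega>. g (Z \<omega>) \<partial>P)"
      by (simp add: tendsto_of_real_iff)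
    then have "\<forall>\<^sub>F N in sequentially. dist (\<integral>\<omega>. g (X N \<omega>) \<partial>M N) (\<integral>\<omega>. g (Z \<omega>) \<partial>P) < e / 4"
      by (rule tendstoD) (use e in auto)
    then show "\<forall>\<^sub>F N in sequentially. dist (\<integral>\<omega>. f (X N \<omega>) \<partial>M N) (\<integral>\<omega>. f (Z \<omega>) \<partial>P) < e"
      using prob X X2
    proof eventually_elim
      case (elim N)
      have 1: "\<bar>(\<integral>\<omega>. f (X N \<omega>) \<partial>M N) - (\<integral>\<omega>. g (X N \<omega>) \<partial>M N)\<bar> \<le> \<eta> * (1 + B)"
        by (rule prob_space.expectation_diff_le) (use elim f g \<eta> in auto)
      have 2: "\<bar>(\<integral>\<omega>. f (Z \<omega>) \<partial>P) - (\<integral>\<omega>. g (Z \<omega>) \<partial>P)\<bar> \<le> \<eta> * (1 + B)"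
        by (rule prob_space.expectation_diff_le) (use P Z Z2 f g \<eta> in auto)
      from 1 2 elim(1) e show ?case
        unfolding \<eta>(2) dist_real_def by linarith
    qed
  qed
qed

section \<open>Gaussian vectors with a given covariance\<close>

text \<open>Cholesky factorisation: one index is eliminated at a time, and the induction hypothesis
  is applied to the Schur complement of its diagonal entry.\<close>

lemma psd_imp_gram:
  fixes B :: "'i \<Rightarrow> 'i \<Rightarrow> real"
  assumes "finite S" "\<And>i j. i \<in> S \<Longrightarrow> j \<in> S \<Longrightarrow> B i j = B j i"
    and "\<And>c. 0 \<le> (\<Sum>i\<in>S. \<Sum>j\<in>S. c i * c j * B i j)"
  shows "\<exists>v :: 'i \<Rightarrow> 'i \<Rightarrow> real. \<forall>i\<in>S. \<forall>j\<in>S. B i j = (\<Sum>k\<in>S. v k i * v k j)"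
  using assms
proof (induction S arbitrary: B rule: finite_induct)
  case empty
  then show ?case by simp
next
  case (insert a S B)
  note sym = insert.prems(1) and psd = insert.prems(2)
  have expand: "(\<Sum>i\<in>insert a S. \<Sum>j\<in>insert a S. c i * c j * B i j) =
      (\<Sum>i\<in>S. \<Sum>j\<in>S. c i * c j * B i j) + 2 * c a * (\<Sum>j\<in>S. c j * B a j) + (c a)\<^sup>2 * B a a" for c
  proof -
    have "(\<Sum>i\<in>S. c i * c a * B i a) = c a * (\<Sum>j\<in>S. c j * B a j)"
      unfolding sum_distrib_left using sym by (intro sum.cong) auto
    moreover have "(\<Sum>j\<in>S. c a * c j * B a j) = c a * (\<Sum>j\<in>S. c j * B a j)"
      unfolding sum_distrib_left by (intro sum.cong) auto
    ultimately show ?thesis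
      using insert.hyps by (simp add: sum.distrib power2_eq_square)
  qed
  have cong: "(\<Sum>i\<in>S. \<Sum>j\<in>S. (c(a := z)) i * (c(a := z)) j * B i j) = (\<Sum>i\<in>S. \<Sum>j\<in>S. c i * c j * B i j)"
    "(\<Sum>j\<in>S. (c(a := z)) j * B a j) = (\<Sum>j\<in>S. c j * B a j)" for c z
    using insert.hyps by (auto intro!: sum.cong)
  have psd': "0 \<le> (\<Sum>i\<in>S. \<Sum>j\<in>S. c i * c j * B i j) + 2 * z * (\<Sum>j\<in>S. c j * B a j) + z\<^sup>2 * B a a" for c z
    using psd[of "c(a := z)"] unfolding expand cong by simp
  have "B a a \<ge> 0" using psd'[of "\<lambda>_. 0" 1] by simp
  show ?case
  proof (cases "B a a = 0")
    case True
    \<comment> \<open>A vanishing diagonal entry forces its row to vanish: otherwise the form would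
      be a nonconstant affine function of z and negative somewhere.\<close>
    have Ba: "B a j = 0" if j: "j \<in> S" for j
    proof -
      define c where "c = (\<lambda>i. if i = j then 1 else 0 :: real)"
      have c: "(\<Sum>i\<in>S. c i * h i) = h j" for h :: "'i \<Rightarrow> real"
        using j insert.hyps(1) sum.delta[of S j h] by (simp add: c_def if_distrib[of "\<lambda>x. x * _"] cong: if_cong)
      have "(\<Sum>i\<in>S. \<Sum>j\<in>S. c i * c j * B i j) = B j j"
        unfolding mult.assoc sum_distrib_left[symmetric] c ..
      moreover have "(\<Sum>j\<in>S. c j * B a j) = B a j"
        by (rule c)
      ultimately have *: "0 \<le> B j j + 2 * z * B a j" for z
        using psd'[of c z] True by simp
      show ?thesis
      proof (rule ccontr)
        assume "B a j \<noteq> 0"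
        then have "2 * (- (B j j + 1) / (2 * B a j)) * B a j = - (B j j + 1)" by simp
        then show False using *[of "- (B j j + 1) / (2 * B a j)"] by linarith
      qed
    qed
    obtain v where v: "\<forall>i\<in>S. \<forall>j\<in>S. B i j = (\<Sum>k\<in>S. v k i * v k j)"
      using insert.IH[of B] sym psd'[of _ 0] by auto
    define w where "w k i = (if k = a \<or> i = a then 0 else v k i)" for k i
    have "B i j = (\<Sum>k\<in>insert a S. w k i * w k j)" if "i \<in> insert a S" "j \<in> insert a S" for i j
    proof (cases "i = a \<or> j = a")
      case True
      then have "B i j = 0" using Ba sym[of i j] that \<open>B a a = 0\<close> by auto
      then show ?thesis using True by (auto simp: w_def)
    next
      case False
      with v that have "B i j = (\<Sum>k\<in>S. v k i * v k j)" by auto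
      also have "\<dots> = (\<Sum>k\<in>S. w k i * w k j)"
        using insert.hyps False by (intro sum.cong) (auto simp: w_def)
      finally show ?thesis using insert.hyps by (simp add: w_def)
    qed
    then show ?thesis by blast
  next
    case False
    with \<open>B a a \<ge> 0\<close> have pos: "B a a > 0" by simp
    \<comment> \<open>The Schur complement. Its form is the minimum of the given form over the
      coefficient at a, attained at \<open>- l / B a a\<close>, hence nonnegative.\<close>
    define B' where "B' i j = B i j - B a i * B a j / B a a" for i j
    have "0 \<le> (\<Sum>i\<in>S. \<Sum>j\<in>S. c i * c j * B' i j)" for c
    proof -
      define l where "l = (\<Sum>j\<in>S. c j * B a j)"
      have e1: "(\<Sum>i\<in>S. \<Sum>j\<in>S. c i * c j * B' i j) =
          (\<Sum>i\<in>S. \<Sum>j\<in>S. c i * c j * B i j) - (\<Sum>i\<in>S. \<Sum>j\<in>S. (c i * B a i) * (c j * B a j)) / B a a"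
        by (simp add: B'_def right_diff_distrib sum_subtractf sum_divide_distrib mult_ac)
      have e2: "(\<Sum>i\<in>S. \<Sum>j\<in>S. (c i * B a i) * (c j * B a j)) = l * l"
        unfolding l_def by (rule sum_product[symmetric])
      have "2 * (- l / B a a) * l + (- l / B a a)\<^sup>2 * B a a = - (l * l / B a a)"
        using pos by (simp add: power2_eq_square field_simps)
      then show ?thesis
        using psd'[of c "- l / B a a"] unfolding l_def[symmetric] e1 e2 by linarith
    qed
    moreover have "B' i j = B' j i" if "i \<in> S" "j \<in> S" for i j
      using sym that by (simp add: B'_def)
    ultimately obtain v where v: "\<forall>i\<in>S. \<forall>j\<in>S. B' i j = (\<Sum>k\<in>S. v k i * v k j)"
      using insert.IH[of B'] by auto
    define w where "w k i = (if k = a then B a i / sqrt (B a a) else if i = a then 0 else v k i)" for k i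
    have "B i j = (\<Sum>k\<in>insert a S. w k i * w k j)" if ij: "i \<in> insert a S" "j \<in> insert a S" for i j
    proof -
      have "(\<Sum>k\<in>insert a S. w k i * w k j) = B a i * B a j / B a a + (\<Sum>k\<in>S. w k i * w k j)"
        using insert.hyps pos by (simp add: w_def)
      also have "(\<Sum>k\<in>S. w k i * w k j) = (if i = a \<or> j = a then 0 else B' i j)"
      proof (cases "i = a \<or> j = a")
        case True
        then show ?thesis using insert.hyps by (auto simp: w_def intro!: sum.neutral)
      next
        case False
        then have "B' i j = (\<Sum>k\<in>S. v k i * v k j)" using v ij by auto
        also have "\<dots> = (\<Sum>k\<in>S. w k i * w k j)"
          using insert.hyps False by (intro sum.cong) (auto simp: w_def)
        finally show ?thesis using False by simp
      qed
      finally show ?thesis using pos sym[of i j] ij by (auto simp: B'_def)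
    qed
    then show ?thesis by blast
  qed
qed

section \<open>Gaussian vectors as linear images of independent standard normals\<close>

text \<open>Puts the point mass at s = 0 on the same footing as the laws with a density; it occurs
  as soon as the covariance is singular.\<close>

lemma normal_law_eq_distr:
  assumes "s \<ge> 0"
  shows "normal_law 0 s = distr std_normal_distribution borel (\<lambda>x. s * x)"
proof (cases "s = 0")
  case True
  interpret S: real_distribution std_normal_distribution by (rule real_dist_normal_dist)
  show ?thesis using True by (simp add: normal_law_def S.distr_const)
next
  case False
  interpret S: real_distribution std_normal_distribution by (rule real_dist_normal_dist)
  have "distributed std_normal_distribution lborel (\<lambda>x. x) std_normal_density"
    by (auto simp: distributed_def distr_id2)
  then have "distributed std_normal_distribution lborel (\<lambda>x. 0 + s * x) (normal_density (0 + s * 0) (\<bar>s\<bar> * 1))"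
    by (rule S.normal_density_affine) (use False in auto)
  with assms have "distributed std_normal_distribution lborel (\<lambda>x. s * x) (normal_density 0 s)"
    by simp
  then have "distr std_normal_distribution lborel (\<lambda>x. s * x) = density lborel (normal_density 0 s)"
    by (rule distributed_distr_eq_density)
  with False show ?thesis
    by (simp add: normal_law_def cong: distr_cong)
qed

lemma char_normal_law:
  assumes "s \<ge> 0"
  shows "char (normal_law 0 s) t = complex_of_real (exp (- (s\<^sup>2 * t\<^sup>2) / 2))"
proof -
  have "char (normal_law 0 s) t = char std_normal_distribution (t * s)"
    by (simp add: normal_law_eq_distr[OF assms] char_def integral_distr mult_ac)
  then show ?thesis
    by (simp add: char_std_normal_distribution power_mult_distrib mult_ac)
qed

lemma normal_law_moments:
  assumes "s \<ge> 0"
  shows "integrable (normal_law 0 s) (\<lambda>x. x ^ k)"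
    and "(\<integral>x. x ^ k \<partial>normal_law 0 s) = s ^ k * gauss_moment k"
  using integrable_std_normal_distribution_power[of k] integral_std_normal_distribution_power[of k]
  by (simp_all add: normal_law_eq_distr[OF assms] integrable_distr_eq integral_distr power_mult_distrib)

text \<open>Independence multiplies the characteristic functions, so the variances add up in the
  exponent, and uniqueness identifies the law, also when all weights vanish.\<close>

lemma distr_linear_PiM_std_normal:
  fixes w :: "'m::finite \<Rightarrow> real"
  shows "distr (PiM UNIV (\<lambda>_. std_normal_distribution)) borel (\<lambda>f. \<Sum>k\<in>UNIV. w k * f k)
    = normal_law 0 (sqrt (\<Sum>k\<in>UNIV. (w k)\<^sup>2))"
proof -
  define Q :: "('m \<Rightarrow> real) measure" where "Q = PiM UNIV (\<lambda>_. std_normal_distribution)"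
  interpret S: real_distribution std_normal_distribution by (rule real_dist_normal_dist)
  interpret Q: prob_space Q unfolding Q_def by (intro prob_space_PiM S.prob_space_axioms)
  have sQ: "sets Q = sets (PiM UNIV (\<lambda>_. borel))"
    unfolding Q_def by (intro sets_PiM_cong) auto
  have [measurable]: "(\<lambda>f. f k) \<in> borel_measurable Q" for k
    by (subst measurable_cong_sets[OF sQ refl]) simp
  have comp: "distr Q borel (\<lambda>f. f k) = std_normal_distribution" for k
  proof -
    have "distr Q std_normal_distribution (\<lambda>f. f k) = std_normal_distribution"
      unfolding Q_def by (rule distr_PiM_component) (auto intro: S.prob_space_axioms)
    then show ?thesis by (simp cong: distr_cong)
  qed
  have "Q.indep_vars (\<lambda>_. borel) (\<lambda>k f. f k) UNIV"
  proof (subst Q.indep_vars_iff_distr_eq_PiM')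
    have "distr Q (PiM UNIV (\<lambda>_. borel)) (\<lambda>x. x) = Q"
      by (rule distr_id2) (use sQ in simp)
    then show "distr Q (PiM UNIV (\<lambda>_. borel)) (\<lambda>x. \<lambda>i\<in>UNIV. x i) = PiM UNIV (\<lambda>i. distr Q borel (\<lambda>f. f i))"
      unfolding comp by (simp add: Q_def restrict_UNIV)
  qed auto
  then have indep: "Q.indep_vars (\<lambda>_. borel) (\<lambda>k f. w k * f k) UNIV"
    by (rule Q.indep_vars_compose2) auto
  have "distr Q borel (\<lambda>f. \<Sum>k\<in>UNIV. w k * f k) = normal_law 0 (sqrt (\<Sum>k\<in>UNIV. (w k)\<^sup>2))"
  proof (rule Levy_uniqueness)
    show "real_distribution (distr Q borel (\<lambda>f. \<Sum>k\<in>UNIV. w k * f k))"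
      by (rule Q.real_distribution_distr) measurable
    show "real_distribution (normal_law 0 (sqrt (\<Sum>k\<in>UNIV. (w k)\<^sup>2)))"
      by (subst normal_law_eq_distr) (auto intro!: S.real_distribution_distr sum_nonneg)
    have 1: "char (distr Q borel (\<lambda>f. w k * f k)) t = complex_of_real (exp (- ((w k)\<^sup>2 * t\<^sup>2) / 2))" for k t
    proof -
      have "char (distr Q borel (\<lambda>f. w k * f k)) t = char (distr Q borel (\<lambda>f. f k)) (t * w k)"
        by (simp add: char_def integral_distr mult_ac)
      then show ?thesis
        unfolding comp by (simp add: char_std_normal_distribution power_mult_distrib mult_ac)
    qed
    show "char (distr Q borel (\<lambda>f. \<Sum>k\<in>UNIV. w k * f k)) = char (normal_law 0 (sqrt (\<Sum>k\<in>UNIV. (w k)\<^sup>2)))"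
    proof
      fix t
      have "char (distr Q borel (\<lambda>f. \<Sum>k\<in>UNIV. w k * f k)) t
          = (\<Prod>k\<in>UNIV. complex_of_real (exp (- ((w k)\<^sup>2 * t\<^sup>2) / 2)))"
        unfolding Q.char_distr_sum[OF indep] 1 ..
      also have "\<dots> = complex_of_real (exp (\<Sum>k\<in>UNIV. - ((w k)\<^sup>2 * t\<^sup>2) / 2))"
        by (simp add: exp_sum)
      also have "(\<Sum>k\<in>UNIV. - ((w k)\<^sup>2 * t\<^sup>2) / 2) = - ((\<Sum>k\<in>UNIV. (w k)\<^sup>2) * t\<^sup>2) / 2"
        by (simp add: sum_distrib_right sum_divide_distrib sum_negf)
      finally show "char (distr Q borel (\<lambda>f. \<Sum>k\<in>UNIV. w k * f k)) t =
          char (normal_law 0 (sqrt (\<Sum>k\<in>UNIV. (w k)\<^sup>2))) t"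
        by (simp add: char_normal_law sum_nonneg)
    qed
  qed
  then show ?thesis by (simp add: Q_def)
qed

text \<open>With C factored as a Gram matrix, the map \<open>A\<close> sends independent standard
  normals to a vector whose linear form given by t has the value of the quadratic form C at t as its
  variance. \<open>P\<close> is the law of this vector, so that the identity can serve as the
  Gaussian vector.\<close>

lemma gaussian_vector_exists:
  fixes C :: "'m::finite \<Rightarrow> 'm \<Rightarrow> real"
  assumes sym: "\<And>a b. C a b = C b a"
    and psd: "\<And>c. 0 \<le> (\<Sum>a\<in>UNIV. \<Sum>b\<in>UNIV. c a * c b * C a b)"
  shows "\<exists>P :: (real ^ 'm) measure. sets P = sets borel \<and> prob_space P \<and> gaussian_vector P (\<lambda>x. x) \<and>
     (\<forall>t. distr P borel (\<lambda>x. t \<bullet> x) =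
        normal_law 0 (sqrt (\<Sum>a\<in>UNIV. \<Sum>b\<in>UNIV. t $ a * t $ b * C a b)))"
proof -
  interpret S: real_distribution std_normal_distribution by (rule real_dist_normal_dist)
  obtain v :: "'m \<Rightarrow> 'm \<Rightarrow> real" where v: "\<And>a b. C a b = (\<Sum>k\<in>UNIV. v k a * v k b)"
    using psd_imp_gram[of UNIV C] sym psd by auto
  define Q :: "('m \<Rightarrow> real) measure" where "Q = PiM UNIV (\<lambda>_. std_normal_distribution)"
  define A :: "('m \<Rightarrow> real) \<Rightarrow> real ^ 'm" where "A f = (\<chi> a. \<Sum>k\<in>UNIV. v k a * f k)" for f
  interpret Q: prob_space Q unfolding Q_def by (intro prob_space_PiM S.prob_space_axioms)
  have sQ: "sets Q = sets (PiM UNIV (\<lambda>_. borel))"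
    unfolding Q_def by (intro sets_PiM_cong) auto
  have [measurable]: "(\<lambda>f. f k) \<in> borel_measurable Q" for k
    by (subst measurable_cong_sets[OF sQ refl]) simp
  have [measurable]: "A \<in> borel_measurable Q"
    unfolding borel_measurable_euclidean_space[of A]
    by (auto simp: Basis_vec_def A_def inner_axis)
  have law: "distr (distr Q borel A) borel (\<lambda>x. t \<bullet> x) =
      normal_law 0 (sqrt (\<Sum>a\<in>UNIV. \<Sum>b\<in>UNIV. t $ a * t $ b * C a b))" for t
  proof -
    define w where "w k = (\<Sum>a\<in>UNIV. t $ a * v k a)" for k
    have "t \<bullet> A f = (\<Sum>k\<in>UNIV. w k * f k)" for f
      unfolding inner_vec_def A_def w_def
      by (simp add: sum_distrib_left sum_distrib_right mult_ac) (rule sum.swap)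
    then have "distr (distr Q borel A) borel (\<lambda>x. t \<bullet> x) = distr Q borel (\<lambda>f. \<Sum>k\<in>UNIV. w k * f k)"
      by (subst distr_distr) (auto simp: comp_def)
    also have "\<dots> = normal_law 0 (sqrt (\<Sum>k\<in>UNIV. (w k)\<^sup>2))"
      unfolding Q_def by (rule distr_linear_PiM_std_normal)
    also have "(\<Sum>k\<in>UNIV. (w k)\<^sup>2) = (\<Sum>k\<in>UNIV. \<Sum>a\<in>UNIV. \<Sum>b\<in>UNIV. t $ a * t $ b * (v k a * v k b))"
      by (simp add: w_def power2_eq_square sum_product mult_ac)
    also have "\<dots> = (\<Sum>a\<in>UNIV. \<Sum>k\<in>UNIV. \<Sum>b\<in>UNIV. t $ a * t $ b * (v k a * v k b))"
      by (rule sum.swap)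
    also have "\<dots> = (\<Sum>a\<in>UNIV. \<Sum>b\<in>UNIV. \<Sum>k\<in>UNIV. t $ a * t $ b * (v k a * v k b))"
      by (intro sum.cong sum.swap refl)
    also have "\<dots> = (\<Sum>a\<in>UNIV. \<Sum>b\<in>UNIV. t $ a * t $ b * C a b)"
      by (simp add: v sum_distrib_left)
    finally show ?thesis .
  qed
  have "gaussian_vector (distr Q borel A) (\<lambda>x. x)"
    unfolding gaussian_vector_def
  proof (intro conjI allI)
    fix t :: "real ^ 'm"
    show "\<exists>m. \<exists>s\<ge>0. distr (distr Q borel A) borel (\<lambda>x. t \<bullet> x) = normal_law m s"
      unfolding law using psd[of "\<lambda>a. t $ a"]
      by (intro exI[of _ 0] exI[of _ "sqrt (\<Sum>a\<in>UNIV. \<Sum>b\<in>UNIV. t $ a * t $ b * C a b)"]) simp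
  qed simp
  moreover have "prob_space (distr Q borel A)" by (rule Q.prob_space_distr) simp
  moreover have "sets (distr Q borel A) = sets borel" by simp
  ultimately show ?thesis using law by blast
qed

section \<open>Moments and covariance of a law known through its linear forms\<close>

context
  fixes P :: "(real ^ 'm::finite) measure" and C :: "'m \<Rightarrow> 'm \<Rightarrow> real"
  assumes setsP: "sets P = sets borel"
    and psd: "\<And>c. 0 \<le> (\<Sum>a\<in>UNIV. \<Sum>b\<in>UNIV. c a * c b * C a b)"
    and sym: "\<And>a b. C a b = C b a"
    and law: "\<And>t. distr P borel (\<lambda>x. t \<bullet> x) =
        normal_law 0 (sqrt (\<Sum>a\<in>UNIV. \<Sum>b\<in>UNIV. t $ a * t $ b * C a b))"
begin

lemma linear_form_moments:
  fixes t :: "real ^ 'm"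
  defines "s \<equiv> sqrt (\<Sum>a\<in>UNIV. \<Sum>b\<in>UNIV. t $ a * t $ b * C a b)"
  shows "integrable P (\<lambda>x. (t \<bullet> x) ^ k)" "(\<integral>x. (t \<bullet> x) ^ k \<partial>P) = s ^ k * gauss_moment k"
proof -
  have s: "s \<ge> 0" unfolding s_def using psd[of "\<lambda>a. t $ a"] by simp
  have [measurable]: "(\<lambda>x. t \<bullet> x) \<in> borel_measurable P"
    by (subst measurable_cong_sets[OF setsP refl]) simp
  have "integrable (distr P borel (\<lambda>x. t \<bullet> x)) (\<lambda>x. x ^ k)"
    "(\<integral>x. x ^ k \<partial>distr P borel (\<lambda>x. t \<bullet> x)) = s ^ k * gauss_moment k"
    unfolding law s_def[symmetric] by (rule normal_law_moments[OF s])+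
  then show "integrable P (\<lambda>x. (t \<bullet> x) ^ k)" "(\<integral>x. (t \<bullet> x) ^ k \<partial>P) = s ^ k * gauss_moment k"
    by (simp_all add: integrable_distr_eq integral_distr)
qed

lemma linear_form_char:
  "(CLINT x|P. iexp (t \<bullet> x)) =
     complex_of_real (exp (- (\<Sum>a\<in>UNIV. \<Sum>b\<in>UNIV. t $ a * t $ b * C a b) / 2))"
proof -
  define q where "q = (\<Sum>a\<in>UNIV. \<Sum>b\<in>UNIV. t $ a * t $ b * C a b)"
  have q: "q \<ge> 0" unfolding q_def by (rule psd)
  have [measurable]: "(\<lambda>x. t \<bullet> x) \<in> borel_measurable P"
    by (subst measurable_cong_sets[OF setsP refl]) simp
  have "(CLINT x|P. iexp (t \<bullet> x)) = char (distr P borel (\<lambda>x. t \<bullet> x)) 1"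
    by (simp add: char_def integral_distr)
  also have "\<dots> = complex_of_real (exp (- q / 2))"
    unfolding law q_def[symmetric] using q by (simp add: char_normal_law)
  finally show ?thesis by (simp add: q_def)
qed

lemma component_mean: "(\<integral>x. x $ a \<partial>P) = 0"
  using linear_form_moments(2)[of "axis a 1" 1] by (simp add: inner_axis')

lemma
  shows component_prod_integrable: "integrable P (\<lambda>x. x $ a * x $ b)"
    and component_covariance: "(\<integral>x. x $ a * x $ b \<partial>P) = C a b"
proof -
  have g2: "gauss_moment 2 = 1" using gauss_moment_Suc_Suc[of 0] by (simp add: numeral_2_eq_2)
  have ax: "axis a (1::real) $ c = (if c = a then 1 else 0)" for a c :: 'm by (simp add: axis_def)
  define T where "T t = (\<Sum>a\<in>UNIV. \<Sum>b\<in>UNIV. t $ a * t $ b * C a b)" for t :: "real ^ 'm"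
  have i: "integrable P (\<lambda>x. (t \<bullet> x)\<^sup>2)" "(\<integral>x. (t \<bullet> x)\<^sup>2 \<partial>P) = T t" for t
    using linear_form_moments[of t 2] psd[of "\<lambda>a. t $ a"] by (auto simp: g2 T_def)
  \<comment> \<open>Polarisation: only the laws of single linear forms are known, so the mixed
    moment is read off from three squares.\<close>
  have pol: "x $ a * x $ b = (((axis a 1 + axis b 1) \<bullet> x)\<^sup>2 - (axis a 1 \<bullet> x)\<^sup>2 - (axis b 1 \<bullet> x)\<^sup>2) / 2" for x :: "real ^ 'm"
    by (simp add: inner_add_left inner_axis' power2_eq_square algebra_simps)
  show "integrable P (\<lambda>x. x $ a * x $ b)"
    unfolding pol using i(1) by (intro integrable_divide Bochner_Integration.integrable_diff)
  have "(\<integral>x. x $ a * x $ b \<partial>P) = (T (axis a 1 + axis b 1) - T (axis a 1) - T (axis b 1)) / 2"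
    unfolding pol using i by (simp add: Bochner_Integration.integrable_diff)
  also have "\<dots> = C a b"
  proof -
    have d: "(\<Sum>c\<in>UNIV. axis a 1 $ c * h c) = h a" for a :: 'm and h :: "'m \<Rightarrow> real"
      by (simp add: ax if_distrib[of "\<lambda>x. x * _"] cong: if_cong)
    have T2: "T t = (\<Sum>a\<in>UNIV. t $ a * (\<Sum>b\<in>UNIV. t $ b * C a b))" for t
      by (simp add: T_def sum_distrib_left mult_ac)
    have "T (axis a 1) = C a a" for a unfolding T2 d ..
    moreover have "T (axis a 1 + axis b 1) = C a a + C a b + (C b a + C b b)"
      unfolding T2 vector_add_component distrib_right sum.distrib distrib_left d by simp
    ultimately show ?thesis using sym[of a b] by simp
  qed
  finally show "(\<integral>x. x $ a * x $ b \<partial>P) = C a b" .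
qed

end

section \<open>Connectivity and trees\<close>

text \<open>Connectivity is used throughout in its cut form: a nonempty vertex set that no arc leaves is
  everything.\<close>

definition arc_closed :: "('v, 'e) pre_digraph \<Rightarrow> 'v set \<Rightarrow> bool" where
  "arc_closed G S \<longleftrightarrow> S \<subseteq> verts G \<and> (\<forall>e\<in>arcs G. head G e \<in> S \<longleftrightarrow> tail G e \<in> S)"

text \<open>The set of vertices reachable from a vertex is arc-closed, and an arc-closed set
  contains everything reachable from its points.\<close>

lemma (in wf_digraph) connected_iff_arc_closed:
  "Digraph_Component.connected G \<longleftrightarrow> verts G \<noteq> {} \<and> (\<forall>S. arc_closed G S \<longrightarrow> S \<noteq> {} \<longrightarrow> S = verts G)"
proof -
  let ?r = "rtrancl_on (verts G) ((arcs_ends G)\<^sup>s)"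
  have closed: "v \<in> S" if "(u, v) \<in> ?r" "u \<in> S" "arc_closed G S" for u v S
    using that
  proof (induction rule: rtrancl_on_induct)
    case (step b c)
    then have "b \<in> S" by blast
    with step.hyps \<open>arc_closed G S\<close> show ?case
      by (auto simp: arc_closed_def symcl_def arcs_ends_conv)
  qed
  have reach: "arc_closed G {v. (u, v) \<in> ?r}" if "u \<in> verts G" for u
    unfolding arc_closed_def
  proof (intro conjI ballI)
    show "{v. (u, v) \<in> ?r} \<subseteq> verts G" by (auto dest: in_rtrancl_on_in_F)
    fix e assume e: "e \<in> arcs G"
    then have "(tail G e, head G e) \<in> (arcs_ends G)\<^sup>s" "(head G e, tail G e) \<in> (arcs_ends G)\<^sup>s"
      by (auto simp: symcl_def arcs_ends_conv)
    with e show "head G e \<in> {v. (u, v) \<in> ?r} \<longleftrightarrow> tail G e \<in> {v. (u, v) \<in> ?r}"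
      by (auto intro: rtrancl_on_into_rtrancl_on)
  qed
  show ?thesis
    unfolding connected_conv
  proof (intro conj_cong refl iffI allI impI ballI)
    fix S assume *: "\<forall>u\<in>verts G. \<forall>v\<in>verts G. (u, v) \<in> ?r" and S: "arc_closed G S" "S \<noteq> {}"
    from S obtain u where u: "u \<in> S" "u \<in> verts G" by (auto simp: arc_closed_def)
    then have "verts G \<subseteq> S" using * closed S by blast
    then show "S = verts G" using S by (auto simp: arc_closed_def)
  next
    fix u v assume *: "\<forall>S. arc_closed G S \<longrightarrow> S \<noteq> {} \<longrightarrow> S = verts G" and uv: "u \<in> verts G" "v \<in> verts G"
    have "u \<in> {v. (u, v) \<in> ?r}" using uv by auto
    then have "{v. (u, v) \<in> ?r} = verts G" using * reach[OF uv(1)] by blast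
    then show "(u, v) \<in> ?r" using uv by blast
  qed
qed

section \<open>Paths, spanning trees and cycles\<close>

text \<open>The list encoding of \<open>undirected_cycle\<close> without the wrap-around: one more
  edge between the end points turns such a path into a cycle.\<close>

definition upath :: "('v, 'e) pre_digraph \<Rightarrow> 'e set \<Rightarrow> 'v list \<Rightarrow> 'e list \<Rightarrow> bool" where
  "upath G F vs es \<longleftrightarrow> length vs = Suc (length es) \<and> distinct vs \<and> distinct es \<and> set es \<subseteq> F \<and>
     (\<forall>k<length es. {tail G (es ! k), head G (es ! k)} = {vs ! k, vs ! Suc k})"

lemma upath_single: "upath G F [v] []"
  by (simp add: upath_def)

lemma upath_mono: "upath G F vs es \<Longrightarrow> F \<subseteq> F' \<Longrightarrow> upath G F' vs es"
  by (auto simp: upath_def)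

lemma upath_snoc:
  assumes "upath G F vs es" "w \<notin> set vs" "e \<notin> F" "{tail G e, head G e} = {last vs, w}"
  shows "upath G (insert e F) (vs @ [w]) (es @ [e])"
proof -
  have l: "length vs = Suc (length es)" using assms(1) by (simp add: upath_def)
  then have "last vs = vs ! length es" by (cases vs rule: rev_cases) (auto simp: nth_append)
  with l assms show ?thesis
    unfolding upath_def by (auto simp: nth_append less_Suc_eq)
qed

lemma upath_Cons:
  assumes "upath G F vs es" "w \<notin> set vs" "e \<notin> F" "{tail G e, head G e} = {w, hd vs}"
  shows "upath G (insert e F) (w # vs) (e # es)"
proof -
  have l: "length vs = Suc (length es)" using assms(1) by (simp add: upath_def)
  then have "hd vs = vs ! 0" by (cases vs) auto
  with l assms show ?thesis
    unfolding upath_def by (auto simp: nth_Cons split: nat.splits)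
qed

context fin_digraph
begin

text \<open>The subtree grows one vertex at a time: while S is not everything, the cut criterion
  yields an arc leaving S. The end points of a path are recorded as an unordered pair, so that no
  path has to be reversed; the new vertex is appended or prepended.\<close>

lemma spanning_subtree:
  assumes conn: "Digraph_Component.connected G" and k: "1 \<le> k" "k \<le> card (verts G)"
  shows "\<exists>S F. S \<subseteq> verts G \<and> card S = k \<and> F \<subseteq> arcs G \<and> Suc (card F) = k \<and>
    (\<forall>e\<in>F. tail G e \<in> S \<and> head G e \<in> S) \<and>
    (\<forall>u\<in>S. \<forall>v\<in>S. \<exists>vs es. upath G F vs es \<and> set vs \<subseteq> S \<and> {hd vs, last vs} = {u, v})"
  using k
proof (induction k rule: dec_induct)
  case base
  from conn obtain v where "v \<in> verts G" unfolding connected_iff_arc_closed by auto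
  then show ?case
    using upath_single[of G "{}" v]
    by (intro exI[of _ "{v}"] exI[of _ "{}"] conjI ballI exI[of _ "[v]"] exI[of _ "[]"]) auto
next
  case (step k)
  then have "k \<le> card (verts G)" by simp
  from step.IH[OF this] obtain S F where S: "S \<subseteq> verts G" "card S = k"
    and F: "F \<subseteq> arcs G" "Suc (card F) = k" "\<forall>e\<in>F. tail G e \<in> S \<and> head G e \<in> S"
    and path: "\<forall>u\<in>S. \<forall>v\<in>S.
        \<exists>vs es. upath G F vs es \<and> set vs \<subseteq> S \<and> {hd vs, last vs} = {u, v}"
    by (elim exE conjE)
  have fin: "finite S" "finite F" using S F finite_subset finite_verts finite_arcs by blast+
  have "S \<noteq> {}" using S step.hyps by auto
  moreover have "S \<noteq> verts G" using S step.prems by auto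
  ultimately have "\<not> arc_closed G S" using conn unfolding connected_iff_arc_closed by blast
  then obtain e where e: "e \<in> arcs G" "\<not> (head G e \<in> S \<longleftrightarrow> tail G e \<in> S)"
    using S by (auto simp: arc_closed_def)
  then obtain s w where sw: "{tail G e, head G e} = {s, w}" "s \<in> S" "w \<notin> S" "w \<in> verts G"
  proof (cases "head G e \<in> S")
    case True
    with e show ?thesis by (intro that[of "head G e" "tail G e"]) auto
  next
    case False
    with e show ?thesis by (intro that[of "tail G e" "head G e"]) auto
  qed
  have eF: "e \<notin> F" using F e by blast
  have pw: "\<exists>vs es. upath G (insert e F) vs es \<and> set vs \<subseteq> insert w S \<and> {hd vs, last vs} = {u, w}"
    if u: "u \<in> S" for u
  proof -
    obtain vs es where vs: "upath G F vs es" "set vs \<subseteq> S" "{hd vs, last vs} = {u, s}"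
      using path u sw(2) by meson
    have ne: "vs \<noteq> []" using vs(1) by (auto simp: upath_def)
    have w: "w \<notin> set vs" using vs sw by auto
    from vs(3) consider "hd vs = u" "last vs = s" | "hd vs = s" "last vs = u"
      by (auto simp: doubleton_eq_iff)
    then show ?thesis
    proof cases
      case 1
      have "upath G (insert e F) (vs @ [w]) (es @ [e])"
        by (rule upath_snoc) (use vs w eF sw 1 in auto)
      then show ?thesis using 1 vs ne by (intro exI[of _ "vs @ [w]"] exI[of _ "es @ [e]"]) auto
    next
      case 2
      have "upath G (insert e F) (w # vs) (e # es)"
        by (rule upath_Cons) (use vs w eF sw 2 in auto)
      then show ?thesis using 2 vs ne by (intro exI[of _ "w # vs"] exI[of _ "e # es"]) auto
    qed
  qed
  have "\<exists>vs es. upath G (insert e F) vs es \<and> set vs \<subseteq> insert w S \<and> {hd vs, last vs} = {u, v}"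
    if uv: "u \<in> insert w S" "v \<in> insert w S" for u v
  proof -
    consider "u \<in> S" "v \<in> S" | "u \<in> S" "v = w" | "u = w" "v \<in> S" | "u = w" "v = w"
      using uv by blast
    then show ?thesis
    proof cases
      case 1
      then show ?thesis using path by (meson upath_mono subset_insertI subset_trans)
    next
      case 2
      then show ?thesis using pw by simp
    next
      case 3
      then show ?thesis using pw[of v] by (simp add: insert_commute)
    next
      case 4
      then show ?thesis by (intro exI[of _ "[w]"] exI[of _ "[]"]) (simp add: upath_single)
    qed
  qed
  moreover have "card (insert w S) = Suc k" using S fin sw by simp
  moreover have "Suc (card (insert e F)) = Suc k" using F fin eF by simp
  moreover have "\<forall>e'\<in>insert e F. tail G e' \<in> insert w S \<and> head G e' \<in> insert w S"
    using F(3) sw by (auto simp: doubleton_eq_iff)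
  ultimately show ?case
    using S F sw e by (intro exI[of _ "insert w S"] exI[of _ "insert e F"]) auto
qed

lemma connected_card_verts_pos: "Digraph_Component.connected G \<Longrightarrow> 1 \<le> card (verts G)"
  using finite_verts unfolding connected_iff_arc_closed by (simp add: Suc_leI card_gt_0_iff)

lemma connected_card_verts_le:
  assumes "Digraph_Component.connected G"
  shows "card (verts G) \<le> Suc (card (arcs G))"
proof -
  obtain F where F: "F \<subseteq> arcs G" "Suc (card F) = card (verts G)"
    using spanning_subtree[OF assms connected_card_verts_pos[OF assms] order_refl]
    by (elim exE conjE)
  have "card F \<le> card (arcs G)" using F(1) by (simp add: card_mono)
  with F(2) show ?thesis by simp
qed

text \<open>Deleting an arc of a cycle keeps the graph connected, and the bound for connected
  graphs, applied to what is left, improves by one.\<close>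

lemma undirected_cycle_card_verts_le:
  assumes conn: "Digraph_Component.connected G" and cyc: "undirected_cycle G vs es"
  shows "card (verts G) \<le> card (arcs G)"
proof -
  define n where "n = length es - 1"
  have es: "length es = Suc n" "length vs = Suc n" "set es \<subseteq> arcs G" "distinct es"
    using cyc by (auto simp: undirected_cycle_def n_def)
  have adj: "{tail G (es ! k), head G (es ! k)} = {vs ! k, vs ! (Suc k mod Suc n)}" if "k < Suc n" for k
    using cyc that es by (auto simp: undirected_cycle_def)
  define e where "e = es ! n"
  have e: "e \<in> arcs G" using es nth_mem[of n es] by (auto simp: e_def)
  define H where "H = G\<lparr>arcs := arcs G - {e}\<rparr>"
  have H: "verts H = verts G" "arcs H = arcs G - {e}" "head H = head G" "tail H = tail G"
    by (auto simp: H_def)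
  interpret H: fin_digraph H
    by unfold_locales (auto simp: H)
  have "Digraph_Component.connected H"
    unfolding H.connected_iff_arc_closed
  proof (intro conjI allI impI)
    show "verts H \<noteq> {}" using conn by (simp add: H connected_iff_arc_closed)
    fix S assume S: "arc_closed H S" "S \<noteq> {}"
    \<comment> \<open>Membership in S is constant along the remaining arcs of the cycle, so the
      deleted arc does not leave S either.\<close>
    have along: "vs ! k \<in> S \<longleftrightarrow> vs ! 0 \<in> S" if "k \<le> n" for k
      using that
    proof (induction k)
      case (Suc k)
      have "es ! k \<in> arcs H"
        using es Suc.prems nth_mem[of k es] nth_eq_iff_index_eq[of es k n] by (auto simp: H e_def)
      then have "tail G (es ! k) \<in> S \<longleftrightarrow> head G (es ! k) \<in> S"
        using S by (auto simp: arc_closed_def H)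
      moreover have "{tail G (es ! k), head G (es ! k)} = {vs ! k, vs ! Suc k}"
        using adj[of k] Suc.prems by simp
      ultimately have "vs ! k \<in> S \<longleftrightarrow> vs ! Suc k \<in> S"
        by (auto simp: doubleton_eq_iff)
      with Suc show ?case by simp
    qed simp
    have "{tail G e, head G e} = {vs ! n, vs ! 0}" using adj[of n] by (simp add: e_def)
    with along[of n] have "head G e \<in> S \<longleftrightarrow> tail G e \<in> S"
      by (auto simp: doubleton_eq_iff)
    then have "arc_closed G S" using S by (auto simp: arc_closed_def H)
    then show "S = verts H" using conn S by (simp add: connected_iff_arc_closed H)
  qed
  from H.connected_card_verts_le[OF this] have "card (verts G) \<le> Suc (card (arcs G - {e}))"
    by (simp add: H)
  also have "\<dots> = card (arcs G)" using e by (intro card_Suc_Diff1) auto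
  finally show ?thesis .
qed

text \<open>Turns the absence of cycles into a relation between cardinalities, that is, between
  exponents of N. An arc outside a spanning tree closes the path between its ends to a cycle; for a
  loop that path has length 0, for an arc parallel to a tree edge length 1.\<close>

lemma undirected_tree_iff_card:
  assumes conn: "Digraph_Component.connected G"
  shows "undirected_tree G \<longleftrightarrow> card (verts G) = Suc (card (arcs G))"
proof
  assume "card (verts G) = Suc (card (arcs G))"
  then show "undirected_tree G"
    using conn undirected_cycle_card_verts_le[OF conn] unfolding undirected_tree_def
    by (metis Suc_n_not_le_n)
next
  assume tree: "undirected_tree G"
  obtain S F where S: "S \<subseteq> verts G" "card S = card (verts G)"
    and F: "F \<subseteq> arcs G" "Suc (card F) = card (verts G)"
    and path: "\<forall>u\<in>S. \<forall>v\<in>S.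
        \<exists>vs es. upath G F vs es \<and> set vs \<subseteq> S \<and> {hd vs, last vs} = {u, v}"
    using spanning_subtree[OF conn connected_card_verts_pos[OF conn] order_refl]
    by (elim exE conjE)
  have SV: "S = verts G" using S by (simp add: card_subset_eq)
  have "F = arcs G"
  proof (rule ccontr)
    assume "F \<noteq> arcs G"
    then obtain e where e: "e \<in> arcs G" "e \<notin> F" using F by auto
    then obtain vs es where vs: "upath G F vs es" "{hd vs, last vs} = {head G e, tail G e}"
      using path SV by (meson head_in_verts tail_in_verts)
    have l: "length vs = Suc (length es)" using vs by (simp add: upath_def)
    then have "last vs = vs ! length es" "hd vs = vs ! 0"
      by (cases vs rule: rev_cases, auto simp: nth_append) (cases vs; auto)
    moreover have "\<forall>k<length (es @ [e]). {tail G ((es @ [e]) ! k), head G ((es @ [e]) ! k)}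
        = {vs ! k, vs ! (Suc k mod length (es @ [e]))}"
    proof (intro allI impI)
      fix k assume k: "k < length (es @ [e])"
      show "{tail G ((es @ [e]) ! k), head G ((es @ [e]) ! k)} = {vs ! k, vs ! (Suc k mod length (es @ [e]))}"
      proof (cases "k < length es")
        case True
        then have "Suc k mod length (es @ [e]) = Suc k" by simp
        with True vs(1) show ?thesis by (simp only: upath_def nth_append if_True)
      next
        case False
        with k have "k = length es" by simp
        then show ?thesis using calculation vs(2) by (simp add: insert_commute)
      qed
    qed
    ultimately have "undirected_cycle G vs (es @ [e])"
      using vs(1) e F l unfolding undirected_cycle_def upath_def by auto
    with tree show False by (auto simp: undirected_tree_def)
  qed
  with F show "card (verts G) = Suc (card (arcs G))" by simp
qed

end

section \<open>Counting pairings\<close>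

text \<open>The function x collects what paired edges must share: the label alone for admissible
  pairings, the label with row and column index for Wick's formula.\<close>

definition pairings :: "'e set \<Rightarrow> ('e \<Rightarrow> 'k) \<Rightarrow> 'e set set set" where
  "pairings E x = {\<phi>. partition_on E \<phi> \<and> (\<forall>p\<in>\<phi>. \<exists>e e'. e \<noteq> e' \<and> p = {e, e'} \<and> x e = x e')}"

lemma admissible_pairings_eq: "admissible_pairings G inp = pairings (W_arcs G inp) (\<lambda>e. ell (inp e))"
  by (simp add: admissible_pairings_def pairings_def)

lemma finite_pairings: "finite E \<Longrightarrow> finite (pairings E x)"
  by (rule finite_subset[of _ "Pow (Pow E)"]) (auto simp: pairings_def partition_on_def)

lemma pairings_empty: "pairings {} x = {{}}"
  by (auto simp: pairings_def partition_on_empty)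

lemma pairings_rec:
  assumes "e0 \<in> E"
  shows "pairings E x = (\<Union>e'\<in>{e'\<in>E - {e0}. x e' = x e0}. insert {e0, e'} ` pairings (E - {e0, e'}) x)"
proof (intro equalityI subsetI)
  fix \<phi> assume \<phi>: "\<phi> \<in> pairings E x"
  then have part: "partition_on E \<phi>" by (simp add: pairings_def)
  then obtain p where p: "p \<in> \<phi>" "e0 \<in> p" using assms by (auto simp: partition_on_def)
  then obtain e' where e': "p = {e0, e'}" "e0 \<noteq> e'" "x e' = x e0"
    using \<phi> by (fastforce simp: pairings_def)
  have "disjnt p (\<Union>(\<phi> - {p}))"
    using part p by (auto simp: partition_on_def disjnt_def pairwise_def)
  then have "partition_on (E - p) (\<phi> - {p})"
    using part p partition_on_insert[of p "\<phi> - {p}" E] by (simp add: insert_absorb)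
  then have "\<phi> - {p} \<in> pairings (E - {e0, e'}) x"
    using \<phi> e' by (auto simp: pairings_def)
  moreover have "\<phi> = insert {e0, e'} (\<phi> - {p})" using p e' by auto
  moreover have "e' \<in> E" using part p e' by (auto simp: partition_on_def)
  ultimately show "\<phi> \<in> (\<Union>e'\<in>{e'\<in>E - {e0}. x e' = x e0}. insert {e0, e'} ` pairings (E - {e0, e'}) x)"
    using e' by blast
next
  fix \<phi> assume "\<phi> \<in> (\<Union>e'\<in>{e'\<in>E - {e0}. x e' = x e0}. insert {e0, e'} ` pairings (E - {e0, e'}) x)"
  then obtain e' \<psi> where e': "e' \<in> E" "e' \<noteq> e0" "x e' = x e0" "\<phi> = insert {e0, e'} \<psi>"
    "\<psi> \<in> pairings (E - {e0, e'}) x" by auto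
  then have "disjnt {e0, e'} (\<Union>\<psi>)" by (auto simp: pairings_def partition_on_def disjnt_def)
  then have "partition_on E \<phi>"
    using e' assms by (auto simp: pairings_def partition_on_insert)
  moreover have "\<exists>a b. a \<noteq> b \<and> {e0, e'} = {a, b} \<and> x a = x b"
    using e' by (intro exI[of _ e0] exI[of _ e']) auto
  ultimately show "\<phi> \<in> pairings E x" using e' by (auto simp: pairings_def)
qed

lemma card_pairings_rec:
  assumes E: "finite E" "e0 \<in> E"
  shows "card (pairings E x) = (\<Sum>e'\<in>{e'\<in>E - {e0}. x e' = x e0}. card (pairings (E - {e0, e'}) x))"
proof -
  have notin: "e0 \<notin> \<Union>\<psi>" if "\<psi> \<in> pairings (E - {e0, e'}) x" for \<psi> e'
    using that by (auto simp: pairings_def partition_on_def)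
  have "card (pairings E x) = (\<Sum>e'\<in>{e'\<in>E - {e0}. x e' = x e0}. card (insert {e0, e'} ` pairings (E - {e0, e'}) x))"
    unfolding pairings_rec[OF E(2), of x]
  proof (rule card_UN_disjoint)
    show "\<forall>i\<in>{e'\<in>E - {e0}. x e' = x e0}. finite (insert {e0, i} ` pairings (E - {e0, i}) x)"
      using E finite_pairings[of "E - {e0, _}" x] by auto
    show "\<forall>i\<in>{e'\<in>E - {e0}. x e' = x e0}. \<forall>j\<in>{e'\<in>E - {e0}. x e' = x e0}. i \<noteq> j \<longrightarrow>
        insert {e0, i} ` pairings (E - {e0, i}) x \<inter> insert {e0, j} ` pairings (E - {e0, j}) x = {}"
    proof (intro ballI impI)
      fix i j assume ij: "i \<in> {e'\<in>E - {e0}. x e' = x e0}" "j \<in> {e'\<in>E - {e0}. x e' = x e0}" "i \<noteq> j"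
      show "insert {e0, i} ` pairings (E - {e0, i}) x \<inter> insert {e0, j} ` pairings (E - {e0, j}) x = {}"
      proof (rule ccontr)
        assume "\<not> ?thesis"
        then obtain \<psi> \<psi>' where *: "\<psi> \<in> pairings (E - {e0, i}) x" "\<psi>' \<in> pairings (E - {e0, j}) x"
          "insert {e0, i} \<psi> = insert {e0, j} \<psi>'" by auto
        then have "{e0, i} \<in> \<psi>'" using ij by (auto simp: doubleton_eq_iff)
        then show False using notin[OF *(2)] by auto
      qed
    qed
  qed (use E in auto)
  also have "\<dots> = (\<Sum>e'\<in>{e'\<in>E - {e0}. x e' = x e0}. card (pairings (E - {e0, e'}) x))"
  proof (intro sum.cong refl card_image inj_onI)
    fix e' \<psi> \<psi>'
    assume *: "\<psi> \<in> pairings (E - {e0, e'}) x" "\<psi>' \<in> pairings (E - {e0, e'}) x"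
      "insert {e0, e'} \<psi> = insert {e0, e'} \<psi>'"
    have "{e0, e'} \<notin> \<psi>" "{e0, e'} \<notin> \<psi>'"
      using notin[OF *(1)] notin[OF *(2)] by auto
    with *(3) show "\<psi> = \<psi>'" by (metis insert_ident)
  qed
  finally show ?thesis .
qed

text \<open>Both sides obey the same recursion: the partner of a fixed \<open>e0\<close> lies in the
  fibre of \<open>e0\<close>, and removing the pair shrinks this fibre by two and leaves the others
  alone. A fibre of odd size makes both sides 0.\<close>

lemma card_pairings:
  assumes "finite E" "finite Y" "x ` E \<subseteq> Y"
  shows "real (card (pairings E x)) = (\<Prod>y\<in>Y. gauss_moment (card {e\<in>E. x e = y}))"
  using assms
proof (induction "card E" arbitrary: E rule: less_induct)
  case less
  show ?case
  proof (cases "E = {}")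
    case True
    then show ?thesis by (simp add: pairings_empty)
  next
    case False
    then obtain e0 where e0: "e0 \<in> E" by auto
    define F where "F = {e'\<in>E - {e0}. x e' = x e0}"
    define R where "R = (\<Prod>y\<in>Y - {x e0}. gauss_moment (card {e\<in>E. x e = y}))"
    have y0: "x e0 \<in> Y" using e0 less.prems by auto
    have finF: "finite F" using less.prems by (simp add: F_def)
    have fib: "{e\<in>E. x e = x e0} = insert e0 F" using e0 by (auto simp: F_def)
    have cF: "card {e\<in>E. x e = x e0} = Suc (card F)"
      unfolding fib using finF by (simp add: F_def)
    have rec: "real (card (pairings (E - {e0, e'}) x)) = gauss_moment (card F - 1) * R" if e': "e' \<in> F" for e'
    proof -
      have "real (card (pairings (E - {e0, e'}) x)) =
          (\<Prod>y\<in>Y. gauss_moment (card {e\<in>E - {e0, e'}. x e = y}))"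
      proof (rule less.hyps)
        show "card (E - {e0, e'}) < card E"
          by (rule psubset_card_mono) (use e0 less.prems in auto)
      qed (use less.prems in auto)
      also have "\<dots> = gauss_moment (card {e\<in>E - {e0, e'}. x e = x e0}) *
          (\<Prod>y\<in>Y - {x e0}. gauss_moment (card {e\<in>E - {e0, e'}. x e = y}))"
        using less.prems y0 by (intro prod.remove) auto
      also have "{e\<in>E - {e0, e'}. x e = x e0} = F - {e'}" by (auto simp: F_def)
      also have "card (F - {e'}) = card F - 1" using e' finF by simp
      also have "(\<Prod>y\<in>Y - {x e0}. gauss_moment (card {e\<in>E - {e0, e'}. x e = y})) = R"
        unfolding R_def
      proof (rule prod.cong[OF refl])
        fix y assume "y \<in> Y - {x e0}"
        then have "{e\<in>E - {e0, e'}. x e = y} = {e\<in>E. x e = y}" using e' by (auto simp: F_def)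
        then show "gauss_moment (card {e\<in>E - {e0, e'}. x e = y}) = gauss_moment (card {e\<in>E. x e = y})"
          by simp
      qed
      finally show ?thesis .
    qed
    have "real (card (pairings E x)) = (\<Sum>e'\<in>F. real (card (pairings (E - {e0, e'}) x)))"
      unfolding card_pairings_rec[OF less.prems(1) e0] F_def by simp
    also have "\<dots> = real (card F) * (gauss_moment (card F - 1) * R)"
      using rec by simp
    \<comment> \<open>For empty F the truncated \<open>card F - 1\<close> does no harm: the factor
      \<open>card F\<close> is 0, and so is \<open>gauss_moment 1\<close>.\<close>
    also have "\<dots> = gauss_moment (Suc (card F)) * R"
      by (cases "card F") (simp_all add: gauss_moment_Suc_Suc)
    also have "\<dots> = (\<Prod>y\<in>Y. gauss_moment (card {e\<in>E. x e = y}))"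
      unfolding R_def cF[symmetric] using less.prems y0 by (intro prod.remove[symmetric]) auto
    finally show ?thesis .
  qed
qed

section \<open>Wick's formula for products of matrix entries\<close>

lemma prod_fibers:
  fixes f :: "'k \<Rightarrow> 'b::comm_semiring_1"
  assumes "finite E" "finite Y" "x ` E \<subseteq> Y"
  shows "(\<Prod>e\<in>E. f (x e)) = (\<Prod>y\<in>Y. f y ^ card {e\<in>E. x e = y})"
proof -
  have "(\<Prod>e\<in>E. f (x e)) = (\<Prod>y\<in>Y. \<Prod>e\<in>{e\<in>E. x e = y}. f (x e))"
    by (rule prod.group[symmetric]) (use assms in auto)
  then show ?thesis by simp
qed

lemma (in prob_space) normal_moments:
  assumes D: "distributed M lborel X (normal_density 0 s)" and s: "s > 0"
  shows "integrable M (\<lambda>\<omega>. X \<omega> ^ n)" "expectation (\<lambda>\<omega>. X \<omega> ^ n) = s ^ n * gauss_moment n"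
proof -
  have [measurable]: "X \<in> borel_measurable M"
    using distributed_measurable[OF D] by simp
  have "distr M borel X = distr M lborel X" by (rule distr_cong) auto
  then have eq: "distr M borel X = normal_law 0 s"
    using distributed_distr_eq_density[OF D] s by (simp add: normal_law_def)
  from normal_law_moments[of s n] s show "integrable M (\<lambda>\<omega>. X \<omega> ^ n)"
    "expectation (\<lambda>\<omega>. X \<omega> ^ n) = s ^ n * gauss_moment n"
    unfolding eq[symmetric] by (simp_all add: integrable_distr_eq integral_distr)
qed

text \<open>The factors are grouped by matrix entry. Independence inside each matrix and then
  between the matrices leaves a product of one-dimensional normal moments, which
  \<open>card_pairings\<close> reads as a number of pairings of edges that carry the same
  entry.\<close>

lemma (in prob_space) wick_matrix_entries:
  fixes W :: "nat \<Rightarrow> 'a \<Rightarrow> nat \<Rightarrow> nat \<Rightarrow> real" and E :: "'e set"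
  assumes W: "independent_gaussian_matrices M N \<sigma> W" and \<sigma>: "\<And>l. \<sigma> l > 0"
    and E: "finite E" and ab: "\<And>e. e \<in> E \<Longrightarrow> a e \<in> {1..N}" "\<And>e. e \<in> E \<Longrightarrow> b e \<in> {1..N}"
  shows "integrable M (\<lambda>\<omega>. \<Prod>e\<in>E. W (l e) \<omega> (a e) (b e))"
    and "expectation (\<lambda>\<omega>. \<Prod>e\<in>E. W (l e) \<omega> (a e) (b e)) =
      (\<Prod>e\<in>E. \<sigma> (l e)) * real (card (pairings E (\<lambda>e. (l e, a e, b e))))"
proof -
  define D where "D = {1..N} \<times> {1..N}"
  define L where "L = l ` E"
  define x where "x e = (l e, a e, b e)" for e
  define n where "n y = card {e\<in>E. x e = y}" for y
  have fin: "finite D" "finite L" using E by (auto simp: D_def L_def)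
  have xE: "x ` E \<subseteq> L \<times> D" using ab by (auto simp: x_def L_def D_def)
  have indep: "indep_vars (\<lambda>_. \<Pi>\<^sub>M ab\<in>D. borel) (\<lambda>l \<omega>. \<lambda>(a, b)\<in>D. W l \<omega> a b) UNIV"
    and indep': "\<And>l. indep_vars (\<lambda>_. borel) (\<lambda>(a, b) \<omega>. W l \<omega> a b) D"
    and dist: "\<And>l a b. (a, b) \<in> D \<Longrightarrow> distributed M lborel (\<lambda>\<omega>. W l \<omega> a b) (normal_density 0 (\<sigma> l))"
    using W unfolding independent_gaussian_matrices_def D_def by auto
  define F where "F k \<omega> = (\<Prod>(a, b)\<in>D. W k \<omega> a b ^ n (k, a, b))" for k \<omega>
  have F: "integrable M (F k) \<and> expectation (F k) = (\<Prod>(a, b)\<in>D. \<sigma> k ^ n (k, a, b) * gauss_moment (n (k, a, b)))" for k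
  proof -
    have "indep_vars (\<lambda>_. borel) (\<lambda>p \<omega>. (\<lambda>(a, b) \<omega>. W k \<omega> a b) p \<omega> ^ n (k, p)) D"
      by (rule indep_vars_compose2[OF indep'[of k]]) auto
    then have iv: "indep_vars (\<lambda>_. borel) (\<lambda>p \<omega>. W k \<omega> (fst p) (snd p) ^ n (k, p)) D"
      by (simp add: case_prod_beta)
    have int: "integrable M (\<lambda>\<omega>. W k \<omega> (fst p) (snd p) ^ n (k, p))"
      and ex: "expectation (\<lambda>\<omega>. W k \<omega> (fst p) (snd p) ^ n (k, p)) =
        \<sigma> k ^ n (k, p) * gauss_moment (n (k, p))" if "p \<in> D" for p
      using that normal_moments[OF dist \<sigma>, of "fst p" "snd p" k "n (k, p)"] by auto
    show ?thesis
      using indep_vars_lebesgue_integral[OF fin(1) iv int] indep_vars_integrable[OF fin(1) iv int]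
      unfolding F_def case_prod_beta by (simp add: ex)
  qed
  \<comment> \<open>\<open>F k\<close> is a function of the k-th matrix alone, so the independence
    of the matrices passes to it.\<close>
  have indepF: "indep_vars (\<lambda>_. borel) F L"
  proof -
    have "indep_vars (\<lambda>_. borel) (\<lambda>k \<omega>. (\<lambda>m. \<Prod>p\<in>D. m p ^ n (k, p)) (\<lambda>(a, b)\<in>D. W k \<omega> a b)) L"
      by (rule indep_vars_compose2[OF indep_vars_subset[OF indep]]) auto
    moreover have "(\<lambda>m. \<Prod>p\<in>D. m p ^ n (k, p)) (\<lambda>(a, b)\<in>D. W k \<omega> a b) = F k \<omega>" for k \<omega>
      unfolding F_def by (auto intro!: prod.cong)
    ultimately show ?thesis by simp
  qed
  have eq: "(\<Prod>e\<in>E. W (l e) \<omega> (a e) (b e)) = (\<Prod>k\<in>L. F k \<omega>)" for \<omega>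
  proof -
    have "(\<Prod>e\<in>E. W (l e) \<omega> (a e) (b e)) = (\<Prod>e\<in>E. (\<lambda>(k, a, b). W k \<omega> a b) (x e))"
      by (simp add: x_def)
    also have "\<dots> = (\<Prod>y\<in>L \<times> D. (\<lambda>(k, a, b). W k \<omega> a b) y ^ n y)"
      unfolding n_def by (rule prod_fibers) (use E fin xE in auto)
    also have "\<dots> = (\<Prod>k\<in>L. \<Prod>p\<in>D. (\<lambda>(k, a, b). W k \<omega> a b) (k, p) ^ n (k, p))"
      unfolding prod.cartesian_product by (rule prod.cong) auto
    finally show ?thesis by (simp add: F_def case_prod_beta)
  qed
  show "integrable M (\<lambda>\<omega>. \<Prod>e\<in>E. W (l e) \<omega> (a e) (b e))"
    unfolding eq by (rule indep_vars_integrable[OF fin(2) indepF]) (use F in auto)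
  have "expectation (\<lambda>\<omega>. \<Prod>e\<in>E. W (l e) \<omega> (a e) (b e)) =
      (\<Prod>k\<in>L. \<Prod>(a, b)\<in>D. \<sigma> k ^ n (k, a, b) * gauss_moment (n (k, a, b)))"
    unfolding eq using indep_vars_lebesgue_integral[OF fin(2) indepF] F by simp
  also have "\<dots> = (\<Prod>y\<in>L \<times> D. \<sigma> (fst y) ^ n y * gauss_moment (n y))"
    by (simp add: prod.cartesian_product case_prod_beta)
  also have "\<dots> = (\<Prod>y\<in>L \<times> D. \<sigma> (fst y) ^ n y) * (\<Prod>y\<in>L \<times> D. gauss_moment (n y))"
    by (rule prod.distrib)
  also have "(\<Prod>y\<in>L \<times> D. \<sigma> (fst y) ^ n y) = (\<Prod>e\<in>E. \<sigma> (fst (x e)))"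
    unfolding n_def by (rule prod_fibers[symmetric]) (use E fin xE in auto)
  also have "(\<Prod>y\<in>L \<times> D. gauss_moment (n y)) = real (card (pairings E x))"
    unfolding n_def by (rule card_pairings[symmetric]) (use E fin xE in auto)
  finally show "expectation (\<lambda>\<omega>. \<Prod>e\<in>E. W (l e) \<omega> (a e) (b e)) =
      (\<Prod>e\<in>E. \<sigma> (l e)) * real (card (pairings E (\<lambda>e. (l e, a e, b e))))"
    by (simp add: x_def[abs_def])
qed

section \<open>The expected value of a product graph\<close>

text \<open>The values are left arbitrary because i will be an index assignment, the indicator of a
  vertex set or the class map of the gluing.\<close>

definition block_const :: "('v, 'e) pre_digraph \<Rightarrow> 'e set set \<Rightarrow> ('v \<Rightarrow> 'k) \<Rightarrow> bool" where
  "block_const G \<phi> i \<longleftrightarrow>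
     (\<forall>p\<in>\<phi>. \<forall>e\<in>p. \<forall>e'\<in>p. i (head G e) = i (head G e') \<and> i (tail G e) = i (tail G e'))"

text \<open>The form in which Wick's formula produces the count; \<open>gluing_count_eq\<close>
  identifies it as a power of N.\<close>

definition gluing_count :: "('v, 'e) pre_digraph \<Rightarrow> 'e set set \<Rightarrow> nat \<Rightarrow> nat" where
  "gluing_count G \<phi> N = card {i \<in> verts G \<rightarrow>\<^sub>E {1..N}. block_const G \<phi> i}"

text \<open>Separates admissibility, which does not involve the indices, from compatibility with
  them; this allows the sums over indices and pairings to be exchanged.\<close>

lemma pairings_block_const:
  "pairings (W_arcs G inp) (\<lambda>e. (ell (inp e), i (head G e), i (tail G e))) =
     {\<phi> \<in> admissible_pairings G inp. block_const G \<phi> i}" (is "?L = ?R")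
proof (intro equalityI subsetI)
  fix \<phi> assume \<phi>: "\<phi> \<in> ?L"
  have *: "(\<exists>e e'. e \<noteq> e' \<and> p = {e, e'} \<and> ell (inp e) = ell (inp e')) \<and>
      (\<forall>e\<in>p. \<forall>e'\<in>p. i (head G e) = i (head G e') \<and> i (tail G e) = i (tail G e'))"
    if p: "p \<in> \<phi>" for p
  proof -
    obtain e e' where "e \<noteq> e'" "p = {e, e'}" "ell (inp e) = ell (inp e')"
      "i (head G e) = i (head G e')" "i (tail G e) = i (tail G e')"
      using \<phi> p by (auto simp: pairings_def)
    then show ?thesis by (intro conjI exI[of _ e] exI[of _ e']) simp_all
  qed
  have "partition_on (W_arcs G inp) \<phi>" using \<phi> unfolding pairings_def by blast
  moreover have "\<forall>p\<in>\<phi>. \<exists>e e'. e \<noteq> e' \<and> p = {e, e'} \<and> ell (inp e) = ell (inp e')"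
    by (intro ballI) (rule conjunct1[OF *])
  moreover have "block_const G \<phi> i"
    unfolding block_const_def by (intro ballI) (rule conjunct2[OF *, rule_format])
  ultimately show "\<phi> \<in> ?R"
    unfolding admissible_pairings_def by (intro CollectI conjI)
next
  fix \<phi> assume \<phi>: "\<phi> \<in> ?R"
  have "\<exists>e e'. e \<noteq> e' \<and> p = {e, e'} \<and> (ell (inp e), i (head G e), i (tail G e)) =
      (ell (inp e'), i (head G e'), i (tail G e'))" if p: "p \<in> \<phi>" for p
  proof -
    obtain e e' where e: "e \<noteq> e'" "p = {e, e'}" "ell (inp e) = ell (inp e')"
      using \<phi> p by (auto simp: admissible_pairings_def)
    then have ep: "e \<in> p" "e' \<in> p" by auto
    have "block_const G \<phi> i" using \<phi> by simp
    then have "i (head G e) = i (head G e')" "i (tail G e) = i (tail G e')"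
      using p ep unfolding block_const_def by blast+
    with e show ?thesis by (intro exI[of _ e] exI[of _ e']) (simp only: simp_thms)
  qed
  then have "\<forall>p\<in>\<phi>. \<exists>e e'. e \<noteq> e' \<and> p = {e, e'} \<and> (ell (inp e), i (head G e), i (tail G e)) =
      (ell (inp e'), i (head G e'), i (tail G e'))" by (intro ballI)
  moreover have "partition_on (W_arcs G inp) \<phi>"
    using \<phi> unfolding admissible_pairings_def by blast
  ultimately show "\<phi> \<in> ?L" unfolding pairings_def by (intro CollectI conjI)
qed

lemma (in fin_digraph) finite_W_arcs: "finite (W_arcs G inp)"
  by (simp add: W_arcs_def)

lemma (in fin_digraph) finite_admissible_pairings: "finite (admissible_pairings G inp)"
  unfolding admissible_pairings_eq by (intro finite_pairings finite_W_arcs)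

lemma (in fin_digraph) graph_value_ones:
  "graph_value G (\<lambda>_. N) (\<lambda>_ _. 1) (\<lambda>e. input_matrix w (inp e)) =
     (\<Sum>i\<in>verts G \<rightarrow>\<^sub>E {1..N}. \<Prod>e\<in>W_arcs G inp. w (ell (inp e)) (i (head G e)) (i (tail G e)))"
  unfolding graph_value_def
proof (rule sum.cong[OF refl])
  fix i
  have "(\<Prod>e\<in>arcs G. input_matrix w (inp e) (i (head G e)) (i (tail G e))) =
      (\<Prod>e\<in>W_arcs G inp. input_matrix w (inp e) (i (head G e)) (i (tail G e)))"
  proof (rule prod.mono_neutral_right)
    show "\<forall>e\<in>arcs G - W_arcs G inp. input_matrix w (inp e) (i (head G e)) (i (tail G e)) = 1"
    proof
      fix e assume "e \<in> arcs G - W_arcs G inp"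
      then have "inp e = Ones_input" by (cases "inp e") (auto simp: W_arcs_def)
      then show "input_matrix w (inp e) (i (head G e)) (i (tail G e)) = 1" by simp
    qed
  qed (auto simp: W_arcs_def)
  also have "\<dots> = (\<Prod>e\<in>W_arcs G inp. w (ell (inp e)) (i (head G e)) (i (tail G e)))"
    by (rule prod.cong) (auto simp: W_arcs_def)
  finally show "(\<Prod>e\<in>arcs G. input_matrix w (inp e) (i (head G e)) (i (tail G e))) * (\<Prod>w\<in>verts G. 1) =
      (\<Prod>e\<in>W_arcs G inp. w (ell (inp e)) (i (head G e)) (i (tail G e)))" by simp
qed

lemma (in prob_space) expectation_graph_value:
  fixes W :: "nat \<Rightarrow> 'a \<Rightarrow> nat \<Rightarrow> nat \<Rightarrow> real"
    and G :: "('v, 'e) pre_digraph" and inp :: "'e \<Rightarrow> edge_input"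
  assumes W: "independent_gaussian_matrices M N \<sigma> W" and \<sigma>: "\<And>l. \<sigma> l > 0"
    and G: "fin_digraph G"
  defines "V \<equiv> \<lambda>\<omega>. graph_value G (\<lambda>_. N) (\<lambda>_ _. 1) (\<lambda>e. input_matrix (\<lambda>l. W l \<omega>) (inp e))"
  shows "integrable M V"
    and "expectation V =
      sigma_graph \<sigma> G inp * (\<Sum>\<phi>\<in>admissible_pairings G inp. real (gluing_count G \<phi> N))"
proof -
  interpret G: fin_digraph G by fact
  let ?I = "verts G \<rightarrow>\<^sub>E {1..N}"
  have finI: "finite ?I" by (simp add: finite_PiE)
  have V: "V = (\<lambda>\<omega>. \<Sum>i\<in>?I. \<Prod>e\<in>W_arcs G inp. W (ell (inp e)) \<omega> (i (head G e)) (i (tail G e)))"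
    unfolding V_def G.graph_value_ones ..
  have ab: "i (head G e) \<in> {1..N}" "i (tail G e) \<in> {1..N}" if "i \<in> ?I" "e \<in> W_arcs G inp" for i e
    using that by (auto simp: W_arcs_def PiE_iff simp del: atLeastAtMost_iff)
  have wick: "integrable M (\<lambda>\<omega>. \<Prod>e\<in>W_arcs G inp. W (ell (inp e)) \<omega> (i (head G e)) (i (tail G e)))"
    "expectation (\<lambda>\<omega>. \<Prod>e\<in>W_arcs G inp. W (ell (inp e)) \<omega> (i (head G e)) (i (tail G e))) =
      (\<Prod>e\<in>W_arcs G inp. \<sigma> (ell (inp e))) *
      real (card (pairings (W_arcs G inp) (\<lambda>e. (ell (inp e), i (head G e), i (tail G e)))))"
    if i: "i \<in> ?I" for i
    by (rule wick_matrix_entries[OF W \<sigma> G.finite_W_arcs ab(1)[OF i] ab(2)[OF i]]; assumption)+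
  show "integrable M V"
    unfolding V by (rule Bochner_Integration.integrable_sum) (rule wick(1))
  have "expectation V = (\<Sum>i\<in>?I. expectation (\<lambda>\<omega>. \<Prod>e\<in>W_arcs G inp. W (ell (inp e)) \<omega> (i (head G e)) (i (tail G e))))"
    unfolding V by (rule Bochner_Integration.integral_sum) (rule wick(1))
  also have "\<dots> = (\<Sum>i\<in>?I. sigma_graph \<sigma> G inp * real (card {\<phi> \<in> admissible_pairings G inp. block_const G \<phi> i}))"
  proof (rule sum.cong[OF refl])
    fix i assume i: "i \<in> ?I"
    show "expectation (\<lambda>\<omega>. \<Prod>e\<in>W_arcs G inp. W (ell (inp e)) \<omega> (i (head G e)) (i (tail G e))) =
        sigma_graph \<sigma> G inp * real (card {\<phi> \<in> admissible_pairings G inp. block_const G \<phi> i})"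
      unfolding wick(2)[OF i] pairings_block_const sigma_graph_def ..
  qed
  also have "\<dots> = sigma_graph \<sigma> G inp * real (\<Sum>i\<in>?I. card {\<phi> \<in> admissible_pairings G inp. block_const G \<phi> i})"
    by (simp add: sum_distrib_left)
  \<comment> \<open>Double counting of the compatible pairs of an index assignment and a
    pairing.\<close>
  also have "(\<Sum>i\<in>?I. card {\<phi> \<in> admissible_pairings G inp. block_const G \<phi> i}) =
      (\<Sum>\<phi>\<in>admissible_pairings G inp. gluing_count G \<phi> N)"
    unfolding gluing_count_def
    using sum.swap_restrict[OF finI G.finite_admissible_pairings,
        where g = "\<lambda>_ _. 1 :: nat" and R = "\<lambda>i \<phi>. block_const G \<phi> i"]
    by simp
  finally show "expectation V =
      sigma_graph \<sigma> G inp * (\<Sum>\<phi>\<in>admissible_pairings G inp. real (gluing_count G \<phi> N))"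
    by simp
qed

section \<open>Glued graphs\<close>

lemma equiv_glue: "equiv UNIV (glue G \<phi>)"
proof (rule equivI)
  show "sym (glue G \<phi>)"
    unfolding glue_def by (rule sym_rtrancl) (auto simp: sym_def; blast)
qed (auto simp: glue_def intro: refl_rtrancl trans_rtrancl)

lemma block_const_glue:
  assumes "block_const G \<phi> i" "(x, y) \<in> glue G \<phi>"
  shows "i x = i y"
  using assms(2) unfolding glue_def
proof (induction rule: rtrancl_induct)
  case (step y z)
  then show ?case using assms(1) unfolding block_const_def by (auto; metis)
qed simp

lemma glue_class_eq_iff: "glue G \<phi> `` {x} = glue G \<phi> `` {y} \<longleftrightarrow> (x, y) \<in> glue G \<phi>"
  by (rule eq_equiv_class_iff[OF equiv_glue]) auto

text \<open>The class map is the universal block-constant map: by \<open>block_const_glue\<close>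
  every other one factors through it.\<close>

lemma block_const_glue_class: "block_const G \<phi> (\<lambda>v. glue G \<phi> `` {v})"
  unfolding block_const_def glue_class_eq_iff unfolding glue_def
  by (intro ballI conjI r_into_rtrancl) blast+

lemma glue_class_block:
  assumes "p \<in> \<phi>" "e \<in> p"
  shows "glue G \<phi> `` (head G ` p) = glue G \<phi> `` {head G e}"
    and "glue G \<phi> `` (tail G ` p) = glue G \<phi> `` {tail G e}"
proof -
  have "glue G \<phi> `` {head G e'} = glue G \<phi> `` {head G e}"
    "glue G \<phi> `` {tail G e'} = glue G \<phi> `` {tail G e}" if "e' \<in> p" for e'
    using block_const_glue_class[of G \<phi>] assms that unfolding block_const_def by blast+
  then show "glue G \<phi> `` (head G ` p) = glue G \<phi> `` {head G e}"
    "glue G \<phi> `` (tail G ` p) = glue G \<phi> `` {tail G e}"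
    using assms(2) by blast+
qed

lemma verts_glued_graph: "verts (glued_graph G \<phi>) = (\<lambda>v. glue G \<phi> `` {v}) ` verts G"
  by (auto simp: glued_graph_def quotient_def)

locale glued = fin_digraph G for G :: "('v, 'e) pre_digraph" +
  fixes inp :: "'e \<Rightarrow> edge_input" and \<phi> :: "'e set set"
  assumes adm: "\<phi> \<in> admissible_pairings G inp"
begin

abbreviation cls :: "'v \<Rightarrow> 'v set" where "cls v \<equiv> glue G \<phi> `` {v}"

lemma part: "partition_on (W_arcs G inp) \<phi>"
  using adm by (simp add: admissible_pairings_def)

lemma block_subset: "p \<in> \<phi> \<Longrightarrow> p \<subseteq> arcs G"
  using part by (auto simp: partition_on_def W_arcs_def)

lemma card_block: "p \<in> \<phi> \<Longrightarrow> card p = 2"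
  using adm by (auto simp: admissible_pairings_def card_2_iff) metis

lemma glued_arcE:
  assumes "p \<in> arcs (glued_graph G \<phi>)"
  obtains e where "e \<in> p" "e \<in> arcs G"
    "head (glued_graph G \<phi>) p = cls (head G e)" "tail (glued_graph G \<phi>) p = cls (tail G e)"
proof (cases "p \<in> \<phi>")
  case True
  then have "p \<noteq> {}" using part by (auto simp: partition_on_def)
  then obtain e where "e \<in> p" by auto
  with True show ?thesis
    using block_subset glue_class_block[OF True, of e G]
    by (intro that[of e]) (auto simp: glued_graph_def)
next
  case False
  with assms obtain e where "p = {e}" "e \<in> arcs G" by (auto simp: glued_graph_def)
  then show ?thesis by (intro that[of e]) (auto simp: glued_graph_def)
qed

lemma glued_arc_of:
  assumes "e \<in> arcs G"
  obtains p where "p \<in> arcs (glued_graph G \<phi>)"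
    "head (glued_graph G \<phi>) p = cls (head G e)" "tail (glued_graph G \<phi>) p = cls (tail G e)"
proof (cases "e \<in> \<Union>\<phi>")
  case True
  then obtain p where p: "p \<in> \<phi>" "e \<in> p" by auto
  show ?thesis
    using p glue_class_block[OF p, of G] by (intro that[of p]) (auto simp: glued_graph_def)
next
  case False
  then show ?thesis using assms by (intro that[of "{e}"]) (auto simp: glued_graph_def)
qed

lemma finite_blocks: "finite \<phi>"
  using part finite_W_arcs by (rule finite_elements[rotated])

lemma fin_digraph_glued: "fin_digraph (glued_graph G \<phi>)"
proof
  show "finite (verts (glued_graph G \<phi>))" by (simp add: verts_glued_graph)
  have "finite {{e} |e. e \<in> arcs G - \<Union>\<phi>}" by (rule finite_subset[of _ "(\<lambda>e. {e}) ` arcs G"]) auto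
  then show "finite (arcs (glued_graph G \<phi>))" using finite_blocks by (simp add: glued_graph_def)
next
  fix p assume "p \<in> arcs (glued_graph G \<phi>)"
  then show "tail (glued_graph G \<phi>) p \<in> verts (glued_graph G \<phi>)"
    "head (glued_graph G \<phi>) p \<in> verts (glued_graph G \<phi>)"
    by (auto simp: verts_glued_graph elim!: glued_arcE)
qed

text \<open>Each block merges two arcs into one, whence the weight 1/2 in \<open>e_check\<close>.
  The count is the same for all pairings, so they differ in order only through their numbers of
  vertices.\<close>

lemma card_arcs_glued: "real (card (arcs (glued_graph G \<phi>))) = e_check G inp"
proof -
  have U: "\<Union>\<phi> = W_arcs G inp" using part by (simp add: partition_on_def)
  have "card (W_arcs G inp) = (\<Sum>p\<in>\<phi>. card p)"
    unfolding U[symmetric]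
    by (rule card_Union_disjoint)
      (use part card_block card.infinite in \<open>fastforce simp: partition_on_def\<close>)+
  also have "\<dots> = 2 * card \<phi>" using card_block by simp
  finally have two: "card (W_arcs G inp) = 2 * card \<phi>" .
  have "arcs (glued_graph G \<phi>) = \<phi> \<union> (\<lambda>e. {e}) ` (arcs G - W_arcs G inp)"
    by (auto simp: glued_graph_def U)
  moreover have "\<phi> \<inter> (\<lambda>e. {e}) ` (arcs G - W_arcs G inp) = {}"
    using card_block by fastforce
  ultimately have "card (arcs (glued_graph G \<phi>)) = card \<phi> + card (arcs G - W_arcs G inp)"
    using finite_blocks by (simp add: card_Un_disjoint card_image)
  with two show ?thesis by (simp add: e_check_def)
qed

text \<open>Block-constant assignments are exactly the functions of the vertex class; the inverse
  bijection evaluates at a representative of each class.\<close>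

lemma gluing_count_eq: "gluing_count G \<phi> N = N ^ card (verts (glued_graph G \<phi>))"
proof -
  let ?Q = "verts (glued_graph G \<phi>)" and ?I = "{i \<in> verts G \<rightarrow>\<^sub>E {1..N}. block_const G \<phi> i}"
  have Q: "?Q = cls ` verts G" by (rule verts_glued_graph)
  then have finQ: "finite ?Q" by simp
  define rep where "rep = inv_into (verts G) cls"
  have rep: "rep C \<in> verts G" "cls (rep C) = C" if "C \<in> ?Q" for C
    using inv_into_into[of C cls "verts G"] f_inv_into_f[of C cls "verts G"] that
    by (simp_all only: Q rep_def)
  have down: "(\<lambda>C\<in>?Q. i (rep C)) \<in> ?Q \<rightarrow>\<^sub>E {1..N}" if "i \<in> ?I" for i
    using that rep(1) by (auto simp: PiE_iff)
  have up: "(\<lambda>v\<in>verts G. f (cls v)) \<in> ?I" if f: "f \<in> ?Q \<rightarrow>\<^sub>E {1..N}" for f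
  proof -
    have "block_const G \<phi> (\<lambda>v\<in>verts G. f (cls v))"
      unfolding block_const_def
    proof (intro ballI)
      fix p e e' assume p: "p \<in> \<phi>" "e \<in> p" "e' \<in> p"
      have "cls (head G e) = cls (head G e')" "cls (tail G e) = cls (tail G e')"
        using block_const_glue_class[of G \<phi>] p unfolding block_const_def by blast+
      moreover have "e \<in> arcs G" "e' \<in> arcs G" using p block_subset by auto
      ultimately show "(\<lambda>v\<in>verts G. f (cls v)) (head G e) = (\<lambda>v\<in>verts G. f (cls v)) (head G e') \<and>
          (\<lambda>v\<in>verts G. f (cls v)) (tail G e) = (\<lambda>v\<in>verts G. f (cls v)) (tail G e')"
        by simp
    qed
    with f show ?thesis by (auto simp: Q)
  qed
  have "bij_betw (\<lambda>f. \<lambda>v\<in>verts G. f (cls v)) (?Q \<rightarrow>\<^sub>E {1..N}) ?I"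
  proof (rule bij_betw_byWitness[where f' = "\<lambda>i. \<lambda>C\<in>?Q. i (rep C)"])
    show "\<forall>f\<in>?Q \<rightarrow>\<^sub>E {1..N}. (\<lambda>C\<in>?Q. (\<lambda>v\<in>verts G. f (cls v)) (rep C)) = f"
    proof
      fix f assume f: "f \<in> ?Q \<rightarrow>\<^sub>E {1..N}"
      show "(\<lambda>C\<in>?Q. (\<lambda>v\<in>verts G. f (cls v)) (rep C)) = f"
        by (rule PiE_ext[OF down[OF up[OF f]] f]) (simp add: rep)
    qed
    show "\<forall>i\<in>?I. (\<lambda>v\<in>verts G. (\<lambda>C\<in>?Q. i (rep C)) (cls v)) = i"
    proof
      fix i assume i: "i \<in> ?I"
      show "(\<lambda>v\<in>verts G. (\<lambda>C\<in>?Q. i (rep C)) (cls v)) = i"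
      proof (rule PiE_ext)
        show "(\<lambda>v\<in>verts G. (\<lambda>C\<in>?Q. i (rep C)) (cls v)) \<in> verts G \<rightarrow>\<^sub>E {1..N}"
          using up[OF down[OF i]] by blast
        fix v assume v: "v \<in> verts G"
        then have "cls v \<in> ?Q" by (simp add: Q)
        moreover from rep(2)[OF this] have "(rep (cls v), v) \<in> glue G \<phi>"
          by (simp only: glue_class_eq_iff)
        ultimately show "(\<lambda>v\<in>verts G. (\<lambda>C\<in>?Q. i (rep C)) (cls v)) v = i v"
          using block_const_glue[of G \<phi> i] i v by simp
      qed (use i in blast)
    qed
  qed (use up down in blast)+
  then have "gluing_count G \<phi> N = card (?Q \<rightarrow>\<^sub>E {1..N})"
    unfolding gluing_count_def by (rule bij_betw_same_card[symmetric])
  also have "\<dots> = N ^ card ?Q" by (simp add: card_PiE[OF finQ])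
  finally show ?thesis .
qed

text \<open>The cut criterion pulled back along the class map: arc-closed sets of the glued graph
  correspond to arc-closed sets of G that respect the blocks. Connectivity can thus be checked
  without handling classes.\<close>

lemma connected_glued_iff:
  "Digraph_Component.connected (glued_graph G \<phi>) \<longleftrightarrow> verts G \<noteq> {} \<and>
     (\<forall>S. arc_closed G S \<longrightarrow> block_const G \<phi> (\<lambda>v. v \<in> S) \<longrightarrow> S \<noteq> {} \<longrightarrow> S = verts G)"
proof -
  interpret H: fin_digraph "glued_graph G \<phi>" by (rule fin_digraph_glued)
  note Q = verts_glued_graph[of G \<phi>]
  have ne: "verts (glued_graph G \<phi>) \<noteq> {} \<longleftrightarrow> verts G \<noteq> {}" by (simp add: Q)
  show ?thesis
    unfolding H.connected_iff_arc_closed ne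
  proof (intro arg_cong2[where f = "(\<and>)"] refl iffI allI impI)
    fix S
    assume *: "\<forall>T. arc_closed (glued_graph G \<phi>) T \<longrightarrow> T \<noteq> {} \<longrightarrow> T = verts (glued_graph G \<phi>)"
      and S: "arc_closed G S" "block_const G \<phi> (\<lambda>v. v \<in> S)" "S \<noteq> {}"
    have cls: "cls v \<in> cls ` S \<longleftrightarrow> v \<in> S" for v
    proof
      assume "cls v \<in> cls ` S"
      then show "v \<in> S" using block_const_glue[OF S(2)] by (auto simp: glue_class_eq_iff)
    qed simp
    have "arc_closed (glued_graph G \<phi>) (cls ` S)"
      unfolding arc_closed_def
    proof (intro conjI ballI)
      show "cls ` S \<subseteq> verts (glued_graph G \<phi>)" using S(1) by (auto simp: arc_closed_def Q)
      fix p assume "p \<in> arcs (glued_graph G \<phi>)"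
      then obtain e where "e \<in> arcs G" "head (glued_graph G \<phi>) p = cls (head G e)"
        "tail (glued_graph G \<phi>) p = cls (tail G e)" by (elim glued_arcE)
      then show "head (glued_graph G \<phi>) p \<in> cls ` S \<longleftrightarrow> tail (glued_graph G \<phi>) p \<in> cls ` S"
        using S(1) by (simp add: cls arc_closed_def)
    qed
    with * S(3) have "cls ` S = verts (glued_graph G \<phi>)" by blast
    then have "v \<in> S" if "v \<in> verts G" for v
      using that cls[of v] by (auto simp: Q)
    then show "S = verts G" using S(1) by (auto simp: arc_closed_def)
  next
    fix T
    assume *: "\<forall>S. arc_closed G S \<longrightarrow> block_const G \<phi> (\<lambda>v. v \<in> S) \<longrightarrow> S \<noteq> {} \<longrightarrow> S = verts G"
      and T: "arc_closed (glued_graph G \<phi>) T" "T \<noteq> {}"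
    define S where "S = {v \<in> verts G. cls v \<in> T}"
    have "arc_closed G S"
      unfolding arc_closed_def
    proof (intro conjI ballI)
      fix e assume e: "e \<in> arcs G"
      obtain p where "p \<in> arcs (glued_graph G \<phi>)"
        "head (glued_graph G \<phi>) p = cls (head G e)" "tail (glued_graph G \<phi>) p = cls (tail G e)"
        by (rule glued_arc_of[OF e])
      then show "head G e \<in> S \<longleftrightarrow> tail G e \<in> S"
        using T(1) e by (auto simp: S_def arc_closed_def)
    qed (simp add: S_def)
    moreover have "block_const G \<phi> (\<lambda>v. v \<in> S)"
      unfolding block_const_def
    proof (intro ballI)
      fix p e e' assume p: "p \<in> \<phi>" "e \<in> p" "e' \<in> p"
      have c: "cls (head G e) = cls (head G e')" "cls (tail G e) = cls (tail G e')"
        using block_const_glue_class[of G \<phi>] p unfolding block_const_def by blast+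
      have "e \<in> arcs G" "e' \<in> arcs G" using p block_subset by auto
      then show "(head G e \<in> S) = (head G e' \<in> S) \<and> (tail G e \<in> S) = (tail G e' \<in> S)"
        unfolding S_def mem_Collect_eq c by simp
    qed
    moreover have "S \<noteq> {}"
      using T by (auto simp: S_def arc_closed_def Q)
    ultimately have "S = verts G" using * by blast
    then show "T = verts (glued_graph G \<phi>)"
      using T(1) by (auto simp: S_def arc_closed_def Q)
  qed
qed

lemma tree_pairings_iff:
  "\<phi> \<in> tree_pairings G inp \<longleftrightarrow> Digraph_Component.connected (glued_graph G \<phi>) \<and>
     real (card (verts (glued_graph G \<phi>))) = e_check G inp + 1"
proof -
  interpret H: fin_digraph "glued_graph G \<phi>" by (rule fin_digraph_glued)
  have "\<phi> \<in> tree_pairings G inp \<longleftrightarrow> undirected_tree (glued_graph G \<phi>)"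
    using adm by (simp add: tree_pairings_def)
  also have "\<dots> \<longleftrightarrow> Digraph_Component.connected (glued_graph G \<phi>) \<and>
      card (verts (glued_graph G \<phi>)) = Suc (card (arcs (glued_graph G \<phi>)))"
    using H.undirected_tree_iff_card by (auto simp: undirected_tree_def)
  finally show ?thesis
    unfolding card_arcs_glued[symmetric] by (simp add: of_nat_eq_iff[symmetric, where 'a = real] add.commute del: of_nat_eq_iff)
qed

lemma gluing_count_tree:
  assumes "\<phi> \<in> tree_pairings G inp" "N \<ge> 1"
  shows "real (gluing_count G \<phi> N) = real N powr (e_check G inp + 1)"
  using assms(2) unfolding gluing_count_eq conjunct2[OF assms(1)[unfolded tree_pairings_iff], symmetric]
  by (simp add: powr_realpow)

text \<open>Numbers of vertices are integers, so a connected glued graph that is not a tree misses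
  the maximal number by at least one, and its count loses a full factor N.\<close>

lemma gluing_count_le:
  assumes "Digraph_Component.connected (glued_graph G \<phi>)" "\<phi> \<notin> tree_pairings G inp" "N \<ge> 1"
  shows "real (gluing_count G \<phi> N) \<le> real N powr e_check G inp"
proof -
  interpret H: fin_digraph "glued_graph G \<phi>" by (rule fin_digraph_glued)
  have "real (card (verts (glued_graph G \<phi>))) \<le> real (Suc (card (arcs (glued_graph G \<phi>))))"
    using H.connected_card_verts_le[OF assms(1)] by linarith
  moreover have "real (card (verts (glued_graph G \<phi>))) \<noteq> real (Suc (card (arcs (glued_graph G \<phi>))))"
    using assms(1,2) unfolding tree_pairings_iff card_arcs_glued[symmetric] by (simp add: add.commute)
  ultimately have "card (verts (glued_graph G \<phi>)) \<le> card (arcs (glued_graph G \<phi>))" by simp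
  then have "real (card (verts (glued_graph G \<phi>))) \<le> e_check G inp"
    unfolding card_arcs_glued[symmetric] by simp
  then have "real N powr real (card (verts (glued_graph G \<phi>))) \<le> real N powr e_check G inp"
    using assms(3) by (intro powr_mono) auto
  then show ?thesis using assms(3) unfolding gluing_count_eq by (simp add: powr_realpow)
qed

end

text \<open>Trees give the main term, every other pairing at most the error scale.
  \<open>\<Phi>\<close> will be the set of all admissible pairings for means and that of the
  irreducible ones for cumulants.\<close>

lemma (in fin_digraph) sum_gluing_count_estimate:
  assumes \<Phi>: "\<Phi> \<subseteq> admissible_pairings G inp" "tree_pairings G inp \<subseteq> \<Phi>"
    and conn: "\<And>\<phi>. \<phi> \<in> \<Phi> \<Longrightarrow> Digraph_Component.connected (glued_graph G \<phi>)"
    and N: "N \<ge> 1"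
  shows "\<bar>(\<Sum>\<phi>\<in>\<Phi>. real (gluing_count G \<phi> N)) -
      real (card (tree_pairings G inp)) * real N powr (e_check G inp + 1)\<bar>
    \<le> real (card \<Phi>) * real N powr e_check G inp"
proof -
  let ?T = "tree_pairings G inp"
  have fin: "finite \<Phi>" using \<Phi>(1) finite_admissible_pairings finite_subset by blast
  have gl: "glued G inp \<phi>" if "\<phi> \<in> \<Phi>" for \<phi>
    using \<Phi>(1) that fin_digraph_axioms by (auto simp: glued_def glued_axioms_def)
  have "(\<Sum>\<phi>\<in>\<Phi>. real (gluing_count G \<phi> N)) =
      (\<Sum>\<phi>\<in>\<Phi> - ?T. real (gluing_count G \<phi> N)) + (\<Sum>\<phi>\<in>?T. real (gluing_count G \<phi> N))"
    using fin \<Phi>(2) by (rule sum.subset_diff[rotated])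
  also have "(\<Sum>\<phi>\<in>?T. real (gluing_count G \<phi> N)) = (\<Sum>\<phi>\<in>?T. real N powr (e_check G inp + 1))"
    using gl \<Phi>(2) N by (intro sum.cong refl glued.gluing_count_tree) auto
  also have "\<dots> = real (card ?T) * real N powr (e_check G inp + 1)" by simp
  finally have eq: "(\<Sum>\<phi>\<in>\<Phi>. real (gluing_count G \<phi> N)) - real (card ?T) * real N powr (e_check G inp + 1)
      = (\<Sum>\<phi>\<in>\<Phi> - ?T. real (gluing_count G \<phi> N))" by simp
  have "(\<Sum>\<phi>\<in>\<Phi> - ?T. real (gluing_count G \<phi> N)) \<le> (\<Sum>\<phi>\<in>\<Phi> - ?T. real N powr e_check G inp)"
    using gl conn N by (intro sum_mono glued.gluing_count_le) auto
  also have "\<dots> \<le> real (card \<Phi>) * real N powr e_check G inp"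
    using fin by (simp add: mult_right_mono card_mono)
  finally show ?thesis unfolding eq by (simp add: sum_nonneg)
qed

section \<open>Coloured graphs and their irreducible pairings\<close>

text \<open>A disjoint union of graphs is encoded as a graph whose vertices are coloured by the index of
  the summand they belong to; the union over a set \<open>J\<close> of indices is then the part coloured by \<open>J\<close>.\<close>

definition color_part :: "('v, 'e) pre_digraph \<Rightarrow> ('v \<Rightarrow> nat) \<Rightarrow> nat set \<Rightarrow> ('v, 'e) pre_digraph" where
  "color_part H c J =
     H\<lparr>verts := {v \<in> verts H. c v \<in> J}, arcs := {e \<in> arcs H. c (head H e) \<in> J}\<rparr>"

lemma color_part_simps [simp]:
  "verts (color_part H c J) = {v \<in> verts H. c v \<in> J}"
  "arcs (color_part H c J) = {e \<in> arcs H. c (head H e) \<in> J}"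
  "head (color_part H c J) = head H"
  "tail (color_part H c J) = tail H"
  by (simp_all add: color_part_def)

lemma W_arcs_color_part: "W_arcs (color_part H c J) inp = {e \<in> W_arcs H inp. c (head H e) \<in> J}"
  by (auto simp: W_arcs_def)

lemma block_const_color_part [simp]: "block_const (color_part H c J) \<phi> i = block_const H \<phi> i"
  by (simp add: block_const_def)

text \<open>Colours linked by a block are in S together or not at all. Testing heads suffices,
  because in a \<open>colored_digraph\<close> both ends of an arc have the same colour.\<close>

definition color_closed :: "('v, 'e) pre_digraph \<Rightarrow> ('v \<Rightarrow> nat) \<Rightarrow> 'e set set \<Rightarrow> nat set \<Rightarrow> bool" where
  "color_closed H c \<phi> S \<longleftrightarrow> (\<forall>p\<in>\<phi>. \<forall>e\<in>p. \<forall>e'\<in>p. c (head H e) \<in> S \<longleftrightarrow> c (head H e') \<in> S)"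

text \<open>The pairings whose blocks link all colours of B; sums over them are the combinatorial
  form of joint cumulants.\<close>

definition irreducible_pairings ::
    "('v, 'e) pre_digraph \<Rightarrow> ('v \<Rightarrow> nat) \<Rightarrow> ('e \<Rightarrow> edge_input) \<Rightarrow> nat set \<Rightarrow> 'e set set set" where
  "irreducible_pairings H c inp B =
     {\<phi> \<in> admissible_pairings (color_part H c B) inp.
        \<forall>S\<subseteq>B. S \<noteq> {} \<longrightarrow> color_closed H c \<phi> S \<longrightarrow> S = B}"

definition pairing_sum ::
    "('v, 'e) pre_digraph \<Rightarrow> ('v \<Rightarrow> nat) \<Rightarrow> ('e \<Rightarrow> edge_input) \<Rightarrow> nat \<Rightarrow> nat set \<Rightarrow> real" where
  "pairing_sum H c inp N J =
     (\<Sum>\<phi>\<in>admissible_pairings (color_part H c J) inp. real (gluing_count (color_part H c J) \<phi> N))"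

definition irreducible_sum ::
    "('v, 'e) pre_digraph \<Rightarrow> ('v \<Rightarrow> nat) \<Rightarrow> ('e \<Rightarrow> edge_input) \<Rightarrow> nat \<Rightarrow> nat set \<Rightarrow> real" where
  "irreducible_sum H c inp N B =
     (\<Sum>\<phi>\<in>irreducible_pairings H c inp B. real (gluing_count (color_part H c B) \<phi> N))"

section \<open>Splitting index sums and pairings over disjoint sets of colours\<close>

text \<open>The hypotheses on \<open>restrict\<close> say that F reads only coordinates in A and G
  only those in B, so that both can be evaluated at a full assignment.\<close>

lemma sum_PiE_Un:
  fixes F G :: "('v \<Rightarrow> 'k) \<Rightarrow> 'b::comm_semiring_1"
  assumes AB: "A \<inter> B = {}"
    and F: "\<And>i. F (restrict i A) = F i" and G: "\<And>i. G (restrict i B) = G i"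
  shows "(\<Sum>i\<in>A \<union> B \<rightarrow>\<^sub>E D. F i * G i) = (\<Sum>i\<in>A \<rightarrow>\<^sub>E D. F i) * (\<Sum>i\<in>B \<rightarrow>\<^sub>E D. G i)"
proof -
  have "(\<Sum>i\<in>A \<union> B \<rightarrow>\<^sub>E D. F i * G i) = (\<Sum>(f, g)\<in>(A \<rightarrow>\<^sub>E D) \<times> (B \<rightarrow>\<^sub>E D). F f * G g)"
  proof (rule sum.reindex_bij_witness[where
        j = "\<lambda>i. (restrict i A, restrict i B)" and
        i = "\<lambda>(f, g). \<lambda>v\<in>A \<union> B. if v \<in> A then f v else g v"])
    fix i assume i: "i \<in> A \<union> B \<rightarrow>\<^sub>E D"
    show "(case (restrict i A, restrict i B) of (f, g) \<Rightarrow> \<lambda>v\<in>A \<union> B. if v \<in> A then f v else g v) = i"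
      using i by (auto simp: fun_eq_iff PiE_def extensional_def)
    show "(restrict i A, restrict i B) \<in> (A \<rightarrow>\<^sub>E D) \<times> (B \<rightarrow>\<^sub>E D)" using i by auto
    show "(case (restrict i A, restrict i B) of (f, g) \<Rightarrow> F f * G g) = F i * G i"
      by (simp add: F G)
  next
    fix fg assume "fg \<in> (A \<rightarrow>\<^sub>E D) \<times> (B \<rightarrow>\<^sub>E D)"
    then obtain f g where fg: "fg = (f, g)" "f \<in> A \<rightarrow>\<^sub>E D" "g \<in> B \<rightarrow>\<^sub>E D" by auto
    let ?i = "\<lambda>v\<in>A \<union> B. if v \<in> A then f v else g v"
    have "restrict ?i A v = f v" "restrict ?i B v = g v" for v
      using fg AB by (auto simp: PiE_def extensional_def restrict_def)
    then have "restrict ?i A = f" "restrict ?i B = g" by (auto simp: fun_eq_iff)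
    then show "(restrict (case fg of (f, g) \<Rightarrow> \<lambda>v\<in>A \<union> B. if v \<in> A then f v else g v) A,
        restrict (case fg of (f, g) \<Rightarrow> \<lambda>v\<in>A \<union> B. if v \<in> A then f v else g v) B) = fg"
      by (simp add: fg)
    show "(case fg of (f, g) \<Rightarrow> \<lambda>v\<in>A \<union> B. if v \<in> A then f v else g v) \<in> A \<union> B \<rightarrow>\<^sub>E D"
      using fg by (auto simp: PiE_iff)
  qed
  also have "\<dots> = (\<Sum>i\<in>A \<rightarrow>\<^sub>E D. F i) * (\<Sum>i\<in>B \<rightarrow>\<^sub>E D. G i)"
    by (simp add: sum_product sum.cartesian_product)
  finally show ?thesis .
qed

locale colored_digraph = fin_digraph H for H :: "('v, 'e) pre_digraph" +
  fixes c :: "'v \<Rightarrow> nat" and inp :: "'e \<Rightarrow> edge_input"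
  assumes monochromatic: "e \<in> arcs H \<Longrightarrow> c (tail H e) = c (head H e)"
begin

abbreviation restr where "restr J \<equiv> color_part H c J"
abbreviation adm where "adm J \<equiv> admissible_pairings (restr J) inp"
abbreviation irr where "irr B \<equiv> irreducible_pairings H c inp B"

lemma fin_digraph_restr: "fin_digraph (restr J)"
  by unfold_locales (auto simp: monochromatic)

lemma adm_block:
  assumes "\<phi> \<in> adm J" "p \<in> \<phi>" "e \<in> p"
  shows "e \<in> W_arcs H inp" "e \<in> arcs H" "c (head H e) \<in> J" "head H e \<in> verts (restr J)" "tail H e \<in> verts (restr J)"
proof -
  have "e \<in> W_arcs (restr J) inp"
    using assms by (auto simp: admissible_pairings_def partition_on_def)
  then have *: "e \<in> W_arcs H inp" "e \<in> arcs H" "c (head H e) \<in> J"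
    by (auto simp: W_arcs_color_part W_arcs_def)
  then show "e \<in> W_arcs H inp" "e \<in> arcs H" "c (head H e) \<in> J" "head H e \<in> verts (restr J)" "tail H e \<in> verts (restr J)"
    by (simp_all add: monochromatic)
qed

lemma block_const_restrict:
  assumes "\<phi> \<in> adm J"
  shows "block_const H \<phi> (restrict i (verts (restr J))) = block_const H \<phi> i"
  using adm_block(4,5)[OF assms] unfolding block_const_def by simp

lemma gluing_count_Un:
  assumes AB: "A \<inter> B = {}" and \<phi>: "\<phi> \<in> adm A" "\<psi> \<in> adm B"
  shows "gluing_count (restr (A \<union> B)) (\<phi> \<union> \<psi>) N = gluing_count (restr A) \<phi> N * gluing_count (restr B) \<psi> N"
proof -
  have card: "card {i \<in> X. P i} = (\<Sum>i\<in>X. if P i then 1 else 0)" if "finite X" for X :: "('v \<Rightarrow> nat) set" and P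
    using that by (simp add: sum.If_cases Int_def)
  have fin: "finite (verts (restr J) \<rightarrow>\<^sub>E {1..N})" for J by (intro finite_PiE) auto
  have V: "verts (restr (A \<union> B)) = verts (restr A) \<union> verts (restr B)"
    and dis: "verts (restr A) \<inter> verts (restr B) = {}" using AB by auto
  have bc: "block_const H (\<phi> \<union> \<psi>) i \<longleftrightarrow> block_const H \<phi> i \<and> block_const H \<psi> i" for i :: "'v \<Rightarrow> nat"
    by (simp add: block_const_def ball_Un)
  have "gluing_count (restr (A \<union> B)) (\<phi> \<union> \<psi>) N =
      (\<Sum>i\<in>verts (restr A) \<union> verts (restr B) \<rightarrow>\<^sub>E {1..N}.
        (if block_const H \<phi> i then 1 else 0) * (if block_const H \<psi> i then 1 else 0))"
    unfolding gluing_count_def block_const_color_part card[OF fin] unfolding V bc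
    by (intro sum.cong) auto
  also have "\<dots> = (\<Sum>i\<in>verts (restr A) \<rightarrow>\<^sub>E {1..N}. if block_const H \<phi> i then 1 else 0) *
      (\<Sum>i\<in>verts (restr B) \<rightarrow>\<^sub>E {1..N}. if block_const H \<psi> i then 1 else 0)"
    by (rule sum_PiE_Un[OF dis]) (simp_all only: block_const_restrict[OF \<phi>(1)] block_const_restrict[OF \<phi>(2)])
  finally show ?thesis
    unfolding gluing_count_def block_const_color_part card[OF fin] by simp
qed

definition blocks_in :: "'e set set \<Rightarrow> nat set \<Rightarrow> 'e set set" where
  "blocks_in \<phi> C = {p \<in> \<phi>. \<forall>e\<in>p. c (head H e) \<in> C}"

text \<open>Together with \<open>adm_restrict\<close> this is a bijection between pairs of pairings
  on A and on B and those pairings on the union in which no block crosses; \<open>blocks_in\<close>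
  is the inverse.\<close>

lemma adm_Un:
  assumes AB: "A \<inter> B = {}" and \<phi>: "\<phi> \<in> adm A" "\<psi> \<in> adm B"
  shows "\<phi> \<union> \<psi> \<in> adm (A \<union> B)" "color_closed H c (\<phi> \<union> \<psi>) A"
    "blocks_in (\<phi> \<union> \<psi>) A = \<phi>" "blocks_in (\<phi> \<union> \<psi>) B = \<psi>"
proof -
  have p: "partition_on (W_arcs (restr A) inp) \<phi>" "partition_on (W_arcs (restr B) inp) \<psi>"
    using \<phi> by (auto simp: admissible_pairings_def)
  have U: "W_arcs (restr (A \<union> B)) inp = W_arcs (restr A) inp \<union> W_arcs (restr B) inp"
    by (auto simp: W_arcs_color_part)
  have dis: "W_arcs (restr A) inp \<inter> W_arcs (restr B) inp = {}"
    using AB by (auto simp: W_arcs_color_part)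
  have "partition_on (W_arcs (restr (A \<union> B)) inp) (\<phi> \<union> \<psi>)"
    unfolding U
  proof (rule partition_onI)
    fix q r assume qr: "q \<in> \<phi> \<union> \<psi>" "r \<in> \<phi> \<union> \<psi>" "q \<noteq> r"
    have sA: "q \<subseteq> W_arcs (restr A) inp" if "q \<in> \<phi>" for q using p that by (auto simp: partition_on_def)
    have sB: "q \<subseteq> W_arcs (restr B) inp" if "q \<in> \<psi>" for q using p that by (auto simp: partition_on_def)
    from qr consider "q \<in> \<phi>" "r \<in> \<phi>" | "q \<in> \<psi>" "r \<in> \<psi>" | "q \<in> \<phi>" "r \<in> \<psi>" | "q \<in> \<psi>" "r \<in> \<phi>"
      by blast
    then show "disjnt q r"
    proof cases
      case 1
      then show ?thesis using p(1) qr(3) by (auto simp: partition_on_def pairwise_def)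
    next
      case 2
      then show ?thesis using p(2) qr(3) by (auto simp: partition_on_def pairwise_def)
    next
      case 3
      then show ?thesis using sA[of q] sB[of r] dis unfolding disjnt_def by blast
    next
      case 4
      then show ?thesis using sA[of r] sB[of q] dis unfolding disjnt_def by blast
    qed
  qed (use p in \<open>auto simp: partition_on_def\<close>)
  then show "\<phi> \<union> \<psi> \<in> adm (A \<union> B)"
    using \<phi> by (auto simp: admissible_pairings_def)
  note a = adm_block(3)[OF \<phi>(1)] and b = adm_block(3)[OF \<phi>(2)]
  have b': "c (head H e) \<notin> A" if "p \<in> \<psi>" "e \<in> p" for p e using b[OF that] AB by auto
  have a': "c (head H e) \<notin> B" if "p \<in> \<phi>" "e \<in> p" for p e using a[OF that] AB by auto
  show "color_closed H c (\<phi> \<union> \<psi>) A"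
    unfolding color_closed_def using a b' by auto
  \<comment> \<open>An empty block would vacuously belong to both restrictions.\<close>
  have ne: "p \<noteq> {}" if "p \<in> \<phi> \<union> \<psi>" for p
    using that p by (auto simp: partition_on_def)
  show "blocks_in (\<phi> \<union> \<psi>) A = \<phi>"
  proof (intro equalityI subsetI)
    fix q assume q: "q \<in> blocks_in (\<phi> \<union> \<psi>) A"
    with ne obtain e where "e \<in> q" unfolding blocks_in_def by blast
    with q b' show "q \<in> \<phi>" unfolding blocks_in_def by blast
  qed (use a in \<open>auto simp: blocks_in_def\<close>)
  show "blocks_in (\<phi> \<union> \<psi>) B = \<psi>"
  proof (intro equalityI subsetI)
    fix q assume q: "q \<in> blocks_in (\<phi> \<union> \<psi>) B"
    with ne obtain e where "e \<in> q" unfolding blocks_in_def by blast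
    with q a' show "q \<in> \<psi>" unfolding blocks_in_def by blast
  qed (use b in \<open>auto simp: blocks_in_def\<close>)
qed

lemma adm_restrict:
  assumes \<phi>: "\<phi> \<in> adm (A \<union> B)" and A: "color_closed H c \<phi> A" and AB: "A \<inter> B = {}"
  defines "\<phi>A \<equiv> blocks_in \<phi> A" and "\<phi>B \<equiv> blocks_in \<phi> B"
  shows "\<phi>A \<in> adm A" "\<phi>B \<in> adm B" "\<phi> = \<phi>A \<union> \<phi>B"
proof -
  have cases: "(\<forall>e\<in>p. c (head H e) \<in> A) \<or> (\<forall>e\<in>p. c (head H e) \<in> B)" if "p \<in> \<phi>" for p
    using A adm_block(3)[OF \<phi> that] that unfolding color_closed_def by blast
  then show "\<phi> = \<phi>A \<union> \<phi>B" by (auto simp: \<phi>A_def \<phi>B_def blocks_in_def)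
  have p: "partition_on (W_arcs (restr (A \<union> B)) inp) \<phi>"
    using \<phi> by (auto simp: admissible_pairings_def)
  have res: "blocks_in \<phi> C \<in> adm C"
    if C: "C \<subseteq> A \<union> B" "\<And>p. p \<in> \<phi> \<Longrightarrow> (\<forall>e\<in>p. c (head H e) \<in> C) \<or> (\<forall>e\<in>p. c (head H e) \<notin> C)" for C
  proof -
    have "partition_on (W_arcs (restr C) inp) (blocks_in \<phi> C)"
    proof (rule partition_onI)
      show "\<Union>(blocks_in \<phi> C) = W_arcs (restr C) inp"
      proof (intro equalityI subsetI)
        fix e assume "e \<in> \<Union>(blocks_in \<phi> C)"
        then show "e \<in> W_arcs (restr C) inp"
          using adm_block(1)[OF \<phi>] by (auto simp: W_arcs_color_part blocks_in_def)
      next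
        fix e assume e: "e \<in> W_arcs (restr C) inp"
        then have "e \<in> W_arcs (restr (A \<union> B)) inp" using C(1) by (auto simp: W_arcs_color_part)
        then obtain q where "q \<in> \<phi>" "e \<in> q" using p by (auto simp: partition_on_def)
        with C(2)[of q] e show "e \<in> \<Union>(blocks_in \<phi> C)"
          by (auto simp: W_arcs_color_part blocks_in_def)
      qed
    qed (use p in \<open>auto simp: partition_on_def pairwise_def disjnt_def blocks_in_def\<close>)
    then show ?thesis using \<phi> by (auto simp: admissible_pairings_def blocks_in_def)
  qed
  show "\<phi>A \<in> adm A" unfolding \<phi>A_def by (rule res) (use cases AB in blast)+
  show "\<phi>B \<in> adm B" unfolding \<phi>B_def by (rule res) (use cases AB in blast)+
qed

lemma color_closed_Inter: "(\<And>S. S \<in> \<S> \<Longrightarrow> color_closed H c \<phi> S) \<Longrightarrow> color_closed H c \<phi> (\<Inter>\<S>)"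
  unfolding color_closed_def by blast

lemma color_closed_Diff: "color_closed H c \<phi> S \<Longrightarrow> color_closed H c \<phi> T \<Longrightarrow> color_closed H c \<phi> (S - T)"
  unfolding color_closed_def by blast

text \<open>The connected component of j when colours are joined by the blocks of
  \<open>\<phi>\<close>, taken as the smallest closed set around j.\<close>

definition component :: "nat \<Rightarrow> nat set \<Rightarrow> 'e set set \<Rightarrow> nat set" where
  "component j I \<phi> = \<Inter>{S. S \<subseteq> I \<and> j \<in> S \<and> color_closed H c \<phi> S}"

lemma component_props:
  assumes "\<phi> \<in> adm I" "j \<in> I"
  shows "color_closed H c \<phi> (component j I \<phi>)" "j \<in> component j I \<phi>" "component j I \<phi> \<subseteq> I"
proof -
  have "color_closed H c \<phi> I"
    using adm_block(3)[OF assms(1)] by (auto simp: color_closed_def)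
  then show "component j I \<phi> \<subseteq> I" using assms(2) by (auto simp: component_def)
  show "color_closed H c \<phi> (component j I \<phi>)"
    unfolding component_def by (rule color_closed_Inter) auto
  show "j \<in> component j I \<phi>" by (simp add: component_def)
qed

lemma component_le: "S \<subseteq> I \<Longrightarrow> j \<in> S \<Longrightarrow> color_closed H c \<phi> S \<Longrightarrow> component j I \<phi> \<subseteq> S"
  unfolding component_def by blast

text \<open>If a proper nonempty subset S of A were closed, then S or A - S would be a closed set
  around j smaller than A.\<close>

lemma component_Un_eq_iff:
  assumes AB: "A \<inter> B = {}" and \<phi>: "\<phi> \<in> adm A" "\<psi> \<in> adm B" and j: "j \<in> A"
  shows "component j (A \<union> B) (\<phi> \<union> \<psi>) = A \<longleftrightarrow> \<phi> \<in> irr A"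
proof
  note un = adm_Un[OF AB \<phi>]
  have cA: "component j (A \<union> B) (\<phi> \<union> \<psi>) \<subseteq> A"
    by (rule component_le) (use un j in auto)
  note cp = component_props[OF un(1), of j]
  {
    assume "\<phi> \<in> irr A"
    moreover have "color_closed H c \<phi> (component j (A \<union> B) (\<phi> \<union> \<psi>))"
      using cp(1) j unfolding color_closed_def by blast
    moreover have "component j (A \<union> B) (\<phi> \<union> \<psi>) \<noteq> {}" using cp(2) j by auto
    ultimately show "component j (A \<union> B) (\<phi> \<union> \<psi>) = A"
      using cA unfolding irreducible_pairings_def by blast
  next
    assume eq: "component j (A \<union> B) (\<phi> \<union> \<psi>) = A"
    have "S = A" if S: "S \<subseteq> A" "S \<noteq> {}" "color_closed H c \<phi> S" for S
    proof -
      have "color_closed H c \<psi> S"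
        using adm_block(3)[OF \<phi>(2)] S(1) AB unfolding color_closed_def by blast
      then have cl: "color_closed H c (\<phi> \<union> \<psi>) S"
        using S(3) unfolding color_closed_def by blast
      show ?thesis
      proof (cases "j \<in> S")
        case True
        then have "component j (A \<union> B) (\<phi> \<union> \<psi>) \<subseteq> S" by (intro component_le) (use S cl in auto)
        with eq S(1) show ?thesis by auto
      next
        case False
        then have "component j (A \<union> B) (\<phi> \<union> \<psi>) \<subseteq> A - S"
          by (intro component_le color_closed_Diff) (use un j cl in auto)
        with eq S show ?thesis by auto
      qed
    qed
    then show "\<phi> \<in> irr A" using \<phi>(1) by (auto simp: irreducible_pairings_def)
  }
qed

lemma finite_adm: "finite (adm J)"
  by (rule fin_digraph.finite_admissible_pairings[OF fin_digraph_restr])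

lemma pairing_sum_empty: "pairing_sum H c inp N {} = 1"
proof -
  have "adm {} = {{}}"
    unfolding admissible_pairings_eq by (simp add: W_arcs_color_part pairings_empty)
  then show ?thesis by (simp add: pairing_sum_def gluing_count_def block_const_def)
qed

text \<open>A pairing is determined by its component at the colour \<open>j\<close> and its restrictions to that
  component and to the complement.\<close>

lemma pairing_sum_insert:
  assumes J: "finite J" and j: "j \<notin> J"
  shows "pairing_sum H c inp N (insert j J) =
    (\<Sum>B\<in>Pow J. irreducible_sum H c inp N (insert j B) * pairing_sum H c inp N (J - B))"
proof -
  define I where "I = insert j J"
  have jI: "j \<in> I" by (simp add: I_def)
  let ?g = "\<lambda>J \<phi>. real (gluing_count (restr J) \<phi> N)"
  have "pairing_sum H c inp N I =
      (\<Sum>B\<in>Pow J. \<Sum>\<phi>\<in>{\<phi> \<in> adm I. component j I \<phi> - {j} = B}. ?g I \<phi>)"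
    unfolding pairing_sum_def
  proof (rule sum.group[symmetric])
    show "(\<lambda>\<phi>. component j I \<phi> - {j}) ` adm I \<subseteq> Pow J"
      using component_props(3)[OF _ jI] by (fastforce simp: I_def)
  qed (use J finite_adm in auto)
  also have "\<dots> = (\<Sum>B\<in>Pow J. irreducible_sum H c inp N (insert j B) * pairing_sum H c inp N (J - B))"
  proof (rule sum.cong[OF refl])
    fix B assume B: "B \<in> Pow J"
    define A where "A = insert j B"
    have A: "A \<inter> (J - B) = {}" "A \<union> (J - B) = I" "j \<in> A" using B j by (auto simp: A_def I_def)
    have eqA: "{\<phi> \<in> adm I. component j I \<phi> - {j} = B} = {\<phi> \<in> adm I. component j I \<phi> = A}"
      using component_props(2)[OF _ jI] B j by (fastforce simp: A_def)
    have "(\<Sum>\<phi>\<in>{\<phi> \<in> adm I. component j I \<phi> = A}. ?g I \<phi>) =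
        (\<Sum>(\<phi>, \<psi>)\<in>irr A \<times> adm (J - B). ?g A \<phi> * ?g (J - B) \<psi>)"
    proof (rule sum.reindex_bij_witness[where i = "\<lambda>(\<phi>, \<psi>). \<phi> \<union> \<psi>" and
        j = "\<lambda>\<phi>. (blocks_in \<phi> A, blocks_in \<phi> (J - B))"])
      fix \<phi> assume \<phi>: "\<phi> \<in> {\<phi> \<in> adm I. component j I \<phi> = A}"
      then have "\<phi> \<in> adm (A \<union> (J - B))" "color_closed H c \<phi> A"
        using component_props(1)[OF _ jI, of \<phi>] by (auto simp: A)
      note r = adm_restrict[OF this A(1)]
      show "(case (blocks_in \<phi> A, blocks_in \<phi> (J - B)) of
          (\<phi>, \<psi>) \<Rightarrow> \<phi> \<union> \<psi>) = \<phi>"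
        using r(3) by simp
      show "(blocks_in \<phi> A, blocks_in \<phi> (J - B)) \<in> irr A \<times> adm (J - B)"
        using component_Un_eq_iff[OF A(1) r(1,2) A(3)] r(2) \<phi> unfolding r(3)[symmetric] A(2) by blast
      show "(case (blocks_in \<phi> A, blocks_in \<phi> (J - B)) of
          (\<phi>, \<psi>) \<Rightarrow> ?g A \<phi> * ?g (J - B) \<psi>) = ?g I \<phi>"
        using gluing_count_Un[OF A(1) r(1,2), of N] unfolding r(3)[symmetric] A(2) by simp
    next
      fix \<phi>\<psi> assume "\<phi>\<psi> \<in> irr A \<times> adm (J - B)"
      then obtain \<phi> \<psi> where *: "\<phi>\<psi> = (\<phi>, \<psi>)" "\<phi> \<in> irr A" "\<psi> \<in> adm (J - B)" by auto
      then have \<phi>: "\<phi> \<in> adm A" by (simp add: irreducible_pairings_def)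
      note un = adm_Un[OF A(1) \<phi> *(3)]
      show "(case \<phi>\<psi> of (\<phi>, \<psi>) \<Rightarrow> \<phi> \<union> \<psi>) \<in> {\<phi> \<in> adm I. component j I \<phi> = A}"
        using un(1) component_Un_eq_iff[OF A(1) \<phi> *(3) A(3)] *(2) by (simp add: *(1) A(2))
      show "(blocks_in (case \<phi>\<psi> of (\<phi>, \<psi>) \<Rightarrow> \<phi> \<union> \<psi>) A,
          blocks_in (case \<phi>\<psi> of (\<phi>, \<psi>) \<Rightarrow> \<phi> \<union> \<psi>) (J - B)) = \<phi>\<psi>"
        unfolding *(1) prod.case un(3,4) ..
    qed
    also have "\<dots> = irreducible_sum H c inp N A * pairing_sum H c inp N (J - B)"
      unfolding irreducible_sum_def pairing_sum_def sum_product sum.cartesian_product ..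
    finally show "(\<Sum>\<phi>\<in>{\<phi> \<in> adm I. component j I \<phi> - {j} = B}. ?g I \<phi>) =
        irreducible_sum H c inp N (insert j B) * pairing_sum H c inp N (J - B)"
      unfolding eqA A_def .
  qed
  finally show ?thesis by (simp add: I_def)
qed

section \<open>Irreducible pairings and connectivity of the glued graph\<close>

text \<open>An arc-closed S that meets a colour class contains all of it, as each piece is
  connected. So S consists of whole colours, and as it respects the blocks these colours form a
  \<open>color_closed\<close> set, hence all of B.\<close>

lemma irreducible_connected:
  assumes conn: "\<And>j. j \<in> B \<Longrightarrow> Digraph_Component.connected (restr {j})"
    and B: "B \<noteq> {}" and \<phi>: "\<phi> \<in> irr B"
  shows "Digraph_Component.connected (glued_graph (restr B) \<phi>)"
proof -
  interpret P: fin_digraph "restr B" by (rule fin_digraph_restr)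
  have adm: "\<phi> \<in> adm B" using \<phi> by (simp add: irreducible_pairings_def)
  interpret gl: glued "restr B" inp \<phi> by unfold_locales (rule adm)
  have cut: "verts (restr {j}) \<noteq> {}" "arc_closed (restr {j}) S \<Longrightarrow> S \<noteq> {} \<Longrightarrow> S = verts (restr {j})"
    if "j \<in> B" for j S
  proof -
    interpret F: fin_digraph "restr {j}" by (rule fin_digraph_restr)
    show "verts (restr {j}) \<noteq> {}" "arc_closed (restr {j}) S \<Longrightarrow> S \<noteq> {} \<Longrightarrow> S = verts (restr {j})"
      using conn[OF that] unfolding F.connected_iff_arc_closed by blast+
  qed
  show ?thesis
    unfolding gl.connected_glued_iff block_const_color_part
  proof (intro conjI allI impI)
    show "verts (restr B) \<noteq> {}" using B cut(1) by fastforce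
    fix S assume S: "arc_closed (restr B) S" "block_const H \<phi> (\<lambda>v. v \<in> S)" "S \<noteq> {}"
    have SB: "v \<in> verts H" "c v \<in> B" if "v \<in> S" for v
      using S(1) that by (auto simp: arc_closed_def)
    have all: "w \<in> S" if v: "v \<in> S" and w: "w \<in> verts H" "c w = c v" for v w
    proof -
      have "arc_closed (restr {c v}) (S \<inter> verts (restr {c v}))"
        using S(1) SB(2)[OF v] by (auto simp: arc_closed_def monochromatic)
      moreover have "v \<in> S \<inter> verts (restr {c v})" using v SB by auto
      ultimately have "S \<inter> verts (restr {c v}) = verts (restr {c v})"
        using cut(2)[OF SB(2)[OF v]] by blast
      with w show "w \<in> S" by auto
    qed
    define T where "T = c ` S"
    have "color_closed H c \<phi> T"
      unfolding color_closed_def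
    proof (intro ballI)
      fix p e e' assume p: "p \<in> \<phi>" "e \<in> p" "e' \<in> p"
      have "head H e \<in> S \<longleftrightarrow> head H e' \<in> S" using S(2) p unfolding block_const_def by blast
      moreover have "c (head H f) \<in> T \<longleftrightarrow> head H f \<in> S" if "f \<in> p" for f
        using adm_block(2)[OF adm p(1) that] all unfolding T_def by (metis head_in_verts image_iff)
      ultimately show "c (head H e) \<in> T \<longleftrightarrow> c (head H e') \<in> T" using p by simp
    qed
    moreover have "T \<subseteq> B" "T \<noteq> {}" using S(3) SB by (auto simp: T_def)
    ultimately have "T = B" using \<phi> by (auto simp: irreducible_pairings_def)
    then have "w \<in> S" if "w \<in> verts (restr B)" for w
      using that all by (auto simp: T_def)
    then show "S = verts (restr B)" using S(1) by (auto simp: arc_closed_def)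
  qed
qed

text \<open>A \<open>color_closed\<close> S cuts the glued graph along the vertices coloured by S;
  as no colour class is empty, the cut is proper unless S = B.\<close>

lemma tree_irreducible:
  assumes ne: "\<And>j. j \<in> B \<Longrightarrow> verts (restr {j}) \<noteq> {}"
  shows "tree_pairings (restr B) inp \<subseteq> irr B"
proof
  fix \<phi> assume \<phi>: "\<phi> \<in> tree_pairings (restr B) inp"
  then have adm: "\<phi> \<in> adm B" by (simp add: tree_pairings_def)
  interpret P: fin_digraph "restr B" by (rule fin_digraph_restr)
  interpret gl: glued "restr B" inp \<phi> by unfold_locales (rule adm)
  have conn: "Digraph_Component.connected (glued_graph (restr B) \<phi>)"
    using \<phi> gl.tree_pairings_iff by simp
  have "S = B" if S: "S \<subseteq> B" "S \<noteq> {}" "color_closed H c \<phi> S" for S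
  proof -
    have "arc_closed (restr B) (verts (restr S))"
      using S(1) by (auto simp: arc_closed_def monochromatic)
    moreover have "block_const H \<phi> (\<lambda>v. v \<in> verts (restr S))"
      unfolding block_const_def
    proof (intro ballI)
      fix p e e' assume p: "p \<in> \<phi>" "e \<in> p" "e' \<in> p"
      have "e \<in> arcs H" "e' \<in> arcs H" using adm_block(2)[OF adm p(1)] p by auto
      moreover have "c (head H e) \<in> S \<longleftrightarrow> c (head H e') \<in> S"
        using S(3) p unfolding color_closed_def by blast
      ultimately show "(head H e \<in> verts (restr S)) = (head H e' \<in> verts (restr S)) \<and>
          (tail H e \<in> verts (restr S)) = (tail H e' \<in> verts (restr S))"
        by (simp add: monochromatic)
    qed
    moreover have "verts (restr S) \<noteq> {}" using S ne by fastforce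
    ultimately have eq: "verts (restr S) = verts (restr B)"
      using conn unfolding gl.connected_glued_iff block_const_color_part by blast
    have "j \<in> S" if "j \<in> B" for j
    proof -
      obtain v where "v \<in> verts H" "c v = j" using ne[OF \<open>j \<in> B\<close>] by auto
      with eq \<open>j \<in> B\<close> show ?thesis by auto
    qed
    with S(1) show ?thesis by auto
  qed
  with adm show "\<phi> \<in> irr B" by (simp add: irreducible_pairings_def)
qed

lemma irreducible_sum_estimate:
  assumes conn: "\<And>j. j \<in> B \<Longrightarrow> Digraph_Component.connected (restr {j})"
    and B: "B \<noteq> {}" and N: "N \<ge> 1"
  shows "\<bar>irreducible_sum H c inp N B -
      real (card (tree_pairings (restr B) inp)) * real N powr (e_check (restr B) inp + 1)\<bar>
    \<le> real (card (irr B)) * real N powr e_check (restr B) inp"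
  unfolding irreducible_sum_def
proof (rule fin_digraph.sum_gluing_count_estimate[OF fin_digraph_restr])
  show "irr B \<subseteq> adm B" by (auto simp: irreducible_pairings_def)
  have "verts (restr {j}) \<noteq> {}" if "j \<in> B" for j
  proof -
    interpret F: fin_digraph "restr {j}" by (rule fin_digraph_restr)
    show ?thesis using conn[OF that] unfolding F.connected_iff_arc_closed by blast
  qed
  then show "tree_pairings (restr B) inp \<subseteq> irr B" by (rule tree_irreducible)
  show "Digraph_Component.connected (glued_graph (restr B) \<phi>)" if "\<phi> \<in> irr B" for \<phi>
    by (rule irreducible_connected[OF conn B that])
qed (rule N)

section \<open>Additivity and multiplicativity over the colours\<close>

lemma e_check_sum:
  assumes "finite J"
  shows "e_check (restr J) inp = (\<Sum>j\<in>J. e_check (restr {j}) inp)"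
  using assms
proof (induction rule: finite_induct)
  case empty
  then show ?case by (simp add: e_check_def W_arcs_color_part)
next
  case (insert j J)
  have W: "W_arcs (restr (insert j J)) inp = W_arcs (restr {j}) inp \<union> W_arcs (restr J) inp"
    by (auto simp: W_arcs_color_part)
  have O: "arcs (restr (insert j J)) - (W_arcs (restr {j}) inp \<union> W_arcs (restr J) inp)
      = (arcs (restr {j}) - W_arcs (restr {j}) inp) \<union> (arcs (restr J) - W_arcs (restr J) inp)"
    by (auto simp: W_arcs_color_part)
  have "finite (W_arcs H inp)" by (rule finite_W_arcs)
  then have "card (W_arcs (restr (insert j J)) inp) = card (W_arcs (restr {j}) inp) + card (W_arcs (restr J) inp)"
    unfolding W using insert.hyps by (intro card_Un_disjoint) (auto simp: W_arcs_color_part)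
  moreover have "card (arcs (restr (insert j J)) - W_arcs (restr (insert j J)) inp) =
      card (arcs (restr {j}) - W_arcs (restr {j}) inp) + card (arcs (restr J) - W_arcs (restr J) inp)"
    unfolding W O using insert.hyps by (intro card_Un_disjoint) auto
  ultimately have "e_check (restr (insert j J)) inp = e_check (restr {j}) inp + e_check (restr J) inp"
    unfolding e_check_def by simp
  then show ?case using insert by simp
qed

lemma sigma_graph_prod:
  assumes "finite J"
  shows "sigma_graph \<sigma> (restr J) inp = (\<Prod>j\<in>J. sigma_graph \<sigma> (restr {j}) inp)"
  using assms
proof (induction rule: finite_induct)
  case empty
  then show ?case by (simp add: sigma_graph_def W_arcs_color_part)
next
  case (insert j J)
  have W: "W_arcs (restr (insert j J)) inp = W_arcs (restr {j}) inp \<union> W_arcs (restr J) inp"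
    by (auto simp: W_arcs_color_part)
  have "finite (W_arcs H inp)" by (rule finite_W_arcs)
  then have "sigma_graph \<sigma> (restr (insert j J)) inp = sigma_graph \<sigma> (restr {j}) inp * sigma_graph \<sigma> (restr J) inp"
    unfolding W sigma_graph_def using insert.hyps by (intro prod.union_disjoint) (auto simp: W_arcs_color_part)
  then show ?case using insert by simp
qed

abbreviation ones_value where "ones_value w N G \<equiv> graph_value G (\<lambda>_. N) (\<lambda>_ _. 1) (\<lambda>e. input_matrix w (inp e))"

lemma graph_value_prod:
  assumes "finite J"
  shows "ones_value w N (restr J) = (\<Prod>j\<in>J. ones_value w N (restr {j}))"
  using assms
proof (induction rule: finite_induct)
  case empty
  then show ?case by (simp add: graph_value_def)
next
  case (insert j J)
  note gv = fin_digraph.graph_value_ones[OF fin_digraph_restr]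
  let ?F = "\<lambda>J i. \<Prod>e\<in>W_arcs (restr J) inp. w (ell (inp e)) (i (head H e)) (i (tail H e))"
  have W: "W_arcs (restr (insert j J)) inp = W_arcs (restr {j}) inp \<union> W_arcs (restr J) inp"
    by (auto simp: W_arcs_color_part)
  have V: "verts (restr (insert j J)) = verts (restr {j}) \<union> verts (restr J)"
    and dis: "verts (restr {j}) \<inter> verts (restr J) = {}" using insert.hyps by auto
  have "finite (W_arcs H inp)" by (rule finite_W_arcs)
  then have F: "?F (insert j J) i = ?F {j} i * ?F J i" for i
    unfolding W using insert.hyps by (intro prod.union_disjoint) (auto simp: W_arcs_color_part)
  have res: "?F J (restrict i (verts (restr J))) = ?F J i" for i J
    by (rule prod.cong) (auto simp: W_arcs_color_part W_arcs_def monochromatic)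
  have "ones_value w N (restr (insert j J)) =
      (\<Sum>i\<in>verts (restr {j}) \<union> verts (restr J) \<rightarrow>\<^sub>E {1..N}. ?F {j} i * ?F J i)"
    unfolding gv V color_part_simps(3,4) F ..
  also have "\<dots> = ones_value w N (restr {j}) * ones_value w N (restr J)"
    unfolding gv color_part_simps(3,4) by (rule sum_PiE_Un[OF dis]) (rule res)+
  finally show ?case using insert by simp
qed

end

text \<open>Identifies a graph with its coloured copy inside a union, uniformly for the two unions
  in use, \<open>family_union\<close> and \<open>disjoint_union\<close>.\<close>

definition graph_iso ::
    "('v \<Rightarrow> 'w) \<Rightarrow> ('e \<Rightarrow> 'f) \<Rightarrow> ('v, 'e) pre_digraph \<Rightarrow> ('e \<Rightarrow> edge_input) \<Rightarrow>
     ('w, 'f) pre_digraph \<Rightarrow> ('f \<Rightarrow> edge_input) \<Rightarrow> bool" where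
  "graph_iso f g G inp H inp' \<longleftrightarrow> bij_betw f (verts G) (verts H) \<and> bij_betw g (arcs G) (arcs H) \<and>
     (\<forall>e\<in>arcs G. head H (g e) = f (head G e) \<and> tail H (g e) = f (tail G e) \<and> inp' (g e) = inp e)"

context
  fixes f :: "'v \<Rightarrow> 'w" and g :: "'e \<Rightarrow> 'f" and G H inp inp'
  assumes iso: "graph_iso f g G inp H inp'" and G: "fin_digraph G" and H: "fin_digraph H"
begin

interpretation G: fin_digraph G by (rule G)
interpretation H: fin_digraph H by (rule H)

lemma iso_bij: "bij_betw f (verts G) (verts H)" "bij_betw g (arcs G) (arcs H)"
  using iso by (auto simp: graph_iso_def)

lemma iso_arc:
  "e \<in> arcs G \<Longrightarrow> head H (g e) = f (head G e)" "e \<in> arcs G \<Longrightarrow> tail H (g e) = f (tail G e)"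
  "e \<in> arcs G \<Longrightarrow> inp' (g e) = inp e"
  using iso by (auto simp: graph_iso_def)

lemma iso_arcs: "arcs H = g ` arcs G" "inj_on g (arcs G)"
  using iso_bij(2) by (auto simp: bij_betw_def)

lemma iso_W_arcs: "W_arcs H inp' = g ` W_arcs G inp" "inj_on g (W_arcs G inp)"
proof -
  show "W_arcs H inp' = g ` W_arcs G inp"
    using iso_arc(3) by (auto simp: W_arcs_def iso_arcs(1))
  show "inj_on g (W_arcs G inp)"
    using iso_arcs(2) by (rule inj_on_subset) (auto simp: W_arcs_def)
qed

lemma iso_e_check: "e_check H inp' = e_check G inp"
proof -
  have "arcs H - W_arcs H inp' = g ` (arcs G - W_arcs G inp)"
    unfolding iso_arcs(1) iso_W_arcs(1)
    by (rule inj_on_image_set_diff[OF iso_arcs(2), symmetric]) (auto simp: W_arcs_def)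
  then have "card (arcs H - W_arcs H inp') = card (arcs G - W_arcs G inp)"
    using iso_arcs(2) by (simp add: card_image inj_on_subset)
  then show ?thesis
    using iso_W_arcs by (simp add: e_check_def card_image)
qed

lemma iso_sigma_graph: "sigma_graph \<sigma> H inp' = sigma_graph \<sigma> G inp"
  unfolding sigma_graph_def iso_W_arcs(1) prod.reindex[OF iso_W_arcs(2)]
  by (rule prod.cong) (auto simp: W_arcs_def iso_arc)

lemma iso_graph_value:
  "graph_value H (\<lambda>_. N) (\<lambda>_ _. 1) (\<lambda>e. input_matrix w (inp' e)) =
   graph_value G (\<lambda>_. N) (\<lambda>_ _. 1) (\<lambda>e. input_matrix w (inp e))"
  unfolding G.graph_value_ones H.graph_value_ones
proof (rule sum.reindex_bij_witness[where
      j = "\<lambda>i. \<lambda>v\<in>verts G. i (f v)" and i = "\<lambda>i. \<lambda>u\<in>verts H. i (inv_into (verts G) f u)"])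
  fix i assume i: "i \<in> verts H \<rightarrow>\<^sub>E {1..N}"
  have inv: "inv_into (verts G) f u \<in> verts G \<and> f (inv_into (verts G) f u) = u" if "u \<in> verts H" for u
    using that iso_bij(1) by (auto simp: bij_betw_def inv_into_into f_inv_into_f)
  show "(\<lambda>u\<in>verts H. (\<lambda>v\<in>verts G. i (f v)) (inv_into (verts G) f u)) = i"
    using i inv by (auto simp: fun_eq_iff PiE_def extensional_def)
  show "(\<lambda>v\<in>verts G. i (f v)) \<in> verts G \<rightarrow>\<^sub>E {1..N}"
    using i iso_bij(1) by (auto simp: PiE_iff bij_betw_def)
  show "(\<Prod>e\<in>W_arcs G inp. w (ell (inp e)) ((\<lambda>v\<in>verts G. i (f v)) (head G e)) ((\<lambda>v\<in>verts G. i (f v)) (tail G e))) =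
      (\<Prod>e\<in>W_arcs H inp'. w (ell (inp' e)) (i (head H e)) (i (tail H e)))"
    unfolding iso_W_arcs(1) prod.reindex[OF iso_W_arcs(2)]
    by (rule prod.cong) (auto simp: W_arcs_def iso_arc)
next
  fix i assume i: "i \<in> verts G \<rightarrow>\<^sub>E {1..N}"
  have inv: "inv_into (verts G) f (f v) = v" "f v \<in> verts H" if "v \<in> verts G" for v
    using that iso_bij(1) by (auto simp: bij_betw_def)
  show "(\<lambda>v\<in>verts G. (\<lambda>u\<in>verts H. i (inv_into (verts G) f u)) (f v)) = i"
    using i inv by (auto simp: fun_eq_iff PiE_def extensional_def)
  show "(\<lambda>u\<in>verts H. i (inv_into (verts G) f u)) \<in> verts H \<rightarrow>\<^sub>E {1..N}"
  proof (rule restrict_PiE_iff[THEN iffD2], rule ballI)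
    fix u assume "u \<in> verts H"
    then have "inv_into (verts G) f u \<in> verts G"
      using iso_bij(1) by (auto simp: bij_betw_def inv_into_into)
    with i show "i (inv_into (verts G) f u) \<in> {1..N}" by blast
  qed
qed

lemma iso_connected:
  assumes "Digraph_Component.connected G"
  shows "Digraph_Component.connected H"
  unfolding H.connected_iff_arc_closed
proof (intro conjI allI impI)
  have fV: "f ` verts G = verts H" using iso_bij(1) by (simp add: bij_betw_def)
  show "verts H \<noteq> {}" using assms fV unfolding G.connected_iff_arc_closed by auto
  fix S assume S: "arc_closed H S" "S \<noteq> {}"
  define T where "T = {v \<in> verts G. f v \<in> S}"
  have "arc_closed G T"
    unfolding arc_closed_def
  proof (intro conjI ballI)
    fix e assume e: "e \<in> arcs G"
    then have "g e \<in> arcs H" by (simp add: iso_arcs(1))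
    with S(1) e show "head G e \<in> T \<longleftrightarrow> tail G e \<in> T"
      by (auto simp: arc_closed_def T_def iso_arc)
  qed (simp add: T_def)
  moreover have "S \<subseteq> f ` verts G" using S(1) fV by (simp add: arc_closed_def)
  then have "T \<noteq> {}" using S(2) unfolding T_def by blast
  ultimately have "T = verts G" using assms unfolding G.connected_iff_arc_closed by blast
  then have "verts H \<subseteq> S" unfolding T_def fV[symmetric] by blast
  then show "S = verts H" using S(1) by (auto simp: arc_closed_def)
qed

end

section \<open>Disjoint unions as coloured graphs\<close>

text \<open>Indexed by positions rather than by graphs, so that a graph occurring several times in a
  mixed moment contributes as many disjoint copies.\<close>

definition family_union :: "nat set \<Rightarrow> (nat \<Rightarrow> ('v, 'e) pre_digraph) \<Rightarrow> (nat \<times> 'v, nat \<times> 'e) pre_digraph" where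
  "family_union I A =
     \<lparr> verts = (SIGMA j:I. verts (A j)),
       arcs = (SIGMA j:I. arcs (A j)),
       tail = (\<lambda>(j, e). (j, tail (A j) e)),
       head = (\<lambda>(j, e). (j, head (A j) e)) \<rparr>"

lemma colored_digraph_family_union:
  assumes "finite I" "\<And>j. j \<in> I \<Longrightarrow> fin_digraph (A j)"
  shows "colored_digraph (family_union I A) fst"
proof
  show "finite (verts (family_union I A))" "finite (arcs (family_union I A))"
    using assms fin_digraph.finite_verts fin_digraph.finite_arcs
    by (auto simp: family_union_def intro!: finite_SigmaI)
qed (use assms in \<open>auto simp: family_union_def intro: wf_digraph.tail_in_verts wf_digraph.head_in_verts fin_digraph.axioms(1)\<close>)

lemma graph_iso_family_union:
  assumes "j \<in> I"
  shows "graph_iso (Pair j) (Pair j) (A j) (Inp j) (color_part (family_union I A) fst {j}) (\<lambda>(j, e). Inp j e)"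
  unfolding graph_iso_def using assms
  by (auto simp: family_union_def bij_betw_def inj_on_def)

abbreviation sum_color :: "'v + 'w \<Rightarrow> nat" where
  "sum_color \<equiv> case_sum (\<lambda>_. 0) (\<lambda>_. 1)"

lemma colored_digraph_disjoint_union:
  assumes "fin_digraph G" "fin_digraph H"
  shows "colored_digraph (disjoint_union G H) sum_color"
proof -
  interpret G: fin_digraph G by fact
  interpret H: fin_digraph H by fact
  show ?thesis by unfold_locales (auto simp: disjoint_union_def)
qed

lemma graph_iso_Inl:
  "graph_iso Inl Inl G inp (color_part (disjoint_union G H) sum_color {0}) (case_sum inp inp')"
  unfolding graph_iso_def by (auto simp: disjoint_union_def bij_betw_def inj_on_def)

lemma graph_iso_Inr:
  "graph_iso Inr Inr H inp' (color_part (disjoint_union G H) sum_color {1}) (case_sum inp inp')"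
  unfolding graph_iso_def by (auto simp: disjoint_union_def bij_betw_def inj_on_def)

lemma color_part_disjoint_union:
  assumes "fin_digraph G" "fin_digraph H"
  shows "color_part (disjoint_union G H) sum_color {0, 1} = disjoint_union G H"
  by (auto simp: color_part_def disjoint_union_def)

section \<open>Centred moments from cumulants\<close>

text \<open>\<open>mo\<close> expands a product of centred factors. Sorting the subsets by whether
  they contain j groups \<open>m (insert j S)\<close> with \<open>- \<kappa> {j} * m S\<close>,
  which is exactly the negative of the term B = {} in the recursion. First cumulants thus disappear
  before any limit is taken.\<close>

lemma centred_moment_recursion:
  fixes m \<kappa> :: "'j set \<Rightarrow> real"
  assumes rec: "\<And>S. S \<subseteq> J \<Longrightarrow> m (insert j S) = (\<Sum>B\<in>Pow S. \<kappa> (insert j B) * m (S - B))"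
    and J: "finite J" "j \<notin> J"
  defines "mo \<equiv> \<lambda>J. \<Sum>S\<in>Pow J. m S * (\<Prod>i\<in>J - S. - \<kappa> {i})"
  shows "mo (insert j J) = (\<Sum>B\<in>Pow J - {{}}. \<kappa> (insert j B) * mo (J - B))"
proof -
  let ?P = "\<lambda>S. \<Prod>i\<in>S. - \<kappa> {i}"
  have inj: "inj_on (insert j) (Pow J)" using J(2) by (auto intro!: inj_onI)
  have "mo (insert j J) =
      (\<Sum>S\<in>Pow J. m S * ?P (insert j J - S)) + (\<Sum>S\<in>insert j ` Pow J. m S * ?P (insert j J - S))"
    unfolding mo_def Pow_insert by (rule sum.union_disjoint) (use J in auto)
  also have "(\<Sum>S\<in>insert j ` Pow J. m S * ?P (insert j J - S)) = (\<Sum>S\<in>Pow J. m (insert j S) * ?P (J - S))"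
    unfolding sum.reindex[OF inj] by (rule sum.cong) (use J in \<open>auto intro!: prod.cong\<close>)
  also have "(\<Sum>S\<in>Pow J. m S * ?P (insert j J - S)) = (\<Sum>S\<in>Pow J. - \<kappa> {j} * m S * ?P (J - S))"
  proof (rule sum.cong[OF refl])
    fix S assume S: "S \<in> Pow J"
    then have "insert j J - S = insert j (J - S)" using J by auto
    then show "m S * ?P (insert j J - S) = - \<kappa> {j} * m S * ?P (J - S)" using J by simp
  qed
  also have "(\<Sum>S\<in>Pow J. - \<kappa> {j} * m S * ?P (J - S)) + (\<Sum>S\<in>Pow J. m (insert j S) * ?P (J - S)) =
      (\<Sum>S\<in>Pow J. (m (insert j S) - \<kappa> {j} * m S) * ?P (J - S))"
    by (simp add: sum.distrib[symmetric] algebra_simps)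
  \<comment> \<open>Here the term B = {} cancels. The inner index set is written inside
    \<open>Pow J\<close> so that the two sums can be exchanged.\<close>
  also have "\<dots> = (\<Sum>S\<in>Pow J. \<Sum>B\<in>{B. B \<in> Pow J - {{}} \<and> B \<subseteq> S}. \<kappa> (insert j B) * m (S - B) * ?P (J - S))"
  proof (rule sum.cong[OF refl])
    fix S assume S: "S \<in> Pow J"
    then have "finite (Pow S)" using J finite_subset by auto
    have "m (insert j S) = (\<Sum>B\<in>Pow S. \<kappa> (insert j B) * m (S - B))" using rec S by simp
    also have "\<dots> = \<kappa> {j} * m S + (\<Sum>B\<in>Pow S - {{}}. \<kappa> (insert j B) * m (S - B))"
      using sum.remove[OF \<open>finite (Pow S)\<close>, of "{}" "\<lambda>B. \<kappa> (insert j B) * m (S - B)"] by simp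
    finally have "m (insert j S) = \<kappa> {j} * m S + (\<Sum>B\<in>Pow S - {{}}. \<kappa> (insert j B) * m (S - B))" .
    moreover have "{B. B \<in> Pow J - {{}} \<and> B \<subseteq> S} = Pow S - {{}}" using S by auto
    ultimately show "(m (insert j S) - \<kappa> {j} * m S) * ?P (J - S) =
        (\<Sum>B\<in>{B. B \<in> Pow J - {{}} \<and> B \<subseteq> S}. \<kappa> (insert j B) * m (S - B) * ?P (J - S))"
      by (simp add: sum_distrib_right)
  qed
  also have "\<dots> = (\<Sum>B\<in>Pow J - {{}}. \<Sum>S\<in>{S. S \<in> Pow J \<and> B \<subseteq> S}. \<kappa> (insert j B) * m (S - B) * ?P (J - S))"
    by (rule sum.swap_restrict) (use J in auto)
  also have "\<dots> = (\<Sum>B\<in>Pow J - {{}}. \<kappa> (insert j B) * mo (J - B))"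
  proof (rule sum.cong[OF refl])
    fix B assume B: "B \<in> Pow J - {{}}"
    have "(\<Sum>S\<in>{S. S \<in> Pow J \<and> B \<subseteq> S}. m (S - B) * ?P (J - S)) = mo (J - B)"
      unfolding mo_def
    proof (rule sum.reindex_bij_witness[where i = "\<lambda>T. T \<union> B" and j = "\<lambda>S. S - B"])
      fix S assume "S \<in> {S. S \<in> Pow J \<and> B \<subseteq> S}"
      then have "J - B - (S - B) = J - S" "S - B \<union> B = S" "S - B \<in> Pow (J - B)" by auto
      then show "m (S - B) * ?P (J - B - (S - B)) = m (S - B) * ?P (J - S)"
        "S - B \<union> B = S" "S - B \<in> Pow (J - B)" by simp_all
    qed (use B in auto)
    then show "(\<Sum>S\<in>{S. S \<in> Pow J \<and> B \<subseteq> S}. \<kappa> (insert j B) * m (S - B) * ?P (J - S)) =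
        \<kappa> (insert j B) * mo (J - B)"
      by (simp add: sum_distrib_left[symmetric] mult.assoc)
  qed
  finally show ?thesis .
qed

section \<open>Cumulants of normalised graph values\<close>

context colored_digraph
begin

definition degree :: "nat set \<Rightarrow> real" where
  "degree J = (\<Sum>j\<in>J. e_check (restr {j}) inp + 1 / 2)"

text \<open>The factor \<open>sigma_graph\<close> of the expectation cancels in the normalised
  values, so no standard deviation appears; this is why they may vary with N.\<close>

definition graph_moment :: "nat \<Rightarrow> nat set \<Rightarrow> real" where
  "graph_moment N J = pairing_sum H c inp N J / real N powr degree J"

definition graph_cumulant :: "nat \<Rightarrow> nat set \<Rightarrow> real" where
  "graph_cumulant N B = irreducible_sum H c inp N B / real N powr degree B"

lemma graph_moment_empty: "N \<ge> 1 \<Longrightarrow> graph_moment N {} = 1"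
  by (simp add: graph_moment_def degree_def pairing_sum_empty)

lemma graph_moment_insert:
  assumes "finite J" "j \<notin> J" "N \<ge> 1"
  shows "graph_moment N (insert j J) = (\<Sum>B\<in>Pow J. graph_cumulant N (insert j B) * graph_moment N (J - B))"
proof -
  have "graph_moment N (insert j J) = (\<Sum>B\<in>Pow J. irreducible_sum H c inp N (insert j B) *
      pairing_sum H c inp N (J - B) / real N powr degree (insert j J))"
    unfolding graph_moment_def pairing_sum_insert[OF assms(1,2)] by (simp add: sum_divide_distrib)
  also have "\<dots> = (\<Sum>B\<in>Pow J. graph_cumulant N (insert j B) * graph_moment N (J - B))"
  proof (rule sum.cong[OF refl])
    fix B assume B: "B \<in> Pow J"
    then have "insert j J = insert j B \<union> (J - B)" "insert j B \<inter> (J - B) = {}" "finite B"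
      using assms finite_subset by auto
    then have "degree (insert j J) = degree (insert j B) + degree (J - B)"
      using assms unfolding degree_def by (metis finite_Diff finite_insert sum.union_disjoint)
    then show "irreducible_sum H c inp N (insert j B) * pairing_sum H c inp N (J - B) / real N powr degree (insert j J) =
        graph_cumulant N (insert j B) * graph_moment N (J - B)"
      by (simp add: graph_cumulant_def graph_moment_def powr_add)
  qed
  finally show ?thesis .
qed

lemma graph_cumulant_single: "N \<ge> 1 \<Longrightarrow> graph_cumulant N {j} = graph_moment N {j}"
  using graph_moment_insert[of "{}" j N] by (simp add: graph_moment_empty)

lemma graph_cumulant_pair:
  assumes "j \<noteq> k" "N \<ge> 1"
  shows "graph_cumulant N {j, k} = graph_moment N {j, k} - graph_moment N {j} * graph_moment N {k}"
proof -
  have "Pow {k} = {{}, {k}}" by auto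
  then show ?thesis
    using graph_moment_insert[of "{k}" j N] assms
    by (simp add: graph_moment_empty graph_cumulant_single)
qed

lemma graph_cumulant_tendsto:
  assumes conn: "\<And>j. j \<in> B \<Longrightarrow> Digraph_Component.connected (restr {j})"
    and B: "finite B" "card B \<ge> 2"
  shows "(\<lambda>N. graph_cumulant N B) \<longlonglongrightarrow>
    (if card B = 2 then real (card (tree_pairings (restr B) inp)) else 0)"
proof -
  define t where "t = real (card (tree_pairings (restr B) inp))"
  define C where "C = real (card (irr B))"
  define b where "b = real (card B) / 2"
  have "B \<noteq> {}" using B by auto
  have deg: "degree B = e_check (restr B) inp + b"
    unfolding degree_def e_check_sum[OF B(1)] sum.distrib b_def by simp
  have est: "\<bar>graph_cumulant N B - t * real N powr (1 - b)\<bar> \<le> C * real N powr (- b)" if N: "N \<ge> 1" for N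
  proof -
    let ?e = "e_check (restr B) inp"
    have pos: "real N powr degree B > 0" using N by simp
    have 1: "real N powr (1 - b) = real N powr (?e + 1) / real N powr degree B"
      and 2: "real N powr (- b) = real N powr ?e / real N powr degree B"
      unfolding deg powr_diff[symmetric] by simp_all
    have "\<bar>graph_cumulant N B - t * real N powr (1 - b)\<bar> =
        \<bar>irreducible_sum H c inp N B - t * real N powr (?e + 1)\<bar> / real N powr degree B"
      unfolding graph_cumulant_def 1 using pos by (simp add: diff_divide_distrib[symmetric])
    also have "\<dots> \<le> C * real N powr ?e / real N powr degree B"
      using irreducible_sum_estimate[OF conn \<open>B \<noteq> {}\<close> N] pos
      by (intro divide_right_mono) (auto simp: t_def C_def)
    finally show ?thesis unfolding 2 by simp
  qed
  have b1: "b \<ge> 1" using B by (simp add: b_def)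
  have top: "filterlim (\<lambda>N. real N) at_top sequentially" by (rule filterlim_real_sequentially)
  have lim1: "(\<lambda>N. t * real N powr (1 - b)) \<longlonglongrightarrow> (if card B = 2 then t else 0)"
  proof (cases "card B = 2")
    case True
    then have "b = 1" by (simp add: b_def)
    \<comment> \<open>Only eventually, because \<open>0 powr 0\<close> is 0.\<close>
    have "\<forall>\<^sub>F N in sequentially. t = t * real N powr (1 - b)"
      using eventually_ge_at_top[of 1] by eventually_elim (simp add: \<open>b = 1\<close>)
    then show ?thesis using True by (simp add: tendsto_eventually eventually_mono)
  next
    case False
    with B have "1 - b < 0" by (simp add: b_def)
    then have "(\<lambda>N. real N powr (1 - b)) \<longlonglongrightarrow> 0" by (rule tendsto_neg_powr[OF _ top])
    from tendsto_mult_left[OF this, of t] show ?thesis using False by simp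
  qed
  have "(\<lambda>N. real N powr (- b)) \<longlonglongrightarrow> 0" by (rule tendsto_neg_powr[OF _ top]) (use b1 in simp)
  from tendsto_mult_left[OF this, of C] have lim2: "(\<lambda>N. C * real N powr (- b)) \<longlonglongrightarrow> 0" by simp
  have "\<forall>\<^sub>F N in sequentially. norm (graph_cumulant N B - t * real N powr (1 - b)) \<le> C * real N powr (- b)"
    using eventually_ge_at_top[of 1] by eventually_elim (use est in simp)
  then have "(\<lambda>N. graph_cumulant N B - t * real N powr (1 - b)) \<longlonglongrightarrow> 0"
    by (rule Lim_null_comparison) (rule lim2)
  from tendsto_add[OF this lim1]
  have "(\<lambda>N. graph_cumulant N B) \<longlonglongrightarrow> (if card B = 2 then t else 0)" by simp
  then show ?thesis unfolding t_def .
qed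

end

section \<open>Expectations of normalised values for fixed N\<close>

definition normalized_value ::
    "nat \<Rightarrow> (nat \<Rightarrow> real) \<Rightarrow> ('v, 'e) pre_digraph \<Rightarrow> ('e \<Rightarrow> edge_input) \<Rightarrow> (nat \<Rightarrow> nat \<Rightarrow> nat \<Rightarrow> real) \<Rightarrow> real" where
  "normalized_value N \<sigma> G inp w =
     inverse (sigma_graph \<sigma> G inp * real N powr (e_check G inp + 1 / 2)) *
     graph_value G (\<lambda>_. N) (\<lambda>_ _. 1) (\<lambda>e. input_matrix w (inp e))"

lemma sigma_graph_pos: "(\<And>l. \<sigma> l > 0) \<Longrightarrow> sigma_graph \<sigma> G inp > 0"
  by (simp add: sigma_graph_def prod_pos)

locale gaussian_matrices = prob_space M for M :: "'a measure" +
  fixes N :: nat and \<sigma> :: "nat \<Rightarrow> real" and W :: "nat \<Rightarrow> 'a \<Rightarrow> nat \<Rightarrow> nat \<Rightarrow> real"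
  assumes N: "N \<ge> 1" and \<sigma>: "\<And>l. \<sigma> l > 0" and W: "independent_gaussian_matrices M N \<sigma> W"
begin

text \<open>H may be any coloured graph whose colour classes are copies of the \<open>A j\<close>,
  so that the lemma applies both to \<open>family_union\<close> and to
  \<open>disjoint_union\<close>.\<close>

lemma colored_moment:
  fixes H :: "('w, 'f) pre_digraph" and A :: "nat \<Rightarrow> ('v, 'e) pre_digraph"
  assumes col: "colored_digraph H c" and J: "finite J"
    and A: "\<And>j. j \<in> J \<Longrightarrow> fin_digraph (A j)"
    and iso: "\<And>j. j \<in> J \<Longrightarrow> graph_iso (f j) (g j) (A j) (Inp j) (color_part H c {j}) inp"
  shows "integrable M (\<lambda>\<omega>. \<Prod>j\<in>J. normalized_value N \<sigma> (A j) (Inp j) (\<lambda>l. W l \<omega>))"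
    and "expectation (\<lambda>\<omega>. \<Prod>j\<in>J. normalized_value N \<sigma> (A j) (Inp j) (\<lambda>l. W l \<omega>)) =
      colored_digraph.graph_moment H c inp N J"
proof -
  interpret colored_digraph H c inp by (rule col)
  have fin: "fin_digraph (restr J)" for J by (rule fin_digraph_restr)
  define s where "s = sigma_graph \<sigma> (restr J) inp * real N powr degree J"
  have e: "e_check (A j) (Inp j) = e_check (restr {j}) inp"
    and sg: "sigma_graph \<sigma> (A j) (Inp j) = sigma_graph \<sigma> (restr {j}) inp"
    and gv: "graph_value (A j) (\<lambda>_. N) (\<lambda>_ _. 1) (\<lambda>e. input_matrix w (Inp j e)) = ones_value w N (restr {j})"
    if "j \<in> J" for j w
    using iso_e_check[OF iso[OF that] A[OF that] fin] iso_sigma_graph[OF iso[OF that] A[OF that] fin]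
      iso_graph_value[OF iso[OF that] A[OF that] fin] by simp_all
  define q where "q j = sigma_graph \<sigma> (A j) (Inp j) * real N powr (e_check (A j) (Inp j) + 1 / 2)" for j
  have s: "(\<Prod>j\<in>J. q j) = s"
    unfolding q_def s_def degree_def sigma_graph_prod[OF J] prod.distrib
    using N J by (simp add: e sg powr_sum)
  have eq: "(\<Prod>j\<in>J. normalized_value N \<sigma> (A j) (Inp j) w) = inverse s * ones_value w N (restr J)" for w
  proof -
    have "(\<Prod>j\<in>J. normalized_value N \<sigma> (A j) (Inp j) w) = (\<Prod>j\<in>J. inverse (q j) * ones_value w N (restr {j}))"
      by (rule prod.cong) (auto simp: normalized_value_def q_def gv)
    also have "\<dots> = inverse s * ones_value w N (restr J)"
      unfolding s[symmetric] graph_value_prod[OF J] prod.distrib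
      using prod_inversef[of q J] by (simp add: comp_def)
    finally show ?thesis .
  qed
  show "integrable M (\<lambda>\<omega>. \<Prod>j\<in>J. normalized_value N \<sigma> (A j) (Inp j) (\<lambda>l. W l \<omega>))"
    unfolding eq by (intro integrable_mult_right expectation_graph_value(1)[OF W \<sigma> fin])
  have "expectation (\<lambda>\<omega>. \<Prod>j\<in>J. normalized_value N \<sigma> (A j) (Inp j) (\<lambda>l. W l \<omega>)) =
      inverse s * (sigma_graph \<sigma> (restr J) inp * pairing_sum H c inp N J)"
    unfolding eq integral_mult_right_zero expectation_graph_value(2)[OF W \<sigma> fin] pairing_sum_def ..
  also have "\<dots> = graph_moment N J"
    using sigma_graph_pos[where \<sigma> = \<sigma> and G = "restr J" and inp = inp, OF \<sigma>] N by (simp add: s_def graph_moment_def field_simps)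
  finally show "expectation (\<lambda>\<omega>. \<Prod>j\<in>J. normalized_value N \<sigma> (A j) (Inp j) (\<lambda>l. W l \<omega>)) = graph_moment N J" .
qed

lemma family_moment:
  fixes A :: "nat \<Rightarrow> ('v, 'e) pre_digraph"
  assumes "finite I" "\<And>j. j \<in> I \<Longrightarrow> fin_digraph (A j)" "J \<subseteq> I"
  shows "integrable M (\<lambda>\<omega>. \<Prod>j\<in>J. normalized_value N \<sigma> (A j) (Inp j) (\<lambda>l. W l \<omega>))"
    and "expectation (\<lambda>\<omega>. \<Prod>j\<in>J. normalized_value N \<sigma> (A j) (Inp j) (\<lambda>l. W l \<omega>)) =
      colored_digraph.graph_moment (family_union I A) fst (\<lambda>(j, e). Inp j e) N J"
  using assms finite_subset[OF assms(3,1)]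
  by (auto intro!: colored_moment[where f = Pair and g = Pair] colored_digraph_family_union graph_iso_family_union)

text \<open>Writes the cumulant as a covariance, where the encoding of the union no longer appears.
  With equal graphs and inputs it gives the variance, since both copies read the same
  matrices.\<close>

lemma disjoint_union_cumulant:
  fixes G1 G2 :: "('v, 'e) pre_digraph" and inp1 inp2 :: "'e \<Rightarrow> edge_input"
  assumes G: "fin_digraph G1" "fin_digraph G2"
  defines "X1 \<equiv> \<lambda>\<omega>. normalized_value N \<sigma> G1 inp1 (\<lambda>l. W l \<omega>)"
    and "X2 \<equiv> \<lambda>\<omega>. normalized_value N \<sigma> G2 inp2 (\<lambda>l. W l \<omega>)"
  shows "expectation (\<lambda>\<omega>. X1 \<omega> * X2 \<omega>) - expectation X1 * expectation X2 =
    colored_digraph.graph_cumulant (disjoint_union G1 G2) sum_color (case_sum inp1 inp2) N {0, 1}"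
proof -
  interpret colored_digraph "disjoint_union G1 G2" sum_color "case_sum inp1 inp2"
    by (rule colored_digraph_disjoint_union[OF G])
  define A where "A j = (if j = (0::nat) then G1 else G2)" for j
  define Inp where "Inp j = (if j = (0::nat) then inp1 else inp2)" for j
  have m: "expectation (\<lambda>\<omega>. \<Prod>j\<in>J. normalized_value N \<sigma> (A j) (Inp j) (\<lambda>l. W l \<omega>)) = graph_moment N J"
    if J: "J \<subseteq> {0, 1}" for J
  proof (rule colored_moment(2)[where f = "\<lambda>j. if j = 0 then Inl else Inr" and g = "\<lambda>j. if j = 0 then Inl else Inr"])
    show "colored_digraph (disjoint_union G1 G2) sum_color" by (rule colored_digraph_disjoint_union[OF G])
    show "finite J" using J finite_subset by blast
    show "fin_digraph (A j)" if "j \<in> J" for j using G by (simp add: A_def)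
    show "graph_iso (if j = 0 then Inl else Inr) (if j = 0 then Inl else Inr) (A j) (Inp j)
        (restr {j}) (case_sum inp1 inp2)" if "j \<in> J" for j
    proof (cases "j = 0")
      case True
      then show ?thesis using graph_iso_Inl[of G1 inp1 G2 inp2] by (simp add: A_def Inp_def)
    next
      case False
      with J that have "j = 1" by auto
      then show ?thesis using graph_iso_Inr[of G2 inp2 G1 inp1] by (simp add: A_def Inp_def)
    qed
  qed
  show ?thesis
    unfolding graph_cumulant_pair[OF zero_neq_one N]
    using m[of "{0, 1}"] m[of "{0}"] m[of "{1}"]
    by (simp add: A_def Inp_def X1_def X2_def)
qed

text \<open>Gluing a connected graph keeps it connected, so the estimate applies to all admissible
  pairings; the normalisation takes half a power of N more than \<open>e_check\<close>, which leaves
  sqrt N for trees and its inverse for the error.\<close>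

lemma normalized_value_mean_estimate:
  fixes G :: "('v, 'e) pre_digraph" and inp :: "'e \<Rightarrow> edge_input"
  assumes G: "fin_digraph G" and conn: "Digraph_Component.connected G"
  shows "\<bar>expectation (\<lambda>\<omega>. normalized_value N \<sigma> G inp (\<lambda>l. W l \<omega>)) -
      real (card (atomic_pairings G inp)) * sqrt (real N)\<bar>
    \<le> real (card (admissible_pairings G inp)) * real N powr (- 1 / 2)"
proof -
  interpret G: fin_digraph G by fact
  let ?e = "e_check G inp" and ?t = "real (card (atomic_pairings G inp))"
    and ?C = "real (card (admissible_pairings G inp))"
  define S where "S = (\<Sum>\<phi>\<in>admissible_pairings G inp. real (gluing_count G \<phi> N))"
  have pos: "real N powr (?e + 1 / 2) > 0" using N by simp
  have est: "\<bar>S - ?t * real N powr (?e + 1)\<bar> \<le> ?C * real N powr ?e"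
    unfolding S_def atomic_pairings_def
  proof (rule G.sum_gluing_count_estimate)
    show "tree_pairings G inp \<subseteq> admissible_pairings G inp" by (auto simp: tree_pairings_def)
    fix \<phi> assume "\<phi> \<in> admissible_pairings G inp"
    then interpret glued G inp \<phi> by unfold_locales
    show "Digraph_Component.connected (glued_graph G \<phi>)"
      using conn unfolding connected_glued_iff G.connected_iff_arc_closed by blast
  qed (use N in auto)
  have "expectation (\<lambda>\<omega>. normalized_value N \<sigma> G inp (\<lambda>l. W l \<omega>)) = S / real N powr (?e + 1 / 2)"
    unfolding normalized_value_def integral_mult_right_zero expectation_graph_value(2)[OF W \<sigma> G] S_def[symmetric]
    using sigma_graph_pos[where \<sigma> = \<sigma> and G = G and inp = inp, OF \<sigma>] by (simp add: field_simps)
  moreover have "sqrt (real N) = real N powr (?e + 1) / real N powr (?e + 1 / 2)"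
    unfolding powr_diff[symmetric] using N by (simp add: powr_half_sqrt)
  moreover have "real N powr (- 1 / 2) = real N powr ?e / real N powr (?e + 1 / 2)"
    unfolding powr_diff[symmetric] by simp
  ultimately show ?thesis
    using divide_right_mono[OF est less_imp_le[OF pos]] pos
    by (simp add: diff_divide_distrib[symmetric] abs_divide)
qed

end

section \<open>Wick sums\<close>

lemma sum_PiE_insert:
  assumes "j \<notin> J"
  shows "(\<Sum>a\<in>insert j J \<rightarrow>\<^sub>E (UNIV :: 'm set). F a) = (\<Sum>x\<in>UNIV. \<Sum>a\<in>J \<rightarrow>\<^sub>E UNIV. F (a(j := x)))"
proof -
  have "(\<Sum>a\<in>insert j J \<rightarrow>\<^sub>E (UNIV :: 'm set). F a) = (\<Sum>(x, a)\<in>UNIV \<times> (J \<rightarrow>\<^sub>E UNIV). F (a(j := x)))"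
    by (subst PiE_insert_eq, subst sum.reindex[OF inj_combinator[OF assms]])
      (simp add: case_prod_beta comp_def)
  then show ?thesis by (simp add: sum.cartesian_product)
qed

text \<open>\<open>L\<close> is a functional obeying the recursion of Isserlis' formula. Summed over
  all assignments with weights t, each chosen pair contributes the factor q, so the recursion
  collapses to that of the moments of a normal law with variance q, and pairings need not be
  enumerated.\<close>

lemma wick_sum:
  fixes L :: "('j \<Rightarrow> 'm::finite) \<Rightarrow> 'j set \<Rightarrow> real" and C :: "'m \<Rightarrow> 'm \<Rightarrow> real"
  assumes cong: "\<And>a b J. (\<And>j. j \<in> J \<Longrightarrow> a j = b j) \<Longrightarrow> L a J = L b J"
    and empty: "\<And>a. L a {} = 1"
    and rec: "\<And>a j J. finite J \<Longrightarrow> j \<notin> J \<Longrightarrow> L a (insert j J) = (\<Sum>k\<in>J. C (a j) (a k) * L a (J - {k}))"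
    and q: "q = (\<Sum>x\<in>UNIV. \<Sum>y\<in>UNIV. t x * t y * C x y)" "q \<ge> 0"
    and J: "finite J"
  shows "(\<Sum>a\<in>J \<rightarrow>\<^sub>E UNIV. (\<Prod>j\<in>J. t (a j)) * L a J) = sqrt q ^ card J * gauss_moment (card J)"
  using J
proof (induction "card J" arbitrary: J rule: less_induct)
  case less
  let ?S = "\<lambda>J. \<Sum>a\<in>J \<rightarrow>\<^sub>E UNIV. (\<Prod>j\<in>J. t (a j)) * L a J"
  show ?case
  proof (cases "J = {}")
    case True
    then show ?thesis by (simp add: empty)
  next
    case False
    then obtain j where j: "j \<in> J" by auto
    define K where "K = J - {j}"
    have K: "J = insert j K" "j \<notin> K" "finite K" using j less.prems by (auto simp: K_def)
    have "?S J = (\<Sum>x\<in>UNIV. \<Sum>a\<in>K \<rightarrow>\<^sub>E UNIV. (\<Prod>i\<in>J. t ((a(j := x)) i)) * L (a(j := x)) J)"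
      unfolding K(1) by (rule sum_PiE_insert[OF K(2)])
    also have "\<dots> = (\<Sum>x\<in>UNIV. \<Sum>a\<in>K \<rightarrow>\<^sub>E UNIV. \<Sum>k\<in>K. t x * C x (a k) * ((\<Prod>i\<in>K. t (a i)) * L a (K - {k})))"
    proof (intro sum.cong refl)
      fix x and a :: "'j \<Rightarrow> 'm"
      have "(\<Prod>i\<in>J. t ((a(j := x)) i)) = t x * (\<Prod>i\<in>K. t ((a(j := x)) i))"
        unfolding K(1) using K by simp
      also have "(\<Prod>i\<in>K. t ((a(j := x)) i)) = (\<Prod>i\<in>K. t (a i))"
        using K by (intro prod.cong) auto
      finally have 1: "(\<Prod>i\<in>J. t ((a(j := x)) i)) = t x * (\<Prod>i\<in>K. t (a i))" .
      have "L (a(j := x)) J = (\<Sum>k\<in>K. C ((a(j := x)) j) ((a(j := x)) k) * L (a(j := x)) (K - {k}))"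
        unfolding K(1) by (rule rec) (use K in auto)
      also have "\<dots> = (\<Sum>k\<in>K. C x (a k) * L a (K - {k}))"
      proof (rule sum.cong[OF refl])
        fix k assume "k \<in> K"
        have "L (a(j := x)) (K - {k}) = L a (K - {k})" by (rule cong) (use K in auto)
        then show "C ((a(j := x)) j) ((a(j := x)) k) * L (a(j := x)) (K - {k}) = C x (a k) * L a (K - {k})"
          using K \<open>k \<in> K\<close> by auto
      qed
      finally show "(\<Prod>i\<in>J. t ((a(j := x)) i)) * L (a(j := x)) J =
          (\<Sum>k\<in>K. t x * C x (a k) * ((\<Prod>i\<in>K. t (a i)) * L a (K - {k})))"
        unfolding 1 by (simp add: sum_distrib_left mult_ac)
    qed
    also have "\<dots> = (\<Sum>k\<in>K. \<Sum>x\<in>UNIV. \<Sum>a\<in>K \<rightarrow>\<^sub>E UNIV. t x * C x (a k) * ((\<Prod>i\<in>K. t (a i)) * L a (K - {k})))"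
      by (subst sum.swap[of _ K], intro sum.cong refl sum.swap)
    \<comment> \<open>Once the partner k of j is fixed, the sums over the values at j and k separate
      from the rest and give q.\<close>
    also have "\<dots> = (\<Sum>k\<in>K. q * ?S (K - {k}))"
    proof (rule sum.cong[OF refl])
      fix k assume k: "k \<in> K"
      let ?K = "K - {k}"
      have Kk: "K = insert k ?K" "k \<notin> ?K" "finite ?K" using k K by auto
      have "(\<Sum>a\<in>K \<rightarrow>\<^sub>E UNIV. t x * C x (a k) * ((\<Prod>i\<in>K. t (a i)) * L a ?K)) =
          (\<Sum>y\<in>UNIV. t x * t y * C x y * ?S ?K)" for x
      proof -
        have "(\<Sum>a\<in>K \<rightarrow>\<^sub>E UNIV. t x * C x (a k) * ((\<Prod>i\<in>K. t (a i)) * L a ?K)) =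
            (\<Sum>a\<in>insert k ?K \<rightarrow>\<^sub>E UNIV. t x * C x (a k) * ((\<Prod>i\<in>K. t (a i)) * L a ?K))"
          using Kk(1) by simp
        also have "\<dots> = (\<Sum>y\<in>UNIV. \<Sum>a\<in>?K \<rightarrow>\<^sub>E UNIV.
            t x * C x ((a(k := y)) k) * ((\<Prod>i\<in>K. t ((a(k := y)) i)) * L (a(k := y)) ?K))"
          by (rule sum_PiE_insert[OF Kk(2)])
        also have "\<dots> = (\<Sum>y\<in>UNIV. t x * t y * C x y * ?S ?K)"
          unfolding sum_distrib_left
        proof (intro sum.cong refl)
          fix y and a :: "'j \<Rightarrow> 'm"
          have "(\<Prod>i\<in>K. t ((a(k := y)) i)) = t y * (\<Prod>i\<in>?K. t ((a(k := y)) i))"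
            using prod.remove[OF K(3) k, of "\<lambda>i. t ((a(k := y)) i)"] by simp
          also have "(\<Prod>i\<in>?K. t ((a(k := y)) i)) = (\<Prod>i\<in>?K. t (a i))"
            by (intro prod.cong) auto
          finally have 1: "(\<Prod>i\<in>K. t ((a(k := y)) i)) = t y * (\<Prod>i\<in>?K. t (a i))" .
          have 2: "L (a(k := y)) ?K = L a ?K" by (rule cong) auto
          show "t x * C x ((a(k := y)) k) * ((\<Prod>i\<in>K. t ((a(k := y)) i)) * L (a(k := y)) ?K) =
              t x * t y * C x y * ((\<Prod>i\<in>?K. t (a i)) * L a ?K)"
            unfolding 1 2 by (simp add: mult_ac)
        qed
        finally show ?thesis .
      qed
      then show "(\<Sum>x\<in>UNIV. \<Sum>a\<in>K \<rightarrow>\<^sub>E UNIV. t x * C x (a k) * ((\<Prod>i\<in>K. t (a i)) * L a ?K)) = q * ?S ?K"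
        by (simp add: q(1) sum_distrib_right)
    qed
    also have "\<dots> = (\<Sum>k\<in>K. q * (sqrt q ^ (card K - 1) * gauss_moment (card K - 1)))"
    proof (intro sum.cong refl arg_cong2[where f = "(*)"])
      fix k assume k: "k \<in> K"
      have "card (K - {k}) < card J" by (rule psubset_card_mono) (use K in auto)
      from less.hyps[OF this] k K show "?S (K - {k}) = sqrt q ^ (card K - 1) * gauss_moment (card K - 1)"
        by simp
    qed
    \<comment> \<open>A single index has no partner: the sum is then empty, in accordance with
      \<open>gauss_moment 1 = 0\<close>.\<close>
    also have "\<dots> = sqrt q ^ card J * gauss_moment (card J)"
    proof (cases "card K")
      case 0
      then show ?thesis using K by simp
    next
      case (Suc n)
      then have "card J = Suc (Suc n)" using K by simp
      moreover have "q = sqrt q * sqrt q" using q(2) by simp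
      ultimately show ?thesis
        using Suc by (simp add: gauss_moment_Suc_Suc del: real_sqrt_mult_self)
    qed
    finally show ?thesis .
  qed
qed

section \<open>Convergence of the centred moments\<close>

locale product_graphs =
  fixes M :: "nat \<Rightarrow> 'a measure" and \<sigma> :: "nat \<Rightarrow> nat \<Rightarrow> real"
    and W :: "nat \<Rightarrow> nat \<Rightarrow> 'a \<Rightarrow> nat \<Rightarrow> nat \<Rightarrow> real"
    and G :: "'m::finite \<Rightarrow> ('v, 'e) pre_digraph" and inp :: "'m \<Rightarrow> 'e \<Rightarrow> edge_input"
  assumes gm: "\<And>N. N \<ge> 1 \<Longrightarrow> gaussian_matrices (M N) N (\<sigma> N) (W N)"
    and fin: "\<And>a. fin_digraph (G a)"
    and conn: "\<And>a. Digraph_Component.connected (G a)"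
begin

definition X :: "nat \<Rightarrow> 'm \<Rightarrow> 'a \<Rightarrow> real" where
  "X N a \<omega> = normalized_value N (\<sigma> N) (G a) (inp a) (\<lambda>l. W N l \<omega>)"

definition \<mu> :: "nat \<Rightarrow> 'm \<Rightarrow> real" where "\<mu> N a = (\<integral>\<omega>. X N a \<omega> \<partial>M N)"

definition centred :: "nat \<Rightarrow> 'm \<Rightarrow> 'a \<Rightarrow> real" where "centred N a \<omega> = X N a \<omega> - \<mu> N a"

definition cmoment :: "nat \<Rightarrow> (nat \<Rightarrow> 'm) \<Rightarrow> nat set \<Rightarrow> real" where
  "cmoment N a J = (\<integral>\<omega>. (\<Prod>j\<in>J. centred N (a j) \<omega>) \<partial>M N)"

definition C :: "'m \<Rightarrow> 'm \<Rightarrow> real" where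
  "C a b = real (card (biatomic_pairings (G a) (inp a) (G b) (inp b)))"

lemma X_prod_integrable:
  assumes "N \<ge> 1" "finite J"
  shows "integrable (M N) (\<lambda>\<omega>. \<Prod>j\<in>J. X N (a (j::nat)) \<omega>)"
proof -
  interpret gaussian_matrices "M N" N "\<sigma> N" "W N" by (rule gm) fact
  show ?thesis
    unfolding X_def by (rule family_moment(1)[where I = J]) (use assms fin in auto)
qed

lemma centred_prod:
  assumes "finite J"
  shows "(\<Prod>j\<in>J. centred N (a j) \<omega>) = (\<Sum>S\<in>Pow J. (\<Prod>j\<in>S. X N (a j) \<omega>) * (\<Prod>j\<in>J - S. - \<mu> N (a j)))"
  using prod_add[OF assms, of "\<lambda>j. X N (a j) \<omega>" "\<lambda>j. - \<mu> N (a j)"] by (simp add: centred_def)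

lemma centred_prod_integrable:
  assumes N: "N \<ge> 1" and J: "finite J"
  shows "integrable (M N) (\<lambda>\<omega>. \<Prod>j\<in>J. centred N (a (j::nat)) \<omega>)"
  unfolding centred_prod[OF J]
  by (intro Bochner_Integration.integrable_sum integrable_mult_left X_prod_integrable N)
    (use J finite_subset in auto)

lemma cmoment_eq:
  assumes N: "N \<ge> 1" and J: "finite J"
  shows "cmoment N a J = (\<Sum>S\<in>Pow J. (\<integral>\<omega>. (\<Prod>j\<in>S. X N (a j) \<omega>) \<partial>M N) * (\<Prod>j\<in>J - S. - \<mu> N (a j)))"
proof -
  have "integrable (M N) (\<lambda>\<omega>. \<Prod>j\<in>S. X N (a j) \<omega>)" if "S \<in> Pow J" for S
    by (rule X_prod_integrable[OF N]) (use J that finite_subset in auto)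
  then show ?thesis
    unfolding cmoment_def centred_prod[OF J] by (subst Bochner_Integration.integral_sum) auto
qed

abbreviation family where "family J a \<equiv> family_union J (\<lambda>i. G (a i))"
abbreviation family_inp where "family_inp a \<equiv> (\<lambda>(j, e). inp (a j) e)"
abbreviation cumulant where "cumulant I a N B \<equiv> colored_digraph.graph_cumulant (family I a) fst (family_inp a) N B"

text \<open>A single union over \<open>insert j J\<close> carries the moments and cumulants of all
  subsets, so that one coloured graph serves the whole recursion.\<close>

lemma cmoment_insert:
  assumes N: "N \<ge> 1" and J: "finite J" "j \<notin> J"
  shows "cmoment N a (insert j J) = (\<Sum>B\<in>Pow J - {{}}. cumulant (insert j J) a N (insert j B) * cmoment N a (J - B))"
proof -
  interpret gaussian_matrices "M N" N "\<sigma> N" "W N" by (rule gm) fact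
  define I where "I = insert j J"
  have I: "finite I" using J by (simp add: I_def)
  interpret colored_digraph "family I a" fst "family_inp a"
    by (rule colored_digraph_family_union) (use I fin in auto)
  have m: "expectation (\<lambda>\<omega>. \<Prod>j\<in>S. X N (a j) \<omega>) = graph_moment N S" if "S \<subseteq> I" for S
    unfolding X_def by (rule family_moment(2)) (use I fin that in auto)
  have \<mu>: "\<mu> N (a i) = graph_cumulant N {i}" if "i \<in> I" for i
    using m[of "{i}"] that N by (simp add: \<mu>_def graph_cumulant_single)
  have cmoment: "cmoment N a K = (\<Sum>S\<in>Pow K. graph_moment N S * (\<Prod>i\<in>K - S. - graph_cumulant N {i}))" if K: "K \<subseteq> I" for K
  proof -
    have "finite K" using K I finite_subset by auto
    show ?thesis
      unfolding cmoment_eq[OF N \<open>finite K\<close>]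
    proof (rule sum.cong[OF refl])
      fix S assume S: "S \<in> Pow K"
      then have "S \<subseteq> I" using K by auto
      moreover have "(\<Prod>i\<in>K - S. - \<mu> N (a i)) = (\<Prod>i\<in>K - S. - graph_cumulant N {i})"
        by (rule prod.cong) (use \<mu> K in auto)
      ultimately show "expectation (\<lambda>\<omega>. \<Prod>j\<in>S. X N (a j) \<omega>) * (\<Prod>i\<in>K - S. - \<mu> N (a i)) =
          graph_moment N S * (\<Prod>i\<in>K - S. - graph_cumulant N {i})"
        by (simp add: m)
    qed
  qed
  have "(\<Sum>S\<in>Pow (insert j J). graph_moment N S * (\<Prod>i\<in>insert j J - S. - graph_cumulant N {i})) =
      (\<Sum>B\<in>Pow J - {{}}. graph_cumulant N (insert j B) *
        (\<Sum>S\<in>Pow (J - B). graph_moment N S * (\<Prod>i\<in>J - B - S. - graph_cumulant N {i})))"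
    by (rule centred_moment_recursion) (use J N finite_subset in \<open>auto intro!: graph_moment_insert\<close>)
  moreover have "cmoment N a (insert j J) =
      (\<Sum>S\<in>Pow (insert j J). graph_moment N S * (\<Prod>i\<in>insert j J - S. - graph_cumulant N {i}))"
    by (rule cmoment) (simp add: I_def)
  moreover have "cmoment N a (J - B) = (\<Sum>S\<in>Pow (J - B). graph_moment N S * (\<Prod>i\<in>J - B - S. - graph_cumulant N {i}))" for B
    by (rule cmoment) (auto simp: I_def)
  ultimately show ?thesis by (simp add: I_def)
qed

lemma disjoint_union_cumulant_tendsto:
  "(\<lambda>N. colored_digraph.graph_cumulant (disjoint_union (G a) (G b)) sum_color (case_sum (inp a) (inp b)) N {0, 1})
    \<longlonglongrightarrow> C a b"
proof -
  interpret colored_digraph "disjoint_union (G a) (G b)" sum_color "case_sum (inp a) (inp b)"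
    by (rule colored_digraph_disjoint_union[OF fin fin])
  have "(\<lambda>N. graph_cumulant N {0, 1}) \<longlonglongrightarrow>
      (if card {0::nat, 1} = 2 then real (card (tree_pairings (restr {0, 1}) (case_sum (inp a) (inp b)))) else 0)"
  proof (rule graph_cumulant_tendsto)
    fix j :: nat assume "j \<in> {0, 1}"
    then consider "j = 0" | "j = 1" by auto
    then show "Digraph_Component.connected (restr {j})"
    proof cases
      case 1
      show ?thesis
        unfolding 1 by (rule iso_connected[OF graph_iso_Inl[of "G a" "inp a" "G b" "inp b"] fin fin_digraph_restr conn])
    next
      case 2
      show ?thesis
        unfolding 2 by (rule iso_connected[OF graph_iso_Inr[of "G b" "inp b" "G a" "inp a"] fin fin_digraph_restr conn])
    qed
  qed auto
  moreover have "card {0::nat, 1} = 2" by simp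
  ultimately show ?thesis
    unfolding C_def biatomic_pairings_def color_part_disjoint_union[OF fin fin] by (simp only: if_True simp_thms)
qed

lemma cumulant_tendsto:
  assumes J: "finite J" "j \<notin> J" and B: "B \<in> Pow J - {{}}"
  shows "(\<lambda>N. cumulant (insert j J) a N (insert j B)) \<longlonglongrightarrow>
    (if card B = 1 then C (a j) (a (the_elem B)) else 0)"
proof -
  define I where "I = insert j J"
  have I: "finite I" using J by (simp add: I_def)
  interpret colored_digraph "family I a" fst "family_inp a"
    by (rule colored_digraph_family_union) (use I fin in auto)
  have finB: "finite B" using B J finite_subset by auto
  show ?thesis
  proof (cases "card B = 1")
    case True
    then obtain k where k: "B = {k}" by (auto simp: card_1_singleton_iff)
    have kj: "j \<noteq> k" "k \<in> I" using B J k by (auto simp: I_def)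
    \<comment> \<open>The pairings of the two unions are not matched directly: for every positive N
      both cumulants equal the covariance of the same two normalised values.\<close>
    have eq: "graph_cumulant N {j, k} =
        colored_digraph.graph_cumulant (disjoint_union (G (a j)) (G (a k))) sum_color
          (case_sum (inp (a j)) (inp (a k))) N {0, 1}" if N: "N \<ge> 1" for N
    proof -
      interpret gaussian_matrices "M N" N "\<sigma> N" "W N" by (rule gm) fact
      have m: "expectation (\<lambda>\<omega>. \<Prod>j\<in>S. X N (a j) \<omega>) = graph_moment N S" if "S \<subseteq> I" for S
        unfolding X_def by (rule family_moment(2)) (use I fin that in auto)
      have "graph_cumulant N {j, k} =
          expectation (\<lambda>\<omega>. X N (a j) \<omega> * X N (a k) \<omega>) - expectation (X N (a j)) * expectation (X N (a k))"
        unfolding graph_cumulant_pair[OF kj(1) N]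
        using m[of "{j, k}"] m[of "{j}"] m[of "{k}"] kj by (simp add: I_def)
      then show ?thesis
        unfolding X_def disjoint_union_cumulant[OF fin fin] .
    qed
    have "\<forall>\<^sub>F N in sequentially. colored_digraph.graph_cumulant (disjoint_union (G (a j)) (G (a k))) sum_color
          (case_sum (inp (a j)) (inp (a k))) N {0, 1} = graph_cumulant N {j, k}"
      using eventually_ge_at_top[of 1] by eventually_elim (simp only: eq)
    from Lim_transform_eventually[OF disjoint_union_cumulant_tendsto this]
    show ?thesis by (simp add: k I_def)
  next
    case False
    have "j \<notin> B" using B J by auto
    moreover have "B \<noteq> {}" using B by simp
    ultimately have c: "card (insert j B) = Suc (card B)" "card B \<ge> 1"
      using finB by (simp_all add: Suc_le_eq card_gt_0_iff)
    have "(\<lambda>N. graph_cumulant N (insert j B)) \<longlonglongrightarrow>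
        (if card (insert j B) = 2 then real (card (tree_pairings (restr (insert j B)) (family_inp a))) else 0)"
    proof (rule graph_cumulant_tendsto)
      fix i assume "i \<in> insert j B"
      then have "i \<in> I" using B by (auto simp: I_def)
      from graph_iso_family_union[OF this, of "\<lambda>i. G (a i)" "\<lambda>i. inp (a i)"]
      show "Digraph_Component.connected (restr {i})"
        by (rule iso_connected[OF _ fin fin_digraph_restr conn])
    qed (use c finB in auto)
    then show ?thesis using c False by (simp add: I_def)
  qed
qed

text \<open>Meaningful once \<open>cmoment_tendsto\<close> has shown convergence. The recursion
  \<open>cmoment_insert_tendsto\<close> serves first for that and then, by uniqueness of limits, for
  \<open>L_insert\<close>.\<close>

definition L :: "(nat \<Rightarrow> 'm) \<Rightarrow> nat set \<Rightarrow> real" where "L a J = lim (\<lambda>N. cmoment N a J)"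

lemma L_cong: "(\<And>j. j \<in> J \<Longrightarrow> a j = b j) \<Longrightarrow> L a J = L b J"
  unfolding L_def cmoment_def by (simp cong: prod.cong)

text \<open>Only cumulants of two graphs survive in the limit of \<open>cmoment_insert\<close>, and
  what remains is the recursion of Isserlis' theorem for a centred Gaussian vector.\<close>

lemma cmoment_insert_tendsto:
  assumes J: "finite J" "j \<notin> J" and IH: "\<And>K. K \<subseteq> J \<Longrightarrow> (\<lambda>N. cmoment N a K) \<longlonglongrightarrow> L a K"
  shows "(\<lambda>N. cmoment N a (insert j J)) \<longlonglongrightarrow> (\<Sum>k\<in>J. C (a j) (a k) * L a (J - {k}))"
proof -
  let ?c = "\<lambda>B. if card B = 1 then C (a j) (a (the_elem B)) else 0"
  have "(\<lambda>N. \<Sum>B\<in>Pow J - {{}}. cumulant (insert j J) a N (insert j B) * cmoment N a (J - B)) \<longlonglongrightarrow>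
      (\<Sum>B\<in>Pow J - {{}}. ?c B * L a (J - B))"
    by (intro tendsto_sum tendsto_mult cumulant_tendsto J IH) auto
  moreover have "\<forall>\<^sub>F N in sequentially.
      (\<Sum>B\<in>Pow J - {{}}. cumulant (insert j J) a N (insert j B) * cmoment N a (J - B)) = cmoment N a (insert j J)"
    using eventually_ge_at_top[of 1] by eventually_elim (simp only: cmoment_insert[OF _ J])
  ultimately have "(\<lambda>N. cmoment N a (insert j J)) \<longlonglongrightarrow> (\<Sum>B\<in>Pow J - {{}}. ?c B * L a (J - B))"
    by (rule Lim_transform_eventually)
  also have "(\<Sum>B\<in>Pow J - {{}}. ?c B * L a (J - B)) = (\<Sum>B\<in>(\<lambda>k. {k}) ` J. ?c B * L a (J - B))"
  proof (rule sum.mono_neutral_right)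
    show "\<forall>B\<in>Pow J - {{}} - (\<lambda>k. {k}) ` J. ?c B * L a (J - B) = 0"
      by (auto simp: card_1_singleton_iff)
  qed (use J in auto)
  also have "\<dots> = (\<Sum>k\<in>J. C (a j) (a k) * L a (J - {k}))"
    by (subst sum.reindex) (auto intro: inj_onI)
  finally show ?thesis .
qed

lemma cmoment_empty: "N \<ge> 1 \<Longrightarrow> cmoment N a {} = 1"
  using gm[of N] by (simp add: cmoment_def gaussian_matrices_def prob_space.prob_space)

lemma cmoment_tendsto: "finite J \<Longrightarrow> (\<lambda>N. cmoment N a J) \<longlonglongrightarrow> L a J"
proof (induction "card J" arbitrary: J rule: less_induct)
  case less
  have "convergent (\<lambda>N. cmoment N a J)"
  proof (cases "J = {}")
    case True
    have "\<forall>\<^sub>F N in sequentially. cmoment N a J = 1"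
      using eventually_ge_at_top[of 1] by eventually_elim (simp add: True cmoment_empty)
    then show ?thesis by (auto intro!: convergentI tendsto_eventually)
  next
    case False
    then obtain j where j: "j \<in> J" by auto
    have "(\<lambda>N. cmoment N a (insert j (J - {j}))) \<longlonglongrightarrow> (\<Sum>k\<in>J - {j}. C (a j) (a k) * L a (J - {j} - {k}))"
    proof (rule cmoment_insert_tendsto)
      fix K assume K: "K \<subseteq> J - {j}"
      show "(\<lambda>N. cmoment N a K) \<longlonglongrightarrow> L a K"
      proof (rule less.hyps)
        show "card K < card J" by (rule psubset_card_mono) (use K j less.prems in auto)
        show "finite K" using K less.prems finite_subset by blast
      qed
    qed (use less.prems in auto)
    then show ?thesis using j by (auto simp: insert_absorb intro: convergentI)
  qed
  then show ?case unfolding L_def by (simp add: convergent_LIMSEQ_iff)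
qed

lemma L_empty: "L a {} = 1"
proof (rule LIMSEQ_unique[OF cmoment_tendsto])
  have "\<forall>\<^sub>F N in sequentially. cmoment N a {} = 1"
    using eventually_ge_at_top[of 1] by eventually_elim (simp add: cmoment_empty)
  then show "(\<lambda>N. cmoment N a {}) \<longlonglongrightarrow> 1" by (rule tendsto_eventually)
qed simp

lemma L_insert:
  assumes "finite J" "j \<notin> J"
  shows "L a (insert j J) = (\<Sum>k\<in>J. C (a j) (a k) * L a (J - {k}))"
proof (rule LIMSEQ_unique[OF cmoment_tendsto])
  show "(\<lambda>N. cmoment N a (insert j J)) \<longlonglongrightarrow> (\<Sum>k\<in>J. C (a j) (a k) * L a (J - {k}))"
    by (rule cmoment_insert_tendsto[OF assms]) (use assms finite_subset in \<open>blast intro: cmoment_tendsto\<close>)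
qed (use assms in simp)

section \<open>Linear forms of the centred values and their covariance\<close>

definition linear_form :: "('m \<Rightarrow> real) \<Rightarrow> nat \<Rightarrow> 'a \<Rightarrow> real" where
  "linear_form t N \<omega> = (\<Sum>b\<in>UNIV. t b * centred N b \<omega>)"

lemma linear_form_power:
  "linear_form t N \<omega> ^ k =
    (\<Sum>a\<in>{..<k} \<rightarrow>\<^sub>E UNIV. (\<Prod>j\<in>{..<k}. t (a j)) * (\<Prod>j\<in>{..<k}. centred N (a j) \<omega>))"
proof -
  have "linear_form t N \<omega> ^ k = (\<Prod>j\<in>{..<k}. \<Sum>b\<in>UNIV. t b * centred N b \<omega>)"
    by (simp add: linear_form_def)
  also have "\<dots> = (\<Sum>a\<in>{..<k} \<rightarrow>\<^sub>E UNIV. \<Prod>j\<in>{..<k}. t (a j) * centred N (a j) \<omega>)"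
    by (rule prod_sum_PiE) auto
  finally show ?thesis by (simp add: prod.distrib)
qed

lemma linear_form_power_integrable: "N \<ge> 1 \<Longrightarrow> integrable (M N) (\<lambda>\<omega>. linear_form t N \<omega> ^ k)"
  unfolding linear_form_power
  by (intro Bochner_Integration.integrable_sum integrable_mult_right centred_prod_integrable) auto

lemma linear_form_moment:
  assumes "N \<ge> 1"
  shows "(\<integral>\<omega>. linear_form t N \<omega> ^ k \<partial>M N) = (\<Sum>a\<in>{..<k} \<rightarrow>\<^sub>E UNIV. (\<Prod>j\<in>{..<k}. t (a j)) * cmoment N a {..<k})"
  unfolding linear_form_power cmoment_def
  using centred_prod_integrable[OF assms, of "{..<k}"] by (subst Bochner_Integration.integral_sum) auto

lemma covariance_tendsto: "(\<lambda>N. \<integral>\<omega>. centred N a \<omega> * centred N b \<omega> \<partial>M N) \<longlonglongrightarrow> C a b"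
proof -
  \<comment> \<open>Two positions, which carry the same graph when a = b.\<close>
  define c where "c j = (if j = (0::nat) then a else b)" for j
  have "L c (insert 0 {1}) = C a b"
    by (subst L_insert) (auto simp: c_def L_empty)
  then have "(\<lambda>N. cmoment N c {0, 1}) \<longlonglongrightarrow> C a b" using cmoment_tendsto[of "{0, 1}" c] by simp
  then show ?thesis by (simp add: cmoment_def c_def)
qed

lemma C_sym: "C a b = C b a"
  by (rule LIMSEQ_unique[OF covariance_tendsto]) (use covariance_tendsto[of b a] in \<open>simp add: mult.commute\<close>)

lemma centred_mult_integrable:
  assumes "N \<ge> 1"
  shows "integrable (M N) (\<lambda>\<omega>. centred N a \<omega> * centred N b \<omega>)"
  using centred_prod_integrable[OF assms, of "{0, 1}" "\<lambda>j. if j = 0 then a else b"] by simp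

lemma centred_integrable: "N \<ge> 1 \<Longrightarrow> integrable (M N) (centred N a)"
  using centred_prod_integrable[of N "{0}" "\<lambda>_. a"] by simp

lemma centred_mean:
  assumes "N \<ge> 1"
  shows "(\<integral>\<omega>. centred N a \<omega> \<partial>M N) = 0"
proof -
  interpret gaussian_matrices "M N" N "\<sigma> N" "W N" by (rule gm) fact
  have "integrable (M N) (X N a)" using X_prod_integrable[OF assms, of "{0}" "\<lambda>_. a"] by simp
  then show ?thesis by (simp add: centred_def \<mu>_def prob_space)
qed

text \<open>Positivity is not apparent from counts of bi-atomic pairings; it passes to the limit
  from the second moments of linear forms.\<close>

lemma C_psd: "0 \<le> (\<Sum>a\<in>UNIV. \<Sum>b\<in>UNIV. t a * t b * C a b)"
proof (rule tendsto_lowerbound)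
  show "(\<lambda>N. \<Sum>a\<in>UNIV. \<Sum>b\<in>UNIV. t a * t b * (\<integral>\<omega>. centred N a \<omega> * centred N b \<omega> \<partial>M N)) \<longlonglongrightarrow>
      (\<Sum>a\<in>UNIV. \<Sum>b\<in>UNIV. t a * t b * C a b)"
    by (intro tendsto_intros covariance_tendsto)
  show "\<forall>\<^sub>F N in sequentially. 0 \<le> (\<Sum>a\<in>UNIV. \<Sum>b\<in>UNIV. t a * t b * (\<integral>\<omega>. centred N a \<omega> * centred N b \<omega> \<partial>M N))"
    using eventually_ge_at_top[of 1]
  proof eventually_elim
    case (elim N)
    have "(\<Sum>a\<in>UNIV. \<Sum>b\<in>UNIV. t a * t b * (\<integral>\<omega>. centred N a \<omega> * centred N b \<omega> \<partial>M N)) =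
        (\<integral>\<omega>. (\<Sum>a\<in>UNIV. \<Sum>b\<in>UNIV. t a * t b * (centred N a \<omega> * centred N b \<omega>)) \<partial>M N)"
      using centred_mult_integrable[OF elim] by (simp add: Bochner_Integration.integral_sum)
    also have "\<dots> = (\<integral>\<omega>. (linear_form t N \<omega>)\<^sup>2 \<partial>M N)"
      by (simp add: linear_form_def power2_eq_square sum_product mult_ac)
    finally show ?case by simp
  qed
qed simp

lemma linear_form_char_tendsto:
  "(\<lambda>N. CLINT \<omega>|M N. iexp (linear_form t N \<omega>)) \<longlonglongrightarrow>
     complex_of_real (exp (- (\<Sum>a\<in>UNIV. \<Sum>b\<in>UNIV. t a * t b * C a b) / 2))"
proof -
  define q where "q = (\<Sum>a\<in>UNIV. \<Sum>b\<in>UNIV. t a * t b * C a b)"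
  have q: "q \<ge> 0" unfolding q_def by (rule C_psd)
  have "(\<lambda>N. CLINT \<omega>|M N. iexp (linear_form t N \<omega>)) \<longlonglongrightarrow> complex_of_real (exp (- ((sqrt q)\<^sup>2) / 2))"
  proof (rule moments_imp_char_tendsto)
    show "\<forall>\<^sub>F N in sequentially. prob_space (M N)"
      using eventually_ge_at_top[of 1] by eventually_elim (use gm in \<open>auto simp: gaussian_matrices_def\<close>)
    show "\<forall>\<^sub>F N in sequentially. \<forall>k. integrable (M N) (\<lambda>\<omega>. linear_form t N \<omega> ^ k)"
      using eventually_ge_at_top[of 1] by eventually_elim (simp add: linear_form_power_integrable)
    fix k
    have "(\<lambda>N. \<Sum>a\<in>{..<k} \<rightarrow>\<^sub>E UNIV. (\<Prod>j\<in>{..<k}. t (a j)) * cmoment N a {..<k}) \<longlonglongrightarrow>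
        (\<Sum>a\<in>{..<k} \<rightarrow>\<^sub>E UNIV. (\<Prod>j\<in>{..<k}. t (a j)) * L a {..<k})"
      by (intro tendsto_sum tendsto_mult tendsto_const cmoment_tendsto) auto
    also have "(\<Sum>a\<in>{..<k} \<rightarrow>\<^sub>E UNIV. (\<Prod>j\<in>{..<k}. t (a j)) * L a {..<k}) =
        sqrt q ^ card {..<k} * gauss_moment (card {..<k})"
      by (rule wick_sum[where C = C, OF L_cong L_empty L_insert q_def q]) auto
    finally have lim: "(\<lambda>N. \<Sum>a\<in>{..<k} \<rightarrow>\<^sub>E UNIV. (\<Prod>j\<in>{..<k}. t (a j)) * cmoment N a {..<k}) \<longlonglongrightarrow>
        sqrt q ^ k * gauss_moment k" by simp
    have "\<forall>\<^sub>F N in sequentially. (\<Sum>a\<in>{..<k} \<rightarrow>\<^sub>E UNIV. (\<Prod>j\<in>{..<k}. t (a j)) * cmoment N a {..<k}) =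
        (\<integral>\<omega>. linear_form t N \<omega> ^ k \<partial>M N)"
      using eventually_ge_at_top[of 1] by eventually_elim (simp only: linear_form_moment)
    with lim show "(\<lambda>N. \<integral>\<omega>. linear_form t N \<omega> ^ k \<partial>M N) \<longlonglongrightarrow> sqrt q ^ k * gauss_moment k"
      by (rule Lim_transform_eventually)
  qed
  then show ?thesis using q by (simp add: q_def)
qed

section \<open>Convergence in distribution of the normalised values\<close>

text \<open>The deterministic error made by subtracting the leading term of the mean instead of the
  mean itself.\<close>

definition \<delta> :: "nat \<Rightarrow> 'm \<Rightarrow> real" where
  "\<delta> N a = \<mu> N a - real (card (atomic_pairings (G a) (inp a))) * sqrt (real N)"

definition value_vector :: "nat \<Rightarrow> 'a \<Rightarrow> real ^ 'm" where
  "value_vector N \<omega> = (\<chi> a. X N a \<omega> - real (card (atomic_pairings (G a) (inp a))) * sqrt (real N))"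

lemma value_vector_nth: "value_vector N \<omega> $ a = centred N a \<omega> + \<delta> N a"
  by (simp add: value_vector_def centred_def \<delta>_def)

lemma \<delta>_tendsto: "(\<lambda>N. \<delta> N a) \<longlonglongrightarrow> 0"
proof (rule Lim_null_comparison)
  define K where "K = real (card (admissible_pairings (G a) (inp a)))"
  show "\<forall>\<^sub>F N in sequentially. norm (\<delta> N a) \<le> K * real N powr (- 1 / 2)"
    using eventually_ge_at_top[of 1]
  proof eventually_elim
    case (elim N)
    interpret gaussian_matrices "M N" N "\<sigma> N" "W N" by (rule gm) fact
    show ?case
      using normalized_value_mean_estimate[OF fin conn] by (simp add: \<delta>_def \<mu>_def X_def K_def)
  qed
  have "(\<lambda>N. real N powr (- 1 / 2)) \<longlonglongrightarrow> 0"
    by (rule tendsto_neg_powr[OF _ filterlim_real_sequentially]) simp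
  from tendsto_mult_left[OF this, of K] show "(\<lambda>N. K * real N powr (- 1 / 2)) \<longlonglongrightarrow> 0" by simp
qed

lemma value_vector_measurable:
  assumes "N \<ge> 1"
  shows "value_vector N \<in> borel_measurable (M N)"
proof -
  have [measurable]: "centred N a \<in> borel_measurable (M N)" for a
    using centred_integrable[OF assms] by (rule borel_measurable_integrable)
  show ?thesis
    unfolding borel_measurable_euclidean_space[of "value_vector N"]
    by (auto simp: Basis_vec_def inner_axis value_vector_nth)
qed

text \<open>Prepares the second moment bound of the continuity theorem; the mixed term drops out
  because \<open>centred\<close> has mean 0.\<close>

lemma value_vector_second_moment:
  assumes "N \<ge> 1"
  shows "integrable (M N) (\<lambda>\<omega>. (norm (value_vector N \<omega>))\<^sup>2)"
    and "(\<integral>\<omega>. (norm (value_vector N \<omega>))\<^sup>2 \<partial>M N) = (\<Sum>a\<in>UNIV. (\<integral>\<omega>. centred N a \<omega> * centred N a \<omega> \<partial>M N) + (\<delta> N a)\<^sup>2)"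
proof -
  interpret gaussian_matrices "M N" N "\<sigma> N" "W N" by (rule gm) fact
  have eq: "(norm (value_vector N \<omega>))\<^sup>2 = (\<Sum>a\<in>UNIV. centred N a \<omega> * centred N a \<omega> + 2 * \<delta> N a * centred N a \<omega> + (\<delta> N a)\<^sup>2)" for \<omega>
    unfolding power2_norm_eq_inner inner_vec_def value_vector_nth
    by (simp add: power2_eq_square algebra_simps)
  have int: "integrable (M N) (\<lambda>\<omega>. centred N a \<omega> * centred N a \<omega> + 2 * \<delta> N a * centred N a \<omega> + (\<delta> N a)\<^sup>2)" for a
    using centred_mult_integrable[OF assms] centred_integrable[OF assms] by auto
  show "integrable (M N) (\<lambda>\<omega>. (norm (value_vector N \<omega>))\<^sup>2)"
    unfolding eq using int by (intro Bochner_Integration.integrable_sum)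
  have "(\<integral>\<omega>. centred N a \<omega> * centred N a \<omega> + 2 * \<delta> N a * centred N a \<omega> + (\<delta> N a)\<^sup>2 \<partial>M N) =
      (\<integral>\<omega>. centred N a \<omega> * centred N a \<omega> \<partial>M N) + (\<delta> N a)\<^sup>2" for a
    using centred_mult_integrable[OF assms] centred_integrable[OF assms] centred_mean[OF assms] by (simp add: prob_space)
  then show "(\<integral>\<omega>. (norm (value_vector N \<omega>))\<^sup>2 \<partial>M N) = (\<Sum>a\<in>UNIV. (\<integral>\<omega>. centred N a \<omega> * centred N a \<omega> \<partial>M N) + (\<delta> N a)\<^sup>2)"
    unfolding eq by (subst Bochner_Integration.integral_sum) (use int in auto)
qed

lemma value_vector_char_tendsto:
  "(\<lambda>N. CLINT \<omega>|M N. iexp (t \<bullet> value_vector N \<omega>)) \<longlonglongrightarrow>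
     complex_of_real (exp (- (\<Sum>a\<in>UNIV. \<Sum>b\<in>UNIV. t $ a * t $ b * C a b) / 2))"
proof -
  \<comment> \<open>The error \<open>\<delta>\<close> is not random, so it splits off as a phase,
    which tends to 1.\<close>
  have eq: "(CLINT \<omega>|M N. iexp (t \<bullet> value_vector N \<omega>)) =
      iexp (\<Sum>a\<in>UNIV. t $ a * \<delta> N a) * (CLINT \<omega>|M N. iexp (linear_form (\<lambda>a. t $ a) N \<omega>))" for N
  proof -
    have "t \<bullet> value_vector N \<omega> = (\<Sum>a\<in>UNIV. t $ a * \<delta> N a) + linear_form (\<lambda>a. t $ a) N \<omega>" for \<omega>
      by (simp add: inner_vec_def value_vector_nth linear_form_def distrib_left sum.distrib)
    then have "(CLINT \<omega>|M N. iexp (t \<bullet> value_vector N \<omega>)) =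
        (CLINT \<omega>|M N. iexp (\<Sum>a\<in>UNIV. t $ a * \<delta> N a) * iexp (linear_form (\<lambda>a. t $ a) N \<omega>))"
      by (simp add: distrib_left exp_add del: of_real_sum)
    then show ?thesis by (simp only: integral_mult_right_zero)
  qed
  have "(\<lambda>N. \<Sum>a\<in>UNIV. t $ a * \<delta> N a) \<longlonglongrightarrow> (\<Sum>a\<in>UNIV. t $ a * 0)"
    by (intro tendsto_intros \<delta>_tendsto)
  then have "(\<lambda>N. iexp (\<Sum>a\<in>UNIV. t $ a * \<delta> N a)) \<longlonglongrightarrow> iexp (\<Sum>a\<in>UNIV. t $ a * 0)"
    by (intro tendsto_exp tendsto_mult tendsto_const tendsto_of_real)
  from tendsto_mult[OF this linear_form_char_tendsto[of "\<lambda>a. t $ a"]]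
  show ?thesis unfolding eq by simp
qed

lemma value_vector_converges:
  "\<exists>(P :: (real ^ 'm) measure) (Z :: real ^ 'm \<Rightarrow> real ^ 'm).
     prob_space P \<and> gaussian_vector P Z \<and> (\<forall>a. (\<integral>\<omega>. Z \<omega> $ a \<partial>P) = 0) \<and>
     (\<forall>a b. (\<integral>\<omega>. Z \<omega> $ a * Z \<omega> $ b \<partial>P) = C a b) \<and> converges_in_distribution M value_vector P Z"
proof -
  obtain P :: "(real ^ 'm) measure" where P: "prob_space P" "gaussian_vector P (\<lambda>x. x)"
    and law: "\<And>t. distr P borel (\<lambda>x. t \<bullet> x) =
        normal_law 0 (sqrt (\<Sum>a\<in>UNIV. \<Sum>b\<in>UNIV. t $ a * t $ b * C a b))"
    and setsP: "sets P = sets borel"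
    using gaussian_vector_exists[OF C_sym C_psd] by blast
  note Pfacts = setsP C_psd C_sym law
  have Z2: "integrable P (\<lambda>x. (norm x)\<^sup>2)" "(\<integral>x. (norm x)\<^sup>2 \<partial>P) = (\<Sum>a\<in>UNIV. C a a)"
  proof -
    have eq: "(norm x)\<^sup>2 = (\<Sum>a\<in>UNIV. x $ a * x $ a)" for x :: "real ^ 'm"
      by (simp add: power2_norm_eq_inner inner_vec_def)
    show "integrable P (\<lambda>x. (norm x)\<^sup>2)" "(\<integral>x. (norm x)\<^sup>2 \<partial>P) = (\<Sum>a\<in>UNIV. C a a)"
      unfolding eq
      using component_prod_integrable[OF Pfacts] component_covariance[OF Pfacts]
      by (simp_all add: Bochner_Integration.integral_sum)
  qed
  have "(\<lambda>N. \<Sum>a\<in>UNIV. (\<integral>\<omega>. centred N a \<omega> * centred N a \<omega> \<partial>M N) + (\<delta> N a)\<^sup>2) \<longlonglongrightarrow> (\<Sum>a\<in>UNIV. C a a + 0\<^sup>2)"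
    by (intro tendsto_intros covariance_tendsto \<delta>_tendsto)
  \<comment> \<open>Adding 1 to the limit makes the inequality hold eventually, and the same
    constant bounds the second moment of the limit vector.\<close>
  then have "\<forall>\<^sub>F N in sequentially.
      (\<Sum>a\<in>UNIV. (\<integral>\<omega>. centred N a \<omega> * centred N a \<omega> \<partial>M N) + (\<delta> N a)\<^sup>2) < (\<Sum>a\<in>UNIV. C a a) + 1"
    by (rule order_tendstoD) simp
  then have X2: "\<forall>\<^sub>F N in sequentially. integrable (M N) (\<lambda>\<omega>. (norm (value_vector N \<omega>))\<^sup>2) \<and>
      (\<integral>\<omega>. (norm (value_vector N \<omega>))\<^sup>2 \<partial>M N) \<le> (\<Sum>a\<in>UNIV. C a a) + 1"
    using eventually_ge_at_top[of 1] by eventually_elim (simp add: value_vector_second_moment)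
  have "converges_in_distribution M value_vector P (\<lambda>x. x)"
  proof (rule converges_in_distributionI_char[OF _ P(1) _ _ _ X2])
    show "\<forall>\<^sub>F N in sequentially. prob_space (M N)"
      using eventually_ge_at_top[of 1] by eventually_elim (use gm in \<open>auto simp: gaussian_matrices_def\<close>)
    show "\<forall>\<^sub>F N in sequentially. value_vector N \<in> borel_measurable (M N)"
      using eventually_ge_at_top[of 1] by eventually_elim (rule value_vector_measurable)
    show "(\<lambda>x. x) \<in> borel_measurable P" using P(2) by (simp add: gaussian_vector_def)
    show "(\<lambda>N. CLINT \<omega>|M N. iexp (t \<bullet> value_vector N \<omega>)) \<longlonglongrightarrow> (CLINT x|P. iexp (t \<bullet> x))" for t
      unfolding linear_form_char[OF Pfacts] by (rule value_vector_char_tendsto)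
  qed (use Z2 in auto)
  then show ?thesis
    using P component_mean[OF Pfacts] component_covariance[OF Pfacts] by (intro exI[of _ P] exI[of _ "\<lambda>x. x"]) simp
qed

end

theorem theorem7:
  fixes M :: "nat \<Rightarrow> 'a measure"
    and \<sigma> :: "nat \<Rightarrow> nat \<Rightarrow> real"
    and W :: "nat \<Rightarrow> nat \<Rightarrow> 'a \<Rightarrow> nat \<Rightarrow> nat \<Rightarrow> real"
    and G :: "nat \<Rightarrow> ('v, 'e) pre_digraph"
    and inp :: "nat \<Rightarrow> 'e \<Rightarrow> edge_input"
    and idx :: "'m::finite \<Rightarrow> nat"
  assumes "\<And>N. N \<ge> 1 \<Longrightarrow> prob_space (M N)"
    and "\<And>N l. N \<ge> 1 \<Longrightarrow> \<sigma> N l > 0"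
    and "\<And>N. N \<ge> 1 \<Longrightarrow> independent_gaussian_matrices (M N) N (\<sigma> N) (W N)"
    and "\<And>i. i \<ge> 1 \<Longrightarrow> fin_digraph (G i)"
    and "\<And>i. i \<ge> 1 \<Longrightarrow> Digraph_Component.connected (G i)"
    and "bij_betw idx (UNIV :: 'm set) {1..CARD('m)}"
  shows "\<exists>(P :: (real ^ 'm) measure) (Z :: real ^ 'm \<Rightarrow> real ^ 'm).
           prob_space P \<and> gaussian_vector P Z \<and>
           (\<forall>a. (\<integral>\<omega>. Z \<omega> $ a \<partial>P) = 0) \<and>
           (\<forall>a b. (\<integral>\<omega>. Z \<omega> $ a * Z \<omega> $ b \<partial>P) =
              real (card (biatomic_pairings (G (idx a)) (inp (idx a)) (G (idx b)) (inp (idx b))))) \<and>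
           converges_in_distribution M
             (\<lambda>N \<omega>. \<chi> a. let i = idx a in
                inverse (sigma_graph (\<sigma> N) (G i) (inp i) * real N powr (e_check (G i) (inp i) + 1/2))
                * graph_value (G i) (\<lambda>_. N) (\<lambda>_ _. 1)
                    (\<lambda>e. input_matrix (\<lambda>l. W N l \<omega>) (inp i e))
                - real (card (atomic_pairings (G i) (inp i))) * sqrt (real N))
             P Z"
proof -
  have idx: "idx a \<ge> 1" for a
    using bij_betwE[OF assms(6)] by auto
  interpret product_graphs M \<sigma> W "\<lambda>a. G (idx a)" "\<lambda>a. inp (idx a)"
  proof (rule product_graphs.intro)
    show "gaussian_matrices (M N) N (\<sigma> N) (W N)" if "N \<ge> 1" for N
      unfolding gaussian_matrices_def gaussian_matrices_axioms_def
      using assms(1-3)[OF that] that by blast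
    show "fin_digraph (G (idx a))" for a by (rule assms(4)[OF idx])
    show "Digraph_Component.connected (G (idx a))" for a by (rule assms(5)[OF idx])
  qed
  show ?thesis
    using value_vector_converges unfolding C_def value_vector_def[abs_def] X_def normalized_value_def Let_def .
qed

end
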